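(* Let $d\ge1$, let $f$ be a probability density on $\mathbb{R}^d$ with $\int f^5<\infty$, and let $(r_n)$ be positive reals with $r_n \to 0$ and $n^{3/2} r_n^d \to \infty$. Let $X_1,\ldots,X_n$ be i.i.d. with density $f$ and let $G_n$ be the graph on $[n]$ with edge $\{i,j\}$ ($i\neq j$) iff $\|X_i-X_j\|\le r_n$ (Euclidean norm). Let $\xi_{ij}$ be the indicator that $i$ and $j$ are adjacent and define $$W_2 = \frac{\sum_{1\le i<j<k\le n} \xi_{ki}\xi_{kj}\xi_{ij}}{\sum_{1\le i<j<k\le n}\xi_{ki}\xi_{kj}}$$ (with an arbitrary fixed value when the denominator vanishes). Let $w_d = \mathbb{P}\{\|X-Y\|\le1\}$ for $X,Y$ independent uniform on the unit ball of $\mathbb{R}^d$. Then $W_2 \to w_d$ in probability as $n\to\infty$, and hence $\Delta_n = \mathrm{argmin}_{s\ge1}|W_2 - w_s| \to d$ in probability. *)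

theory Defs
  imports "HOL-Probability.Probability"
begin

text \<open>Euclidean space R^d is represented uniformly in d as functions nat => real
  restricted to the coordinates {..<d}; Lebesgue measure on R^d is the product
  of d copies of lborel.\<close>

definition lebd :: "nat \<Rightarrow> (nat \<Rightarrow> real) measure" where
  "lebd d = (\<Pi>\<^sub>M i\<in>{..<d}. lborel)"

definition enorm :: "nat \<Rightarrow> (nat \<Rightarrow> real) \<Rightarrow> real" where
  "enorm d x = sqrt (\<Sum>i<d. (x i)\<^sup>2)"

definition unit_ball_d :: "nat \<Rightarrow> (nat \<Rightarrow> real) set" where
  "unit_ball_d d = {x \<in> space (lebd d). enorm d x \<le> 1}"

definition w :: "nat \<Rightarrow> real" where
  "w d = measure (uniform_measure (lebd d) (unit_ball_d d) \<Otimes>\<^sub>M uniform_measure (lebd d) (unit_ball_d d))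
            {p \<in> space (lebd d \<Otimes>\<^sub>M lebd d). enorm d (\<lambda>i. fst p i - snd p i) \<le> 1}"

definition adj :: "nat \<Rightarrow> real \<Rightarrow> (nat \<Rightarrow> nat \<Rightarrow> real) \<Rightarrow> nat \<Rightarrow> nat \<Rightarrow> bool" where
  "adj d r x i j \<longleftrightarrow> enorm d (\<lambda>l. x i l - x j l) \<le> r"

definition W2 :: "real \<Rightarrow> nat \<Rightarrow> real \<Rightarrow> nat \<Rightarrow> (nat \<Rightarrow> nat \<Rightarrow> real) \<Rightarrow> real" where
  "W2 c d r n x =
    (let num = card {(i,j,k). i < j \<and> j < k \<and> k < n \<and> adj d r x k i \<and> adj d r x k j \<and> adj d r x i j};
         den = card {(i,j,k). i < j \<and> j < k \<and> k < n \<and> adj d r x k i \<and> adj d r x k j}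
     in if den = 0 then c else real num / real den)"

end

theory Submission
  imports Defs
begin

text \<open>
  Numerator and denominator of \<open>W\<^sub>2\<close> count the triples \<open>i < j < k\<close> forming a triangle, respectively a
  path centred at \<open>k\<close>. Rescaling around \<open>X\<^sub>k\<close>, the probability of either shape is \<open>r^(2 d)\<close> times the
  integral over a bounded set \<open>K\<close> of \<open>(a, b)\<close> of \<open>\<integral> f(z) f(z + r a) f(z + r b) dz\<close>. As \<open>r \<rightarrow> 0\<close> this inner
  integral tends to \<open>\<integral> f\<^sup>3\<close>: it is at most that by AM-GM, and truncating \<open>f\<close> reduces the lower bound to
  continuity of translations in \<open>L\<^sup>1\<close>. The ratio of the volumes of the two sets \<open>K\<close> is \<open>w d\<close>.

  In the variance of a count only pairs of overlapping triples contribute; their union is a set of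
  \<open>u \<in> {3, 4, 5}\<close> points with pairwise distances at most \<open>4 r\<close>, which has probability
  \<open>O(r^(d (u - 1)) \<integral> f^u)\<close>. Relative to the squared mean this is negligible because \<open>n^(3/2) r^d \<rightarrow> \<infinity>\<close>, and
  Chebyshev's inequality applies.

  For the argmin it remains to see that \<open>w\<close> is strictly decreasing. By rotation invariance and symmetry
  of the ball, \<open>w d = E[min(1, 2 \<bar>Y\<bar>)^d]\<close> with \<open>Y\<close> a coordinate of a uniform point of the unit ball, that
  is, a variable with density proportional to \<open>(1 - t\<^sup>2)^((d - 1) / 2)\<close>; passing from \<open>d\<close> to \<open>d + 1\<close> lowers both
  the integrand and, by Chebyshev's integral inequality, the weight of large \<open>\<bar>t\<bar>\<close>.
\<close>

section \<open>Affine maps and shears of Lebesgue measure\<close>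

text \<open>The dimension \<open>d\<close> is a variable, and monotonicity of \<open>w\<close>
  compares different dimensions, so geometry is done coordinatewise on product measures: dilations
  and translations are affine maps, rotations are products of shears. The density is only measurable
  and integrable to some powers, so values of \<open>f\<close> at nearby points cannot be compared
  pointwise; the comparison is made only after integration. Truncation at a level \<open>B\<close>
  lets L^1 continuity suffice: with factors bounded by \<open>B\<close>, exchanging one of them for
  its shifted copy costs at most \<open>B^2\<close> times an L^1 distance. The exponent 3/2 comes
  from the overlap size u = 3. Relative to the squared mean, of order \<open>n^6 r^(4 d)\<close>,
  the sizes 3, 4, 5 contribute orders \<open>1/(n^3 r^(2 d))\<close>, \<open>1/(n^2 r^d)\<close> and
  \<open>1/n\<close>. The first is the inverse square of \<open>n^(3/2) r^d\<close>, the second is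
  at most its inverse. The fifth moment belongs to u = 5, two triples that share one point. The
  argmin ranges over infinitely many s, so \<open>w s \<noteq> w d\<close> for each s would not be
  enough: a positive gap is required, and monotonicity reduces it to the neighbours of
  \<open>d\<close>.\<close>

interpretation leb_prod: product_sigma_finite "\<lambda>_::nat. lborel :: real measure"
  by standard

lemma space_lebd: "space (lebd d) = {..<d} \<rightarrow>\<^sub>E UNIV"
  by (simp add: lebd_def space_PiM)

lemma sigma_finite_lebd: "sigma_finite_measure (lebd d)"
  unfolding lebd_def by (rule leb_prod.sigma_finite) simp

interpretation lebd: sigma_finite_measure "lebd d" for d
  by (rule sigma_finite_lebd)

interpretation lebd_pair: pair_sigma_finite "lebd d" "lebd d'" for d d'
  by (intro pair_sigma_finite.intro sigma_finite_lebd)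

lemma measurable_lebd_component:
  "i < d \<Longrightarrow> (\<lambda>x. x i) \<in> borel_measurable (lebd d)"
  unfolding lebd_def by measurable

lemma measurable_lebdI:
  assumes "\<And>i. i < d \<Longrightarrow> (\<lambda>x. f x i) \<in> borel_measurable N"
    and "\<And>x i. x \<in> space N \<Longrightarrow> i \<ge> d \<Longrightarrow> f x i = undefined"
  shows "f \<in> measurable N (lebd d)"
proof -
  have "(\<lambda>x i. f x i) \<in> measurable N (lebd d)"
    unfolding lebd_def using assms
    by (intro measurable_PiM_single') (auto simp: PiE_def extensional_def)
  then show ?thesis by simp
qed

lemma measurable_enorm:
  assumes "\<And>i. i < d \<Longrightarrow> (\<lambda>x. h x i) \<in> borel_measurable N"
  shows "(\<lambda>x. enorm d (h x)) \<in> borel_measurable N"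
  unfolding enorm_def using assms by measurable

lemma measurable_enorm_diff [measurable]:
  assumes [measurable]: "g \<in> measurable N (lebd d)" "h \<in> measurable N (lebd d)"
  shows "(\<lambda>x. enorm d (\<lambda>i. g x i - h x i)) \<in> borel_measurable N"
proof (rule measurable_enorm)
  fix i assume "i < d"
  have "(\<lambda>x. g x i) \<in> borel_measurable N" "(\<lambda>x. h x i) \<in> borel_measurable N"
    by (auto intro!: measurable_compose[OF _ measurable_lebd_component[OF \<open>i < d\<close>]] assms)
  then show "(\<lambda>x. g x i - h x i) \<in> borel_measurable N" by simp
qed

lemma measurable_enorm_diff_const [measurable]:
  "(\<lambda>x. enorm d (\<lambda>i. x i - a i)) \<in> borel_measurable (lebd d)"
  by (intro measurable_enorm borel_measurable_diff measurable_lebd_component borel_measurable_const)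

lemma measurable_enorm_lebd [measurable]: "enorm d \<in> borel_measurable (lebd d)"
  using measurable_enorm[of d "\<lambda>x. x" "lebd d"] by (simp add: measurable_lebd_component)

text \<open>Induction on the coordinates: each one contributes a factor \<open>\<bar>c\<bar>\<close>
  by the substitution rule on the line. The same rule later serves translations
  (\<open>c = 1\<close>), the point reflection (\<open>c = -1\<close>) and the rescaling by
  \<open>r\<close>.\<close>

lemma nn_integral_PiM_affine:
  fixes t :: "nat \<Rightarrow> real"
  assumes "finite I" "c \<noteq> 0" "g \<in> borel_measurable (\<Pi>\<^sub>M i\<in>I. lborel)"
  shows "(\<integral>\<^sup>+ x. g x \<partial>(\<Pi>\<^sub>M i\<in>I. lborel)) =
    ennreal (\<bar>c\<bar> ^ card I) * (\<integral>\<^sup>+ x. g (\<lambda>i\<in>I. t i + c * x i) \<partial>(\<Pi>\<^sub>M i\<in>I. lborel))"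
  using assms(1,3)
proof (induction I arbitrary: g)
  case empty
  have "(\<lambda>i\<in>{}. t i + c * x i) = (\<lambda>_. undefined)" for x by auto
  then show ?case
    by (simp add: leb_prod.nn_integral_empty restrict_def space_PiM)
next
  case (insert j I)
  note insert.prems [measurable]
  let ?P = "\<lambda>I::nat set. (\<Pi>\<^sub>M i\<in>I. lborel :: real measure)"
  have m[measurable]: "(\<lambda>x. g (x(j := y))) \<in> borel_measurable (?P I)" for y
    by measurable
  have gm: "(\<lambda>p. g ((fst p)(j := t j + c * snd p))) \<in> borel_measurable (?P I \<Otimes>\<^sub>M borel)"
    by measurable
  have Gm[measurable]: "(\<lambda>x. \<integral>\<^sup>+ y. g (x(j := t j + c * y)) \<partial>lborel) \<in> borel_measurable (?P I)"
    by measurable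
  have am[measurable]: "(\<lambda>x. \<lambda>i\<in>insert j I. t i + c * x i) \<in> measurable (?P (insert j I)) (?P (insert j I))"
    by measurable
  have "(\<integral>\<^sup>+ x. g x \<partial>?P (insert j I)) = (\<integral>\<^sup>+ x. \<integral>\<^sup>+ y. g (x(j := y)) \<partial>lborel \<partial>?P I)"
    using insert by (intro leb_prod.product_nn_integral_insert) auto
  also have "\<dots> = (\<integral>\<^sup>+ x. ennreal \<bar>c\<bar> * (\<integral>\<^sup>+ y. g (x(j := t j + c * y)) \<partial>lborel) \<partial>?P I)"
    using assms(2) by (intro nn_integral_cong nn_integral_real_affine) measurable
  also have "\<dots> = ennreal \<bar>c\<bar> * (\<integral>\<^sup>+ x. (\<integral>\<^sup>+ y. g (x(j := t j + c * y)) \<partial>lborel) \<partial>?P I)"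
    by (intro nn_integral_cmult) measurable
  also have "\<dots> = ennreal \<bar>c\<bar> * (ennreal (\<bar>c\<bar> ^ card I) *
      (\<integral>\<^sup>+ x. (\<integral>\<^sup>+ y. g ((\<lambda>i\<in>I. t i + c * x i)(j := t j + c * y)) \<partial>lborel) \<partial>?P I))"
    by (subst insert.IH[OF Gm]) simp
  also have "(\<integral>\<^sup>+ x. (\<integral>\<^sup>+ y. g ((\<lambda>i\<in>I. t i + c * x i)(j := t j + c * y)) \<partial>lborel) \<partial>?P I) =
      (\<integral>\<^sup>+ x. (\<integral>\<^sup>+ y. g (\<lambda>i\<in>insert j I. t i + c * (x(j := y)) i) \<partial>lborel) \<partial>?P I)"
    using insert(2) by (intro nn_integral_cong arg_cong[where f=g]) (auto simp: fun_eq_iff)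
  also have "\<dots> = (\<integral>\<^sup>+ x. g (\<lambda>i\<in>insert j I. t i + c * x i) \<partial>?P (insert j I))"
    using insert by (intro leb_prod.product_nn_integral_insert[symmetric]) measurable
  finally show ?case
    using insert(1,2) by (simp add: ennreal_mult mult.assoc del: restrict_apply)
qed

text \<open>If coordinate \<open>i\<close> is integrated out first, all others are fixed and the
  shear is the translation by \<open>a * x j\<close> in one real variable.\<close>

lemma nn_integral_PiM_shear:
  fixes a :: real and i j :: nat
  assumes "finite I" "i \<in> I" "j \<in> I" "i \<noteq> j" "g \<in> borel_measurable (\<Pi>\<^sub>M i\<in>I. lborel)"
  shows "(\<integral>\<^sup>+ x. g (x(i := x i + a * x j)) \<partial>(\<Pi>\<^sub>M i\<in>I. lborel)) = (\<integral>\<^sup>+ x. g x \<partial>(\<Pi>\<^sub>M i\<in>I. lborel))"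
proof -
  let ?P = "\<lambda>I::nat set. (\<Pi>\<^sub>M i\<in>I. lborel :: real measure)"
  define J where "J = I - {i}"
  have I: "I = insert i J" "finite J" "i \<notin> J" "j \<in> J" using assms by (auto simp: J_def)
  have [measurable]: "g \<in> borel_measurable (?P (insert i J))" using assms(5) I by simp
  have c [measurable]: "(\<lambda>x. x k) \<in> borel_measurable (?P (insert i J))" if "k \<in> insert i J" for k
    using measurable_component_singleton[OF that, of "\<lambda>_. lborel :: real measure"] by simp
  have [measurable]: "(\<lambda>x. x i) \<in> borel_measurable (?P (insert i J))"
      "(\<lambda>x. x j) \<in> borel_measurable (?P (insert i J))"
    using c I by auto
  have "(\<lambda>x. x i + a * x j) \<in> borel_measurable (?P (insert i J))"
    by measurable
  then have "(\<lambda>x. x(i := x i + a * x j)) \<in> measurable (?P (insert i J)) (?P (insert i J))"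
    by (intro measurable_fun_upd[where J="insert i J"]) auto
  then have "(\<lambda>x. g (x(i := x i + a * x j))) \<in> borel_measurable (?P (insert i J))"
    by (rule measurable_compose) measurable
  then have "(\<integral>\<^sup>+ x. g (x(i := x i + a * x j)) \<partial>?P (insert i J)) =
     (\<integral>\<^sup>+ x. \<integral>\<^sup>+ y. g ((x(i := y))(i := (x(i := y)) i + a * (x(i := y)) j)) \<partial>lborel \<partial>?P J)"
    using I by (intro leb_prod.product_nn_integral_insert) auto
  also have "\<dots> = (\<integral>\<^sup>+ x. \<integral>\<^sup>+ y. g (x(i := a * x j + 1 * y)) \<partial>lborel \<partial>?P J)"
    using assms(4) by (intro nn_integral_cong) (auto simp: add.commute)
  also have "\<dots> = (\<integral>\<^sup>+ x. \<integral>\<^sup>+ y. g (x(i := y)) \<partial>lborel \<partial>?P J)"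
  proof (rule nn_integral_cong)
    fix x assume [measurable]: "x \<in> space (?P J)"
    show "(\<integral>\<^sup>+ y. g (x(i := a * x j + 1 * y)) \<partial>lborel) = (\<integral>\<^sup>+ y. g (x(i := y)) \<partial>lborel)"
      using nn_integral_real_affine[of "\<lambda>y. g (x(i := y))" 1 "a * x j"] by simp
  qed
  also have "\<dots> = (\<integral>\<^sup>+ x. g x \<partial>?P (insert i J))"
    using I by (intro leb_prod.product_nn_integral_insert[symmetric]) auto
  finally show ?thesis using I(1) by simp
qed

section \<open>Intersections of two unit balls\<close>

lemma enorm_nonneg [simp]: "0 \<le> enorm d x"
  by (simp add: enorm_def sum_nonneg)

lemma enorm_le_iff: "0 \<le> s \<Longrightarrow> enorm d x \<le> s \<longleftrightarrow> (\<Sum>i<d. (x i)\<^sup>2) \<le> s\<^sup>2"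
  by (metis enorm_def real_le_rsqrt real_sqrt_le_iff real_sqrt_unique)

lemma enorm_cong: "(\<And>i. i < d \<Longrightarrow> x i = y i) \<Longrightarrow> enorm d x = enorm d y"
  by (simp add: enorm_def)

lemma enorm_minus_commute: "enorm d (\<lambda>i. x i - y i) = enorm d (\<lambda>i. y i - x i)"
  by (simp add: enorm_def power2_commute)

lemma enorm_scale: "enorm d (\<lambda>i. c * x i) = \<bar>c\<bar> * enorm d x"
  by (simp add: enorm_def power_mult_distrib sum_distrib_left[symmetric] real_sqrt_mult)

section \<open>Substitution rules, ball volumes and rotation invariance of the lens\<close>

lemma nn_integral_lebd_affine:
  assumes "c \<noteq> 0" "g \<in> borel_measurable (lebd d)"
  shows "(\<integral>\<^sup>+ x. g x \<partial>lebd d) = ennreal (\<bar>c\<bar> ^ d) * (\<integral>\<^sup>+ x. g (\<lambda>i\<in>{..<d}. t i + c * x i) \<partial>lebd d)"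
  using nn_integral_PiM_affine[of "{..<d}" c g t] assms by (simp add: lebd_def)

lemma nn_integral_lebd_shear:
  assumes "i < d" "j < d" "i \<noteq> j" "g \<in> borel_measurable (lebd d)"
  shows "(\<integral>\<^sup>+ x. g (x(i := x i + a * x j)) \<partial>lebd d) = (\<integral>\<^sup>+ x. g x \<partial>lebd d)"
  using nn_integral_PiM_shear[of "{..<d}" i j g a] assms by (simp add: lebd_def)

lemma emeasure_lebd_ball:
  assumes "0 \<le> s"
  shows "emeasure (lebd d) {y \<in> space (lebd d). enorm d y \<le> s} = ennreal (unit_ball_vol (real d) * s ^ d)"
proof (cases "s = 0")
  case False
  then show ?thesis
    using emeasure_cball_aux[of "{..<d}" s] assms
    by (simp add: enorm_def lebd_def Int_def conj_commute)
next
  \<comment> \<open>Radius 0 does occur later: as \<open>sqrt (1 - t^2)\<close> at the poles of the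
    ball and as \<open>min 1 (2 * \<bar>t\<bar>)\<close> at \<open>t = 0\<close>. In dimension 0 the
    ball is the whole one-point space, in agreement with \<open>0 ^ 0 = 1\<close>.\<close>
  case True
  show ?thesis
  proof (cases d)
    case 0
    have "{y \<in> space (lebd d). enorm d y \<le> s} = space (lebd d)" using True 0 by (auto simp: enorm_def)
    then show ?thesis using 0 True
      by (simp add: lebd_def space_PiM)
  next
    case (Suc m)
    have "{y \<in> space (lebd d). enorm d y \<le> s} = (\<Pi>\<^sub>E i\<in>{..<d}. {0})"
    proof -
      have "(\<Sum>i<d. (y i)\<^sup>2) \<le> 0 \<longleftrightarrow> (\<forall>i<d. y i = 0)" for y :: "nat \<Rightarrow> real"
        using sum_nonneg_eq_0_iff[of "{..<d}" "\<lambda>i. (y i)\<^sup>2"] sum_nonneg[of "{..<d}" "\<lambda>i. (y i)\<^sup>2"]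
        by (auto simp del: sum_nonneg_eq_0_iff)
      then show ?thesis using True by (auto simp: enorm_le_iff space_lebd PiE_iff fun_eq_iff extensional_def)
    qed
    also have "emeasure (lebd d) \<dots> = (\<Prod>i<d. emeasure lborel {0::real})"
      unfolding lebd_def by (rule leb_prod.emeasure_PiM) auto
    finally show ?thesis using True Suc by simp
  qed
qed

text \<open>The volume of the intersection of the unit balls about 0 and \<open>x\<close>, written
  as an integral so that the substitution rules apply to it directly.\<close>

definition lens_vol :: "nat \<Rightarrow> (nat \<Rightarrow> real) \<Rightarrow> ennreal" where
  "lens_vol d x = (\<integral>\<^sup>+ y. indicator {y. enorm d y \<le> 1 \<and> enorm d (\<lambda>i. y i - x i) \<le> 1} y \<partial>lebd d)"

lemma measurable_lens [measurable]:
  "(\<lambda>y. indicator {y. enorm d y \<le> 1 \<and> enorm d (\<lambda>i. y i - x i) \<le> 1} y :: ennreal) \<in> borel_measurable (lebd d)"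
  by measurable

lemma lens_vol_cong: "(\<And>i. i < d \<Longrightarrow> x i = y i) \<Longrightarrow> lens_vol d x = lens_vol d y"
  unfolding lens_vol_def indicator_def mem_Collect_eq
  by (intro nn_integral_cong arg_cong[where f=of_bool] conj_cong arg_cong2[where f="(\<le>)"] enorm_cong) auto

text \<open>The point reflection maps the lens of \<open>x\<close> to that of \<open>-x\<close>. It
  settles the sign that the rotations below leave open.\<close>

lemma lens_vol_uminus: "lens_vol d (\<lambda>i. - x i) = lens_vol d x"
proof -
  let ?n = "\<lambda>y. \<lambda>i\<in>{..<d}. 0 + (-1) * y i :: real"
  have e: "enorm d (?n y) = enorm d y" "enorm d (\<lambda>i. ?n y i - - x i) = enorm d (\<lambda>i. y i - x i)" for y
    by (auto simp: enorm_def power2_eq_square algebra_simps intro!: sum.cong)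
  have "lens_vol d (\<lambda>i. - x i) = (\<integral>\<^sup>+ y. indicator {y. enorm d y \<le> 1 \<and> enorm d (\<lambda>i. y i - - x i) \<le> 1} (?n y) \<partial>lebd d)"
    unfolding lens_vol_def
    by (subst nn_integral_lebd_affine[where c="-1" and t="\<lambda>_. 0", OF _ measurable_lens]) simp_all
  also have "\<dots> = lens_vol d x"
    unfolding lens_vol_def by (intro nn_integral_cong) (simp only: indicator_def mem_Collect_eq e)
  finally show ?thesis .
qed

lemma sum_two_le_split:
  fixes h :: "nat \<Rightarrow> real"
  assumes "i < d" "j < d" "i \<noteq> j"
  shows "(\<Sum>k<d. h k) = h i + h j + (\<Sum>k\<in>{..<d}-{i}-{j}. h k)"
proof -
  have "(\<Sum>k<d. h k) = h i + (\<Sum>k\<in>{..<d}-{i}. h k)"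
    using assms by (intro sum.remove) auto
  also have "(\<Sum>k\<in>{..<d}-{i}. h k) = h j + (\<Sum>k\<in>{..<d}-{i}-{j}. h k)"
    using assms by (intro sum.remove) auto
  finally show ?thesis by simp
qed

text \<open>A plane rotation other than the half turn is a product of three shears, and shears preserve
  Lebesgue measure.\<close>

lemma lens_vol_rotate:
  assumes ij: "i < d" "j < d" "i \<noteq> j"
  shows "\<exists>s. lens_vol d x = lens_vol d (x(j := 0, i := s)) \<and> s\<^sup>2 = (x i)\<^sup>2 + (x j)\<^sup>2"
proof (cases "x j = 0")
  \<comment> \<open>No rotation is required here, and \<open>s = x i\<close> may be negative; this
    is why the statement only fixes the square of \<open>s\<close>.\<close>
  case True
  then have "x(j := 0, i := x i) = x" by auto
  then show ?thesis using True by (metis add_0_right power_zero_numeral)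
next
  case False
  define \<rho> where "\<rho> = sqrt ((x i)\<^sup>2 + (x j)\<^sup>2)"
  define c where "c = x i / \<rho>"
  define s where "s = x j / \<rho>"
  \<comment> \<open>With \<open>c\<close> and \<open>s\<close> the cosine and sine of the angle,
    \<open>a\<close> is the tangent of the half angle, for which the shears with parameters
    \<open>a\<close>, \<open>-s\<close>, \<open>a\<close> compose to the rotation \<open>R\<close>.
    Since \<open>x j\<close> is nonzero, so is \<open>s\<close>.\<close>
  define a where "a = (1 - c) / s"
  have \<rho>2: "\<rho>\<^sup>2 = (x i)\<^sup>2 + (x j)\<^sup>2" by (simp add: \<rho>_def)
  have "\<rho> > 0" using False by (simp add: \<rho>_def add_nonneg_pos)
  have cs: "c\<^sup>2 + s\<^sup>2 = 1" using \<open>\<rho> > 0\<close> \<rho>2 by (simp add: c_def s_def power_divide add_divide_distrib[symmetric] flip: \<rho>2)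
  have "s \<noteq> 0" using False \<open>\<rho> > 0\<close> by (simp add: s_def)
  have xi: "x i = \<rho> * c" "x j = \<rho> * s" using \<open>\<rho> > 0\<close> by (simp_all add: c_def s_def)
  define x' where "x' = x(j := 0, i := \<rho>)"
  define R where "R y = y(i := c * y i + s * y j, j := c * y j - s * y i)" for y :: "nat \<Rightarrow> real"
  let ?S = "\<lambda>i j a y. y(i := y i + a * y j) :: nat \<Rightarrow> real"
  have as: "a * s = 1 - c" using \<open>s \<noteq> 0\<close> by (simp add: a_def)
  have "s * (a * (1 + c)) = (1 - c) * (1 + c)"
    by (metis as mult.assoc mult.commute)
  also have "\<dots> = s * s"
    using cs by (simp add: power2_eq_square algebra_simps)
  finally have "s * (a * (1 + c)) = s * s" .
  then have a1: "a * (1 + c) = s" using \<open>s \<noteq> 0\<close> by simp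
  have RS: "?S i j a (?S j i (- s) (?S i j a y)) = R y" for y
  proof -
    have "y j + - s * (y i + a * y j) = (1 - a * s) * y j - s * y i"
      by (simp add: algebra_simps)
    then have 1: "y j + - s * (y i + a * y j) = c * y j - s * y i"
      by (simp add: as)
    have "(y i + a * y j) + a * (c * y j - s * y i) = (1 - a * s) * y i + (a * (1 + c)) * y j"
      by (simp add: algebra_simps)
    also have "\<dots> = c * y i + s * y j" using as a1 by simp
    finally show ?thesis using ij 1 by (auto simp: R_def fun_eq_iff)
  qed
  have shear_meas: "(\<lambda>y. ?S i j a y) \<in> measurable (lebd d) (lebd d)" if "i < d" "j < d" for i j a
  proof (rule measurable_lebdI)
    fix k assume "k < d"
    show "(\<lambda>y. ?S i j a y k) \<in> borel_measurable (lebd d)"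
      using that \<open>k < d\<close> by (cases "k = i") (auto intro!: borel_measurable_add borel_measurable_times measurable_lebd_component)
  qed (use that in \<open>auto simp: space_lebd PiE_def extensional_def\<close>)
  let ?g = "\<lambda>x y. indicator {y. enorm d y \<le> 1 \<and> enorm d (\<lambda>i. y i - x i) \<le> 1} y :: ennreal"
  \<comment> \<open>The chain starts at \<open>x'\<close> because composing an integrand with
    \<open>R\<close> pulls the lens of \<open>x' = R x\<close> back to the lens of
    \<open>x\<close>.\<close>
  have "lens_vol d x' = (\<integral>\<^sup>+ y. ?g x' y \<partial>lebd d)" by (simp add: lens_vol_def)
  also have "\<dots> = (\<integral>\<^sup>+ y. ?g x' (?S i j a y) \<partial>lebd d)"
    using ij by (intro nn_integral_lebd_shear[symmetric] measurable_lens) auto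
  also have "\<dots> = (\<integral>\<^sup>+ y. ?g x' (?S i j a (?S j i (- s) y)) \<partial>lebd d)"
    using ij by (intro nn_integral_lebd_shear[symmetric, of j d i "\<lambda>y. ?g x' (?S i j a y)"]
       measurable_compose[OF shear_meas measurable_lens]) auto
  also have "\<dots> = (\<integral>\<^sup>+ y. ?g x' (?S i j a (?S j i (- s) (?S i j a y))) \<partial>lebd d)"
    using ij by (intro nn_integral_lebd_shear[symmetric, of i d j "\<lambda>y. ?g x' (?S i j a (?S j i (- s) y))"]
       measurable_compose[OF shear_meas measurable_compose[OF shear_meas measurable_lens]]) auto
  also have "\<dots> = (\<integral>\<^sup>+ y. ?g x' (R y) \<partial>lebd d)" by (simp only: RS)
  also have "\<dots> = lens_vol d x"
  proof -
    have iso: "(c * u + s * v)\<^sup>2 + (c * v - s * u)\<^sup>2 = u\<^sup>2 + v\<^sup>2" for u v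
    proof -
      have "(c * u + s * v)\<^sup>2 + (c * v - s * u)\<^sup>2 = (c\<^sup>2 + s\<^sup>2) * (u\<^sup>2 + v\<^sup>2)"
        by (simp add: power2_eq_square algebra_simps)
      then show ?thesis using cs by simp
    qed
    have n1: "enorm d (R y) = enorm d y" for y
      using ij iso[of "y i" "y j"] unfolding enorm_def sum_two_le_split[OF ij]
      by (simp add: R_def)
    have "enorm d (\<lambda>k. R y k - x' k) = enorm d (R (\<lambda>k. y k - x k))" for y
    proof (rule enorm_cong)
      fix k
      have "c * x i + s * x j = \<rho>" "c * x j - s * x i = 0"
        using cs by (simp_all add: xi power2_eq_square algebra_simps flip: distrib_left)
      then show "R y k - x' k = R (\<lambda>k. y k - x k) k"
        using ij by (auto simp: R_def x'_def algebra_simps)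
    qed
    then have e: "enorm d (\<lambda>k. R y k - x' k) = enorm d (\<lambda>k. y k - x k)" for y
      by (simp only: n1)
    show ?thesis unfolding lens_vol_def
      by (rule nn_integral_cong) (simp only: indicator_def mem_Collect_eq n1 e)
  qed
  finally show ?thesis using \<rho>2 x'_def by metis
qed

text \<open>Rotations in the planes of the coordinates \<open>k\<close> and \<open>m\<close>, for
  \<open>k < m\<close> in turn, clear coordinate \<open>k\<close> and collect its square in
  coordinate \<open>m\<close>; a final reflection makes that coordinate nonnegative.\<close>

lemma lens_vol_axis:
  "lens_vol (Suc m) x = lens_vol (Suc m) (\<lambda>l. if l = m then enorm (Suc m) x else 0)"
proof -
  have "\<exists>s. lens_vol (Suc m) x = lens_vol (Suc m) (\<lambda>l. if l < k then 0 else if l = m then s else x l) \<and>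
     s\<^sup>2 = (x m)\<^sup>2 + (\<Sum>l<k. (x l)\<^sup>2)" if "k \<le> m" for k
    using that
  proof (induction k)
    case 0
    have "(\<lambda>l. if l < (0::nat) then 0 else if l = m then x m else x l) = x" by auto
    then show ?case by (intro exI[of _ "x m"]) simp
  next
    case (Suc k)
    then obtain s where s: "lens_vol (Suc m) x = lens_vol (Suc m) (\<lambda>l. if l < k then 0 else if l = m then s else x l)"
      "s\<^sup>2 = (x m)\<^sup>2 + (\<Sum>l<k. (x l)\<^sup>2)" by auto
    let ?x = "\<lambda>l. if l < k then 0 else if l = m then s else x l"
    obtain t where t: "lens_vol (Suc m) ?x = lens_vol (Suc m) (?x(k := 0, m := t))" "t\<^sup>2 = (?x m)\<^sup>2 + (?x k)\<^sup>2"
      using lens_vol_rotate[of m "Suc m" k ?x] Suc.prems by auto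
    have "?x(k := 0, m := t) = (\<lambda>l. if l < Suc k then 0 else if l = m then t else x l)"
      using Suc.prems by (auto simp: fun_eq_iff)
    then show ?case using s t Suc.prems by (intro exI[of _ t]) auto
  qed
  from this[of m] obtain s where s: "lens_vol (Suc m) x = lens_vol (Suc m) (\<lambda>l. if l < m then 0 else if l = m then s else x l)"
      "s\<^sup>2 = (x m)\<^sup>2 + (\<Sum>l<m. (x l)\<^sup>2)" by auto
  have n: "enorm (Suc m) x = \<bar>s\<bar>" unfolding enorm_def using s(2) by (simp add: real_sqrt_abs[symmetric] add.commute del: real_sqrt_abs)
  have 1: "lens_vol (Suc m) x = lens_vol (Suc m) (\<lambda>l. if l = m then s else 0)"
    using s(1) by (simp cong: lens_vol_cong if_cong) (rule lens_vol_cong, auto)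
  also have "\<dots> = lens_vol (Suc m) (\<lambda>l. if l = m then \<bar>s\<bar> else 0)"
  proof (cases "s \<ge> 0")
    case False
    have "lens_vol (Suc m) (\<lambda>l. if l = m then s else 0) = lens_vol (Suc m) (\<lambda>l. - (if l = m then \<bar>s\<bar> else 0))"
      using False by (intro lens_vol_cong) auto
    then show ?thesis by (simp only: lens_vol_uminus)
  qed (simp cong: if_cong)
  finally show ?thesis unfolding n .
qed

text \<open>Cavalieri's principle: the slice of the unit ball at height \<open>t\<close> is a ball
  of radius \<open>sqrt (1 - t^2)\<close> in one dimension less.\<close>

lemma nn_integral_ball_slices:
  fixes h :: "real \<Rightarrow> ennreal"
  assumes [measurable]: "h \<in> borel_measurable borel"
  shows "(\<integral>\<^sup>+ y. h (y m) * indicator {y. enorm (Suc m) y \<le> 1} y \<partial>lebd (Suc m)) =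
    ennreal (unit_ball_vol (real m)) * (\<integral>\<^sup>+ t. h t * (indicator {-1..1} t * ennreal (sqrt (1 - t\<^sup>2) ^ m)) \<partial>lborel)"
proof -
  have hm: "(\<lambda>t. h t * (indicator {-1..1} t * ennreal (sqrt (1 - t\<^sup>2) ^ m))) \<in> borel_measurable lborel"
    by measurable
  have [measurable]: "(\<lambda>y. y m) \<in> borel_measurable (lebd (Suc m))" by (rule measurable_lebd_component) simp
  let ?g = "\<lambda>y. h (y m) * indicator {y. enorm (Suc m) y \<le> 1} y :: ennreal"
  have "?g \<in> borel_measurable (lebd (Suc m))" by measurable
  then have "(\<integral>\<^sup>+ y. ?g y \<partial>lebd (Suc m)) = (\<integral>\<^sup>+ t. \<integral>\<^sup>+ z. ?g (z(m := t)) \<partial>lebd m \<partial>lborel)"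
    unfolding lebd_def lessThan_Suc by (intro leb_prod.product_nn_integral_insert_rev) auto
  also have "\<dots> = (\<integral>\<^sup>+ t. h t * (indicator {-1..1} t * (ennreal (unit_ball_vol (real m)) * ennreal (sqrt (1 - t\<^sup>2) ^ m))) \<partial>lborel)"
  proof (rule nn_integral_cong)
    fix t :: real
    have e: "enorm (Suc m) (z(m := t)) \<le> 1 \<longleftrightarrow> t \<in> {-1..1} \<and> enorm m z \<le> sqrt (1 - t\<^sup>2)" for z
    proof -
      have "enorm (Suc m) (z(m := t)) \<le> 1 \<longleftrightarrow> (\<Sum>i<m. (z i)\<^sup>2) + t\<^sup>2 \<le> 1"
        by (simp add: enorm_le_iff)
      moreover have "t\<^sup>2 \<le> 1 \<longleftrightarrow> t \<in> {-1..1}" by (auto simp: abs_square_le_1 abs_le_iff)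
      moreover have "(\<Sum>i<m. (z i)\<^sup>2) \<ge> 0" by (simp add: sum_nonneg)
      moreover have "enorm m z \<le> sqrt (1 - t\<^sup>2) \<longleftrightarrow> (\<Sum>i<m. (z i)\<^sup>2) \<le> 1 - t\<^sup>2" by (simp add: enorm_def)
      ultimately show ?thesis by auto
    qed
    have "(\<integral>\<^sup>+ z. ?g (z(m := t)) \<partial>lebd m) =
        (\<integral>\<^sup>+ z. (h t * indicator {-1..1} t) * indicator {z \<in> space (lebd m). enorm m z \<le> sqrt (1 - t\<^sup>2)} z \<partial>lebd m)"
      by (intro nn_integral_cong) (auto simp: e split: split_indicator)
    also have "\<dots> = (h t * indicator {-1..1} t) * emeasure (lebd m) {z \<in> space (lebd m). enorm m z \<le> sqrt (1 - t\<^sup>2)}"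
      by (rule nn_integral_cmult_indicator) measurable
    also have "\<dots> = h t * (indicator {-1..1} t * (ennreal (unit_ball_vol (real m)) * ennreal (sqrt (1 - t\<^sup>2) ^ m)))"
    \<comment> \<open>For \<open>\<bar>t\<bar> > 1\<close> the radius is negative, as
      \<open>sqrt\<close> is odd, and the volume formula does not apply; there the indicator makes
      both sides 0.\<close>
    proof (cases "t \<in> {-1..1}")
      case True
      then have "0 \<le> 1 - t\<^sup>2" by (simp add: abs_square_le_1 abs_le_iff)
      then show ?thesis by (simp add: emeasure_lebd_ball mult.assoc ennreal_mult)
    qed simp
    finally show "(\<integral>\<^sup>+ z. ?g (z(m := t)) \<partial>lebd m) = h t * (indicator {-1..1} t * (ennreal (unit_ball_vol (real m)) * ennreal (sqrt (1 - t\<^sup>2) ^ m)))" .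
  qed
  also have "\<dots> = (\<integral>\<^sup>+ t. ennreal (unit_ball_vol (real m)) * (h t * (indicator {-1..1} t * ennreal (sqrt (1 - t\<^sup>2) ^ m))) \<partial>lborel)"
    by (simp add: mult_ac)
  also have "\<dots> = ennreal (unit_ball_vol (real m)) * (\<integral>\<^sup>+ t. h t * (indicator {-1..1} t * ennreal (sqrt (1 - t\<^sup>2) ^ m)) \<partial>lborel)"
    by (rule nn_integral_cmult[OF hm])
  finally show ?thesis .
qed

text \<open>The lens consists of two caps, one of which is moved by \<open>-x\<close>.\<close>

lemma lens_vol_eq:
  "lens_vol (Suc m) x = ennreal (unit_ball_vol (real m)) *
     (\<integral>\<^sup>+ t. indicator {t. enorm (Suc m) x \<le> 2 * \<bar>t\<bar>} t * (indicator {-1..1} t * ennreal (sqrt (1 - t\<^sup>2) ^ m)) \<partial>lborel)"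
proof -
  define \<rho> where "\<rho> = enorm (Suc m) x"
  have "\<rho> \<ge> 0" by (simp add: \<rho>_def)
  define e where "e = (\<lambda>l. if l = m then \<rho> else 0 :: real)"
  let ?d = "Suc m"
  let ?B = "{y. enorm ?d y \<le> 1}"
  have [measurable]: "(\<lambda>y. y m) \<in> borel_measurable (lebd ?d)" by (rule measurable_lebd_component) simp
  have sq: "(\<Sum>i<?d. (y i - e i)\<^sup>2) = (\<Sum>i<?d. (y i)\<^sup>2) - 2 * \<rho> * y m + \<rho>\<^sup>2" for y :: "nat \<Rightarrow> real"
    by (simp add: e_def power2_eq_square algebra_simps)
  \<comment> \<open>The hyperplane \<open>y m = \<rho> / 2\<close> bisects the segment between the
    two centres. On either side only the condition for the farther centre remains, since it implies
    the other one.\<close>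
  have hi: "enorm ?d (\<lambda>i. y i - e i) \<le> enorm ?d y" if "y m \<ge> \<rho> / 2" for y
  proof -
    have "\<rho> * \<rho> \<le> \<rho> * (2 * y m)" using that \<open>\<rho> \<ge> 0\<close> by (intro mult_left_mono) auto
    then show ?thesis unfolding enorm_def real_sqrt_le_iff sq by (simp add: power2_eq_square algebra_simps)
  qed
  have lo: "enorm ?d y \<le> enorm ?d (\<lambda>i. y i - e i)" if "y m < \<rho> / 2" for y
  proof -
    have "\<rho> * (2 * y m) \<le> \<rho> * \<rho>" using that \<open>\<rho> \<ge> 0\<close> by (intro mult_left_mono) auto
    then show ?thesis unfolding enorm_def real_sqrt_le_iff sq by (simp add: power2_eq_square algebra_simps)
  qed
  have "lens_vol ?d x = lens_vol ?d e" unfolding e_def \<rho>_def by (rule lens_vol_axis)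
  also have "\<dots> = (\<integral>\<^sup>+ y. indicator {\<rho>/2..} (y m) * indicator ?B y +
      indicator {..<\<rho>/2} (y m) * indicator {y. enorm ?d (\<lambda>i. y i - e i) \<le> 1} y \<partial>lebd ?d)"
    unfolding lens_vol_def
  proof (rule nn_integral_cong)
    fix y :: "nat \<Rightarrow> real"
    show "indicator {y. enorm ?d y \<le> 1 \<and> enorm ?d (\<lambda>i. y i - e i) \<le> 1} y =
      (indicator {\<rho>/2..} (y m) * indicator ?B y +
      indicator {..<\<rho>/2} (y m) * indicator {y. enorm ?d (\<lambda>i. y i - e i) \<le> 1} y :: ennreal)"
      using hi[of y] lo[of y] by (cases "y m \<ge> \<rho> / 2") (auto simp: indicator_def)
  qed
  also have "\<dots> = (\<integral>\<^sup>+ y. indicator {\<rho>/2..} (y m) * indicator ?B y \<partial>lebd ?d) +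
     (\<integral>\<^sup>+ y. indicator {..<\<rho>/2} (y m) * indicator {y. enorm ?d (\<lambda>i. y i - e i) \<le> 1} y \<partial>lebd ?d)"
    by (rule nn_integral_add) measurable
  also have "(\<integral>\<^sup>+ y. indicator {..<\<rho>/2} (y m) * indicator {y. enorm ?d (\<lambda>i. y i - e i) \<le> 1} y \<partial>lebd ?d) =
     (\<integral>\<^sup>+ y. indicator {..<-\<rho>/2} (y m) * indicator ?B y \<partial>lebd ?d)"
  proof -
    let ?T = "\<lambda>y. \<lambda>i\<in>{..<?d}. e i + 1 * y i"
    have gm: "(\<lambda>y. indicator {..<\<rho>/2} (y m) * indicator {y. enorm ?d (\<lambda>i. y i - e i) \<le> 1} y :: ennreal)
        \<in> borel_measurable (lebd ?d)"
      by measurable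
    have n: "enorm ?d (\<lambda>i. ?T y i - e i) = enorm ?d y" for y by (rule enorm_cong) auto
    have "(\<integral>\<^sup>+ y. indicator {..<\<rho>/2} (y m) * indicator {y. enorm ?d (\<lambda>i. y i - e i) \<le> 1} y \<partial>lebd ?d) =
      (\<integral>\<^sup>+ y. indicator {..<\<rho>/2} (?T y m) * indicator {y. enorm ?d (\<lambda>i. y i - e i) \<le> 1} (?T y) \<partial>lebd ?d)"
      by (subst nn_integral_lebd_affine[where c=1 and t=e, OF _ gm]) simp_all
    also have "\<dots> = (\<integral>\<^sup>+ y. indicator {..<-\<rho>/2} (y m) * indicator ?B y \<partial>lebd ?d)"
      by (intro nn_integral_cong arg_cong2[where f="(*)"])
        (simp_all only: indicator_def mem_Collect_eq n, auto simp: e_def)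
    finally show ?thesis .
  qed
  also have "(\<integral>\<^sup>+ y. indicator {\<rho>/2..} (y m) * indicator ?B y \<partial>lebd ?d) +
      (\<integral>\<^sup>+ y. indicator {..<-\<rho>/2} (y m) * indicator ?B y \<partial>lebd ?d) =
     (\<integral>\<^sup>+ y. indicator {\<rho>/2..} (y m) * indicator ?B y + indicator {..<-\<rho>/2} (y m) * indicator ?B y \<partial>lebd ?d)"
    by (rule nn_integral_add[symmetric]) measurable
  also have "\<dots> = (\<integral>\<^sup>+ y. indicator ({\<rho>/2..} \<union> {..<-\<rho>/2}) (y m) * indicator ?B y \<partial>lebd ?d)"
    using \<open>\<rho> \<ge> 0\<close> by (intro nn_integral_cong) (auto split: split_indicator)
  also have "\<dots> = ennreal (unit_ball_vol (real m)) *
     (\<integral>\<^sup>+ t. indicator ({\<rho>/2..} \<union> {..<-\<rho>/2}) t * (indicator {-1..1} t * ennreal (sqrt (1 - t\<^sup>2) ^ m)) \<partial>lborel)"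
    by (rule nn_integral_ball_slices) measurable
  also have "(\<integral>\<^sup>+ t. indicator ({\<rho>/2..} \<union> {..<-\<rho>/2}) t * (indicator {-1..1} t * ennreal (sqrt (1 - t\<^sup>2) ^ m)) \<partial>lborel) =
    (\<integral>\<^sup>+ t. indicator {t. \<rho> \<le> 2 * \<bar>t\<bar>} t * (indicator {-1..1} t * ennreal (sqrt (1 - t\<^sup>2) ^ m)) \<partial>lborel)"
    \<comment> \<open>The two sets can differ only in the point \<open>-\<rho> / 2\<close>, which is
      null.\<close>
    using AE_lborel_singleton[of "-\<rho>/2"] \<open>\<rho> \<ge> 0\<close>
    by (intro nn_integral_cong_AE) (auto elim!: eventually_mono split: split_indicator)
  finally show ?thesis by (simp add: \<rho>_def)
qed

section \<open>Monotonicity of the limiting constants\<close>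

lemma measurable_lens_vol [measurable]: "lens_vol d \<in> borel_measurable (lebd d)"
proof -
  have "(\<lambda>p. indicator {p. enorm d (snd p) \<le> 1 \<and> enorm d (\<lambda>i. snd p i - fst p i) \<le> 1} p :: ennreal)
      \<in> borel_measurable (lebd d \<Otimes>\<^sub>M lebd d)"
    by measurable
  from lebd.borel_measurable_nn_integral_fst[OF this]
  show ?thesis
    by (simp add: lens_vol_def[abs_def] indicator_def)
qed

lemma unit_ball_vol_nonzero: "ennreal (unit_ball_vol (real d)) \<noteq> 0" "ennreal (unit_ball_vol (real d)) \<noteq> top"
  by (simp_all add: ennreal_eq_0_iff not_le)

lemma emeasure_unit_ball_d: "emeasure (lebd d) (unit_ball_d d) = ennreal (unit_ball_vol (real d))"
  unfolding unit_ball_d_def by (subst emeasure_lebd_ball) auto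

lemma sets_unit_ball_d [measurable]: "unit_ball_d d \<in> sets (lebd d)"
  unfolding unit_ball_d_def by measurable

text \<open>Fubini for the pair of uniform points: given the first one at \<open>x\<close>, the
  second must fall into the lens of \<open>x\<close>. Clearing the denominators turns the
  probability into a volume, the form in which it is used for triangles.\<close>

lemma w_mult_sq:
  "ennreal (w d) * ennreal (unit_ball_vol (real d)) ^ 2 = (\<integral>\<^sup>+ x. indicator {x. enorm d x \<le> 1} x * lens_vol d x \<partial>lebd d)"
proof -
  let ?v = "ennreal (unit_ball_vol (real d))"
  let ?U = "uniform_measure (lebd d) (unit_ball_d d)"
  let ?S = "{p \<in> space (lebd d \<Otimes>\<^sub>M lebd d). enorm d (\<lambda>i. fst p i - snd p i) \<le> 1}"
  interpret U: prob_space ?U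
    by (rule prob_space_uniform_measure) (simp_all add: emeasure_unit_ball_d unit_ball_vol_nonzero)
  interpret UU: pair_prob_space ?U ?U ..
  have "sets (?U \<Otimes>\<^sub>M ?U) = sets (lebd d \<Otimes>\<^sub>M lebd d)" by (rule sets_pair_measure_cong) auto
  moreover have "?S \<in> sets (lebd d \<Otimes>\<^sub>M lebd d)" by measurable
  ultimately have S: "?S \<in> sets (?U \<Otimes>\<^sub>M ?U)" by simp
  have slice: "emeasure ?U (Pair x -` ?S) = lens_vol d x / ?v" if x: "x \<in> space (lebd d)" for x
  proof -
    have "Pair x -` ?S \<in> sets ?U" by (rule sets_Pair1[OF S])
    then have sl [measurable]: "Pair x -` ?S \<in> sets (lebd d)" by (simp only: sets_uniform_measure)
    have "emeasure ?U (Pair x -` ?S) = emeasure (lebd d) (unit_ball_d d \<inter> Pair x -` ?S) / ?v"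
      by (simp only: emeasure_uniform_measure[OF sets_unit_ball_d sl] emeasure_unit_ball_d)
    also have "emeasure (lebd d) (unit_ball_d d \<inter> Pair x -` ?S) = (\<integral>\<^sup>+ y. indicator (unit_ball_d d \<inter> Pair x -` ?S) y \<partial>lebd d)"
      by (rule nn_integral_indicator[symmetric]) measurable
    also have "\<dots> = lens_vol d x"
      unfolding lens_vol_def
      by (rule nn_integral_cong)
        (use x in \<open>auto simp: unit_ball_d_def space_pair_measure enorm_minus_commute[of d x] split: split_indicator\<close>)
    finally show ?thesis .
  qed
  have "emeasure (?U \<Otimes>\<^sub>M ?U) ?S = (\<integral>\<^sup>+ x. emeasure ?U (Pair x -` ?S) \<partial>?U)"
    by (rule U.emeasure_pair_measure_alt[OF S])
  also have "\<dots> = (\<integral>\<^sup>+ x. lens_vol d x / ?v \<partial>?U)"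
    by (intro nn_integral_cong slice) simp
  also have "\<dots> = (\<integral>\<^sup>+ x. lens_vol d x / ?v * indicator (unit_ball_d d) x \<partial>lebd d) / ?v"
    by (subst nn_integral_uniform_measure) (auto simp: emeasure_unit_ball_d)
  also have "(\<integral>\<^sup>+ x. lens_vol d x / ?v * indicator (unit_ball_d d) x \<partial>lebd d) =
      (\<integral>\<^sup>+ x. (indicator {x. enorm d x \<le> 1} x * lens_vol d x) / ?v \<partial>lebd d)"
    by (intro nn_integral_cong) (auto simp: unit_ball_d_def split: split_indicator)
  also have "\<dots> = (\<integral>\<^sup>+ x. indicator {x. enorm d x \<le> 1} x * lens_vol d x \<partial>lebd d) / ?v"
    by (rule nn_integral_divide) measurable
  finally have "emeasure (?U \<Otimes>\<^sub>M ?U) ?S = (\<integral>\<^sup>+ x. indicator {x. enorm d x \<le> 1} x * lens_vol d x \<partial>lebd d) / ?v / ?v" .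
  moreover have "ennreal (w d) = emeasure (?U \<Otimes>\<^sub>M ?U) ?S"
    unfolding w_def by (rule UU.emeasure_eq_measure[symmetric])
  ultimately have "ennreal (w d) = (\<integral>\<^sup>+ x. indicator {x. enorm d x \<le> 1} x * lens_vol d x \<partial>lebd d) / ?v / ?v"
    by simp
  then have "ennreal (w d) * ?v\<^sup>2 = (\<integral>\<^sup>+ x. indicator {x. enorm d x \<le> 1} x * lens_vol d x \<partial>lebd d) / ?v / ?v * ?v * ?v"
    by (simp add: power2_eq_square mult.assoc)
  moreover have "X / ?v * ?v = X" for X
    using unit_ball_vol_nonzero[of d] by (simp only: ennreal_divide_times ennreal_divide_self less_top mult_1_right not_False_eq_True)
  ultimately show ?thesis by simp
qed

text \<open>The weight \<open>(1 - t^2)^(m/2)\<close> is, up to normalisation, the density of a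
  coordinate \<open>Y\<close> of a uniform point of the unit ball in dimension \<open>m + 1\<close>,
  so \<open>cap_int k m / cap_int 0 m\<close> is the mean of
  \<open>min 1 (2 * \<bar>Y\<bar>) ^ k\<close>. The two exponents are kept apart because the step to
  the next dimension is split into one change of each.\<close>

definition cap_int :: "nat \<Rightarrow> nat \<Rightarrow> real" where
  "cap_int k m = integral {-1..1} (\<lambda>t. min 1 (2 * \<bar>t\<bar>) ^ k * sqrt (1 - t\<^sup>2) ^ m)"

lemma cap_int_continuous: "continuous_on {-1..1} (\<lambda>t. min 1 (2 * \<bar>t\<bar>) ^ k * sqrt (1 - t\<^sup>2) ^ m :: real)"
  by (intro continuous_intros)

lemma cap_integrable: "(\<lambda>t. min 1 (2 * \<bar>t\<bar>) ^ k * sqrt (1 - t\<^sup>2) ^ m :: real) integrable_on {-1..1}"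
  by (rule integrable_continuous_interval[OF cap_int_continuous])

lemma nn_integral_cap:
  "(\<integral>\<^sup>+ t. indicator {-1..1} t * ennreal (min 1 (2 * \<bar>t\<bar>) ^ k * sqrt (1 - t\<^sup>2) ^ m) \<partial>lborel) = ennreal (cap_int k m)"
proof -
  let ?f = "\<lambda>t::real. min 1 (2 * \<bar>t\<bar>) ^ k * sqrt (1 - t\<^sup>2) ^ m"
  have "((\<lambda>t. if t \<in> {-1..1} then ?f t else 0) has_integral cap_int k m) UNIV"
    using integrable_integral[OF cap_integrable[of k m]]
    by (subst has_integral_restrict_UNIV) (simp add: cap_int_def)
  then have "(\<integral>\<^sup>+ t. ennreal (if t \<in> {-1..1} then ?f t else 0) \<partial>lborel) = ennreal (cap_int k m)"
    by (intro nn_integral_has_integral_lborel) (auto simp: abs_square_le_1 abs_le_iff)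
  moreover have "(\<integral>\<^sup>+ t. ennreal (if t \<in> {-1..1} then ?f t else 0) \<partial>lborel) =
      (\<integral>\<^sup>+ t. indicator {-1..1} t * ennreal (?f t) \<partial>lborel)"
    by (rule nn_integral_cong) simp
  ultimately show ?thesis by simp
qed

lemma cap_int_pos: "0 < cap_int k m"
proof -
  have "cap_int k m \<ge> 0"
    unfolding cap_int_def by (rule integral_nonneg[OF cap_integrable]) (auto simp: abs_square_le_1 abs_le_iff)
  moreover have "cap_int k m \<noteq> 0"
  proof
    assume "cap_int k m = 0"
    then have "\<forall>t\<in>{-1..1}. min 1 (2 * \<bar>t\<bar>) ^ k * sqrt (1 - t\<^sup>2) ^ m = (0::real)"
      unfolding cap_int_def
      by (subst (asm) integral_eq_0_iff[OF cap_int_continuous]) (auto simp: abs_square_le_1 abs_le_iff)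
    from this[rule_format, of "1/2"] show False by (simp add: power2_eq_square)
  qed
  ultimately show ?thesis by simp
qed

text \<open>In the double integral over \<open>x\<close> in the ball and the height \<open>t\<close>
  in the caps, the condition on \<open>x\<close> for fixed \<open>t\<close> is
  \<open>enorm x \<le> min 1 (2 * \<bar>t\<bar>)\<close>, a ball again. Exchanging the integrals
  therefore leaves a power of its radius.\<close>

lemma w_eq_cap_int: "w (Suc m) = cap_int (Suc m) m / cap_int 0 m"
proof -
  let ?d = "Suc m"
  let ?v = "\<lambda>m. ennreal (unit_ball_vol (real m))"
  let ?g = "\<lambda>t. indicator {-1..1} t * ennreal (sqrt (1 - t\<^sup>2) ^ m)"
  \<comment> \<open>The lens of \<open>x = 0\<close> is the whole ball, so the cap formula at 0
    supplies the normalising constant.\<close>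
  have 0: "?v ?d = ?v m * ennreal (cap_int 0 m)"
  proof -
    have e: "enorm ?d (\<lambda>i. 0) = 0" by (simp add: enorm_def)
    have "?v ?d = emeasure (lebd ?d) {y \<in> space (lebd ?d). enorm ?d y \<le> 1}"
      by (subst emeasure_lebd_ball) auto
    also have "\<dots> = (\<integral>\<^sup>+ y. indicator {y \<in> space (lebd ?d). enorm ?d y \<le> 1} y \<partial>lebd ?d)"
      by (rule nn_integral_indicator[symmetric]) measurable
    also have "\<dots> = lens_vol ?d (\<lambda>_. 0)"
      unfolding lens_vol_def by (rule nn_integral_cong) (simp add: indicator_def)
    also have "\<dots> = ?v m * ennreal (cap_int 0 m)"
      using nn_integral_cap[of 0 m] by (subst lens_vol_eq) (simp add: e indicator_def)
    finally show ?thesis .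
  qed
  have [measurable]: "?g \<in> borel_measurable borel" by measurable
  have "(\<integral>\<^sup>+ x. indicator {x. enorm ?d x \<le> 1} x * lens_vol ?d x \<partial>lebd ?d) =
    (\<integral>\<^sup>+ x. ?v m * (\<integral>\<^sup>+ t. indicator {x. enorm ?d x \<le> 1} x * (indicator {t. enorm ?d x \<le> 2 * \<bar>t\<bar>} t * ?g t) \<partial>lborel) \<partial>lebd ?d)"
    unfolding lens_vol_eq by (intro nn_integral_cong) (simp add: indicator_def)
  also have "\<dots> = ?v m * (\<integral>\<^sup>+ x. \<integral>\<^sup>+ t. indicator {x. enorm ?d x \<le> 1} x * (indicator {t. enorm ?d x \<le> 2 * \<bar>t\<bar>} t * ?g t) \<partial>lborel \<partial>lebd ?d)"
    by (rule nn_integral_cmult) measurable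
  also have "(\<integral>\<^sup>+ x. \<integral>\<^sup>+ t. indicator {x. enorm ?d x \<le> 1} x * (indicator {t. enorm ?d x \<le> 2 * \<bar>t\<bar>} t * ?g t) \<partial>lborel \<partial>lebd ?d) =
    (\<integral>\<^sup>+ t. \<integral>\<^sup>+ x. indicator {x. enorm ?d x \<le> 1} x * (indicator {t. enorm ?d x \<le> 2 * \<bar>t\<bar>} t * ?g t) \<partial>lebd ?d \<partial>lborel)"
  proof -
    interpret P: pair_sigma_finite "lebd ?d" "lborel :: real measure"
      by (intro pair_sigma_finite.intro sigma_finite_lebd lborel.sigma_finite_measure_axioms)
    show ?thesis
      by (rule P.Fubini'[symmetric]) (simp add: split_beta indicator_def, measurable)
  qed
  also have "\<dots> = (\<integral>\<^sup>+ t. ?v ?d * (indicator {-1..1} t * ennreal (min 1 (2 * \<bar>t\<bar>) ^ Suc m * sqrt (1 - t\<^sup>2) ^ m)) \<partial>lborel)"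
  proof (rule nn_integral_cong)
    fix t :: real
    have "(\<integral>\<^sup>+ x. indicator {x. enorm ?d x \<le> 1} x * (indicator {t. enorm ?d x \<le> 2 * \<bar>t\<bar>} t * ?g t) \<partial>lebd ?d) =
      (\<integral>\<^sup>+ x. ?g t * indicator {x \<in> space (lebd ?d). enorm ?d x \<le> min 1 (2 * \<bar>t\<bar>)} x \<partial>lebd ?d)"
      by (intro nn_integral_cong) (auto split: split_indicator)
    also have "\<dots> = ?g t * emeasure (lebd ?d) {x \<in> space (lebd ?d). enorm ?d x \<le> min 1 (2 * \<bar>t\<bar>)}"
      by (rule nn_integral_cmult_indicator) measurable
    also have "\<dots> = ?v ?d * (indicator {-1..1} t * ennreal (min 1 (2 * \<bar>t\<bar>) ^ Suc m * sqrt (1 - t\<^sup>2) ^ m))"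
      using ennreal_mult'[of "min 1 (2 * \<bar>t\<bar>) ^ Suc m" "sqrt (1 - t\<^sup>2) ^ m"]
      by (subst emeasure_lebd_ball) (simp_all add: ennreal_mult' mult_ac del: power_Suc)
    finally show "(\<integral>\<^sup>+ x. indicator {x. enorm ?d x \<le> 1} x * (indicator {t. enorm ?d x \<le> 2 * \<bar>t\<bar>} t * ?g t) \<partial>lebd ?d) =
       ?v ?d * (indicator {-1..1} t * ennreal (min 1 (2 * \<bar>t\<bar>) ^ Suc m * sqrt (1 - t\<^sup>2) ^ m))" .
  qed
  also have "\<dots> = ?v ?d * ennreal (cap_int (Suc m) m)"
    unfolding nn_integral_cap[symmetric] by (rule nn_integral_cmult) measurable
  finally have "ennreal (w ?d) * ?v ?d ^ 2 = ?v m * (?v ?d * ennreal (cap_int (Suc m) m))"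
    using w_mult_sq[of ?d] by simp
  then have "ennreal (w ?d * unit_ball_vol (real ?d) ^ 2) = ennreal (unit_ball_vol (real m) * (unit_ball_vol (real ?d) * cap_int (Suc m) m))"
    using cap_int_pos[of "Suc m" m] by (simp add: ennreal_mult' ennreal_power w_def)
  then have "w ?d * unit_ball_vol (real ?d) ^ 2 = unit_ball_vol (real m) * (unit_ball_vol (real ?d) * cap_int (Suc m) m)"
    using cap_int_pos[of "Suc m" m] by (subst (asm) ennreal_inj) (auto simp: w_def less_imp_le)
  moreover have "unit_ball_vol (real ?d) = unit_ball_vol (real m) * cap_int 0 m"
    using 0 cap_int_pos[of 0 m] by (simp add: ennreal_mult'[symmetric] less_imp_le del: of_nat_Suc)
  moreover have "unit_ball_vol (real m) > 0" "unit_ball_vol (real ?d) > 0" by auto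
  ultimately show ?thesis
    using cap_int_pos[of 0 m] by (simp add: field_simps power2_eq_square del: of_nat_Suc)
qed

section \<open>Comparison of consecutive dimensions and the gap around \<open>w d\<close>\<close>

lemma cap_int_0_antimono: "cap_int 0 (Suc m) \<le> cap_int 0 m"
  unfolding cap_int_def
  by (rule integral_le[OF cap_integrable cap_integrable]) (auto intro!: mult_left_le_one_le simp: abs_square_le_1 abs_le_iff)

text \<open>A case of Chebyshev's integral inequality: \<open>t \<mapsto> min 1 (2 \<bar>t\<bar>)\<close> and \<open>t \<mapsto> sqrt (1 - t\<^sup>2)\<close> are
  oppositely ordered, so it suffices to compare both with their values at the point where the
  latter equals its weighted mean.\<close>

lemma cap_int_chebyshev: "cap_int k (Suc m) * cap_int 0 m \<le> cap_int k m * cap_int 0 (Suc m)"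
proof -
  let ?\<psi> = "\<lambda>t::real. min 1 (2 * \<bar>t\<bar>) ^ k" and ?\<phi> = "\<lambda>t::real. sqrt (1 - t\<^sup>2)"
  define c where "c = cap_int 0 (Suc m) / cap_int 0 m"
  have c: "0 \<le> c" "c \<le> 1" using cap_int_pos[of 0 m] cap_int_pos[of 0 "Suc m"] cap_int_0_antimono[of m]
    by (auto simp: c_def)
  \<comment> \<open>Chosen so that \<open>?\<phi> s = c\<close>; \<open>c \<le> 1\<close> makes the
    root real.\<close>
  define s where "s = sqrt (1 - c\<^sup>2)"
  have s: "s \<ge> 0" "s\<^sup>2 = 1 - c\<^sup>2" using c by (auto simp: s_def abs_square_le_1)
  \<comment> \<open>As functions of \<open>\<bar>t\<bar>\<close>, \<open>?\<psi>\<close> is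
    nondecreasing and \<open>?\<phi>\<close> decreasing, so
    \<open>(?\<psi> t - ?\<psi> s) * (?\<phi> t - c)\<close> is never positive. Multiplied by
    \<open>?\<phi> t ^ m\<close> and expanded, this is the claim; the factors
    \<open>?\<psi> t ^ 0\<close> are 1 and mark the integrands of \<open>cap_int 0\<close>.\<close>
  have pt: "?\<psi> t * ?\<phi> t ^ Suc m - c * (?\<psi> t * ?\<phi> t ^ m) \<le> ?\<psi> s * (?\<psi> t ^ 0 * ?\<phi> t ^ Suc m - c * (?\<psi> t ^ 0 * ?\<phi> t ^ m))"
    if t: "t \<in> {-1..1}" for t
  proof -
    have t2: "0 \<le> 1 - t\<^sup>2" using t by (auto simp: abs_square_le_1 abs_le_iff)
    have "(?\<psi> t - ?\<psi> s) * (?\<phi> t - c) \<le> 0"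
    proof (cases "\<bar>t\<bar> \<le> s")
      case True
      then have "t\<^sup>2 \<le> s\<^sup>2" using abs_le_square_iff[of t s] s by simp
      then have "c \<le> ?\<phi> t" using s c by (intro real_le_rsqrt) linarith
      moreover have "?\<psi> t \<le> ?\<psi> s" using True s by (intro power_mono) auto
      ultimately show ?thesis by (intro mult_nonpos_nonneg) auto
    next
      case False
      then have "s\<^sup>2 \<le> t\<^sup>2" using abs_le_square_iff[of s t] s by simp
      then have "?\<phi> t \<le> c" using s c t2 by (intro real_le_lsqrt) linarith+
      moreover have "?\<psi> s \<le> ?\<psi> t" using False s by (intro power_mono) auto
      ultimately show ?thesis by (intro mult_nonneg_nonpos) auto
    qed
    then have "(?\<psi> t - ?\<psi> s) * (?\<phi> t - c) * ?\<phi> t ^ m \<le> 0" by (rule mult_nonpos_nonneg) (use t2 in auto)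
    then show ?thesis by (simp add: algebra_simps)
  qed
  have i0: "(\<lambda>t. ?\<psi> t ^ 0 * ?\<phi> t ^ n) integrable_on {-1..1}" for n
    using cap_integrable[of 0 n] by simp
  have c0: "cap_int 0 n = integral {-1..1} (\<lambda>t. ?\<psi> t ^ 0 * ?\<phi> t ^ n)" for n by (simp add: cap_int_def)
  have "cap_int k (Suc m) - c * cap_int k m =
      integral {-1..1} (\<lambda>t. ?\<psi> t * ?\<phi> t ^ Suc m - c * (?\<psi> t * ?\<phi> t ^ m))"
    unfolding cap_int_def
    by (subst integral_diff[OF cap_integrable integrable_on_mult_right[OF cap_integrable]])
      (simp only: integral_mult_right)
  also have "\<dots> \<le> integral {-1..1} (\<lambda>t. ?\<psi> s * (?\<psi> t ^ 0 * ?\<phi> t ^ Suc m - c * (?\<psi> t ^ 0 * ?\<phi> t ^ m)))"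
    by (intro integral_le integrable_diff integrable_on_mult_right cap_integrable i0 pt)
  also have "\<dots> = ?\<psi> s * (cap_int 0 (Suc m) - c * cap_int 0 m)"
    unfolding c0 integral_mult_right
    by (subst integral_diff[OF i0 integrable_on_mult_right[OF i0]]) (simp only: integral_mult_right)
  \<comment> \<open>The definition of \<open>c\<close> as a weighted mean is exactly what makes this
    vanish.\<close>
  also have "\<dots> = 0" using cap_int_pos[of 0 m] by (simp add: c_def)
  finally show ?thesis using cap_int_pos[of 0 m] by (simp add: c_def field_simps)
qed

text \<open>The difference of the integrands is continuous, nonnegative, and positive wherever
  \<open>0 < 2 * \<bar>t\<bar> < 1\<close>, for instance at 1/4, so its integral is not 0.\<close>

lemma cap_int_strict: "cap_int (Suc k) m < cap_int k m"
proof -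
  let ?f = "\<lambda>k t. min 1 (2 * \<bar>t\<bar>) ^ k * sqrt (1 - t\<^sup>2) ^ m :: real"
  have cont: "continuous_on {-1..1} (\<lambda>t. ?f k t - ?f (Suc k) t)"
    by (intro continuous_on_diff cap_int_continuous)
  have eq: "?f k t - ?f (Suc k) t = (1 - min 1 (2 * \<bar>t\<bar>)) * ?f k t" for t by (simp add: algebra_simps)
  have nn: "0 \<le> ?f k t - ?f (Suc k) t" if "t \<in> {-1..1}" for t
    unfolding eq using that by (auto intro!: mult_nonneg_nonneg simp: abs_square_le_1 abs_le_iff)
  have "cap_int k m - cap_int (Suc k) m = integral {-1..1} (\<lambda>t. ?f k t - ?f (Suc k) t)"
    unfolding cap_int_def by (rule integral_diff[symmetric, OF cap_integrable cap_integrable])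
  moreover have "\<dots> \<ge> 0"
    by (intro integral_nonneg integrable_diff cap_integrable nn)
  moreover have "\<dots> \<noteq> 0"
  proof
    assume "integral {-1..1} (\<lambda>t. ?f k t - ?f (Suc k) t) = 0"
    then have "\<forall>t\<in>{-1..1}. ?f k t - ?f (Suc k) t = 0"
      by (subst (asm) integral_eq_0_iff[OF cont _ nn]) auto
    from this[rule_format, of "1/4"] show False unfolding eq by (simp add: power2_eq_square)
  qed
  ultimately show ?thesis by simp
qed

text \<open>Both effects of the dimension are separated: at the weight of \<open>d + 1\<close> the
  exponent drops from \<open>d + 1\<close> to \<open>d\<close>, a strict gain, and then
  \<open>cap_int_chebyshev\<close> exchanges that weight for the one of \<open>d\<close>.\<close>

lemma w_strict_decreasing: "1 \<le> d \<Longrightarrow> w (Suc d) < w d"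
proof -
  assume "1 \<le> d"
  then obtain m where d: "d = Suc m" by (cases d) auto
  have p: "cap_int 0 m > 0" "cap_int 0 (Suc m) > 0" by (rule cap_int_pos)+
  have "cap_int (Suc (Suc m)) (Suc m) * cap_int 0 m < cap_int (Suc m) (Suc m) * cap_int 0 m"
    using p cap_int_strict by simp
  also have "\<dots> \<le> cap_int (Suc m) m * cap_int 0 (Suc m)" by (rule cap_int_chebyshev)
  finally show ?thesis unfolding d w_eq_cap_int using p by (simp add: field_simps)
qed

lemma w_strict_antimono: "1 \<le> s \<Longrightarrow> s < t \<Longrightarrow> w t < w s"
proof (induction t)
  case (Suc t)
  then show ?case using w_strict_decreasing[of t] by (cases "s = t") auto
qed simp

text \<open>By monotonicity the values closest to \<open>w d\<close> are those of
  \<open>d - 1\<close> and \<open>d + 1\<close>, so the minimum over infinitely many s is one over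
  two.\<close>

lemma w_gap:
  assumes "1 \<le> d"
  shows "\<exists>\<delta>>0. \<forall>s. 1 \<le> s \<and> s \<noteq> d \<longrightarrow> \<delta> \<le> \<bar>w s - w d\<bar>"
proof -
  \<comment> \<open>For \<open>d = 1\<close> there is no admissible smaller dimension, and any
    positive number may stand for the left gap.\<close>
  define g where "g = (if d = 1 then 1 else w (d - 1) - w d)"
  have g: "g > 0" using assms w_strict_antimono[of "d - 1" d] by (auto simp: g_def)
  have u: "w d - w (Suc d) > 0" using assms w_strict_decreasing by simp
  have "min g (w d - w (Suc d)) \<le> \<bar>w s - w d\<bar>" if s: "1 \<le> s" "s \<noteq> d" for s
  proof (cases "s < d")
    case True
    then have "d \<noteq> 1" "s \<le> d - 1" using s by auto
    then have "w (d - 1) \<le> w s" using s w_strict_antimono[of s "d - 1"] by (cases "s = d - 1") auto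
    then show ?thesis using \<open>d \<noteq> 1\<close> by (simp add: g_def)
  next
    case False
    then have "Suc d \<le> s" using s by auto
    then have "w s \<le> w (Suc d)" using w_strict_antimono[of "Suc d" s] by (cases "s = Suc d") auto
    then show ?thesis by simp
  qed
  then show ?thesis using g u by (intro exI[of _ "min g (w d - w (Suc d))"]) auto
qed

section \<open>Continuity of translations in \<open>L\<^sup>1\<close>\<close>

text \<open>Restriction to \<open>{..<d}\<close> makes the result a point of
  \<open>space (lebd d)\<close> for arbitrary arguments \<open>z\<close> and
  \<open>a\<close>.\<close>

definition vshift :: "nat \<Rightarrow> (nat \<Rightarrow> real) \<Rightarrow> real \<Rightarrow> (nat \<Rightarrow> real) \<Rightarrow> (nat \<Rightarrow> real)" where
  "vshift d z h a = (\<lambda>i\<in>{..<d}. z i + h * a i)"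

lemma measurable_vshift [measurable]:
  assumes "f \<in> measurable N (lebd d)" "g \<in> measurable N (lebd d)"
  shows "(\<lambda>x. vshift d (f x) h (g x)) \<in> measurable N (lebd d)"
proof (rule measurable_lebdI)
  fix i assume i: "i < d"
  have "(\<lambda>x. f x i + h * g x i) \<in> borel_measurable N"
    by (intro borel_measurable_add borel_measurable_times borel_measurable_const
        measurable_compose[OF _ measurable_lebd_component[OF i]] assms)
  then show "(\<lambda>x. vshift d (f x) h (g x) i) \<in> borel_measurable N" using i by (simp add: vshift_def)
qed (simp add: vshift_def)

lemma measurable_vshift_const [measurable]: "(\<lambda>z. vshift d z h a) \<in> measurable (lebd d) (lebd d)"
proof (rule measurable_lebdI)
  fix i assume i: "i < d"
  have "(\<lambda>x. x i + h * a i) \<in> borel_measurable (lebd d)"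
    by (intro borel_measurable_add borel_measurable_const measurable_lebd_component i)
  then show "(\<lambda>x. vshift d x h a i) \<in> borel_measurable (lebd d)" using i by (simp add: vshift_def)
qed (simp add: vshift_def)

lemma vshift_space: "vshift d z h a \<in> space (lebd d)"
  by (simp add: vshift_def space_lebd)

lemma nn_integral_vshift:
  assumes "g \<in> borel_measurable (lebd d)"
  shows "(\<integral>\<^sup>+ z. g (vshift d z h a) \<partial>lebd d) = (\<integral>\<^sup>+ z. g z \<partial>lebd d)"
  using nn_integral_lebd_affine[of 1 g d "\<lambda>i. h * a i"] assms by (simp add: vshift_def add.commute)

text \<open>Continuity along each fixed direction \<open>a\<close> only: in the application the
  rescaled offsets stay fixed while their scale tends to 0.\<close>

definition l1_continuous :: "nat \<Rightarrow> ((nat \<Rightarrow> real) \<Rightarrow> real) \<Rightarrow> bool" where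
  "l1_continuous d g \<longleftrightarrow> g \<in> borel_measurable (lebd d) \<and>
     (\<forall>a h. h \<longlonglongrightarrow> 0 \<longrightarrow> (\<lambda>n. \<integral>\<^sup>+ z. ennreal \<bar>g (vshift d z (h n) a) - g z\<bar> \<partial>lebd d) \<longlonglongrightarrow> 0)"

lemma tendsto_0_ennrealI:
  fixes X :: "nat \<Rightarrow> ennreal"
  assumes "\<And>e. e > 0 \<Longrightarrow> eventually (\<lambda>n. X n \<le> ennreal e) sequentially"
  shows "X \<longlonglongrightarrow> 0"
proof (rule order_tendstoI)
  fix a :: ennreal assume "0 < a"
  then obtain b where b: "0 < b" "b < a" using dense by blast
  then obtain e where e: "b = ennreal e" "e > 0" by (cases b) auto
  show "eventually (\<lambda>n. X n < a) sequentially"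
    using assms[OF e(2)] by eventually_elim (use b e in auto)
qed simp

text \<open>The three-epsilon argument. Translation invariance makes the distance of the shifted
  functions equal to the distance of the unshifted ones, so both outer errors are controlled by
  \<open>lim\<close>.\<close>

lemma l1_continuous_approx:
  assumes g[measurable]: "g \<in> borel_measurable (lebd d)"
    and s: "\<And>i. l1_continuous d (s i)"
    and lim: "(\<lambda>i::nat. \<integral>\<^sup>+ z. ennreal \<bar>s i z - g z\<bar> \<partial>lebd d) \<longlonglongrightarrow> 0"
  shows "l1_continuous d g"
  unfolding l1_continuous_def
proof (intro conjI g allI impI tendsto_0_ennrealI)
  fix a :: "nat \<Rightarrow> real" and h :: "nat \<Rightarrow> real" and e :: real
  assume h: "h \<longlonglongrightarrow> 0" and e: "e > 0"
  from e have "0 < ennreal (e / 3)" by simp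
  from order_tendstoD(2)[OF lim this] obtain i where i: "(\<integral>\<^sup>+ z. ennreal \<bar>s i z - g z\<bar> \<partial>lebd d) < ennreal (e / 3)"
    by (auto simp: eventually_sequentially)
  have [measurable]: "s i \<in> borel_measurable (lebd d)" using s by (simp add: l1_continuous_def)
  have "(\<lambda>n. \<integral>\<^sup>+ z. ennreal \<bar>s i (vshift d z (h n) a) - s i z\<bar> \<partial>lebd d) \<longlonglongrightarrow> 0"
    using s h by (simp add: l1_continuous_def)
  from order_tendstoD(2)[OF this \<open>0 < ennreal (e / 3)\<close>]
  show "eventually (\<lambda>n. (\<integral>\<^sup>+ z. ennreal \<bar>g (vshift d z (h n) a) - g z\<bar> \<partial>lebd d) \<le> ennreal e) sequentially"
  proof eventually_elim
    case (elim n)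
    have "(\<integral>\<^sup>+ z. ennreal \<bar>g (vshift d z (h n) a) - g z\<bar> \<partial>lebd d) \<le>
      (\<integral>\<^sup>+ z. ennreal \<bar>s i (vshift d z (h n) a) - g (vshift d z (h n) a)\<bar> +
         (ennreal \<bar>s i (vshift d z (h n) a) - s i z\<bar> + ennreal \<bar>s i z - g z\<bar>) \<partial>lebd d)"
      by (intro nn_integral_mono) (auto simp flip: ennreal_plus)
    also have "\<dots> = (\<integral>\<^sup>+ z. ennreal \<bar>s i (vshift d z (h n) a) - g (vshift d z (h n) a)\<bar> \<partial>lebd d) +
       ((\<integral>\<^sup>+ z. ennreal \<bar>s i (vshift d z (h n) a) - s i z\<bar> \<partial>lebd d) + (\<integral>\<^sup>+ z. ennreal \<bar>s i z - g z\<bar> \<partial>lebd d))"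
      by (subst nn_integral_add, measurable)+
    also have "(\<integral>\<^sup>+ z. ennreal \<bar>s i (vshift d z (h n) a) - g (vshift d z (h n) a)\<bar> \<partial>lebd d) =
        (\<integral>\<^sup>+ z. ennreal \<bar>s i z - g z\<bar> \<partial>lebd d)"
      by (rule nn_integral_vshift[of "\<lambda>z. ennreal \<bar>s i z - g z\<bar>"]) measurable
    also have "\<dots> + ((\<integral>\<^sup>+ z. ennreal \<bar>s i (vshift d z (h n) a) - s i z\<bar> \<partial>lebd d) + (\<integral>\<^sup>+ z. ennreal \<bar>s i z - g z\<bar> \<partial>lebd d))
       \<le> ennreal (e / 3) + (ennreal (e / 3) + ennreal (e / 3))"
      using i elim by (intro add_mono) auto
    also have "\<dots> = ennreal e" using e by (simp flip: ennreal_plus)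
    finally show ?case .
  qed
qed

text \<open>Unions, differences, multiples and sums all satisfy such a pointwise Lipschitz bound, so
  this one closure property covers every algebraic step below.\<close>

lemma l1_continuous_le_sum:
  assumes "l1_continuous d f" "l1_continuous d g" and k[measurable]: "k \<in> borel_measurable (lebd d)"
    and le: "\<And>x y. x \<in> space (lebd d) \<Longrightarrow> y \<in> space (lebd d) \<Longrightarrow> \<bar>k x - k y\<bar> \<le> C * (\<bar>f x - f y\<bar> + \<bar>g x - g y\<bar>)"
    and C: "C \<ge> 0"
  shows "l1_continuous d k"
  unfolding l1_continuous_def
proof (intro conjI k allI impI)
  fix a :: "nat \<Rightarrow> real" and h :: "nat \<Rightarrow> real"
  assume h: "h \<longlonglongrightarrow> 0"
  let ?D = "\<lambda>f n. \<integral>\<^sup>+ z. ennreal \<bar>f (vshift d z (h n) a) - f z\<bar> \<partial>lebd d"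
  have [measurable]: "f \<in> borel_measurable (lebd d)" "g \<in> borel_measurable (lebd d)"
    and lim: "?D f \<longlonglongrightarrow> 0" "?D g \<longlonglongrightarrow> 0"
    using assms h by (auto simp: l1_continuous_def)
  have "(\<lambda>n. ennreal C * (?D f n + ?D g n)) \<longlonglongrightarrow> ennreal C * (0 + 0)"
    by (intro tendsto_mult_ennreal tendsto_const tendsto_add lim) auto
  moreover have "?D k n \<le> ennreal C * (?D f n + ?D g n)" for n
  proof -
    have "?D k n \<le> (\<integral>\<^sup>+ z. ennreal C * (ennreal \<bar>f (vshift d z (h n) a) - f z\<bar> + ennreal \<bar>g (vshift d z (h n) a) - g z\<bar>) \<partial>lebd d)"
      using le C by (intro nn_integral_mono) (simp add: vshift_space flip: ennreal_plus ennreal_mult)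
    also have "\<dots> = ennreal C * (?D f n + ?D g n)"
      by (subst nn_integral_cmult, measurable, subst nn_integral_add, measurable)
    finally show ?thesis .
  qed
  ultimately show "?D k \<longlonglongrightarrow> 0"
    by (intro tendsto_sandwich[where f="\<lambda>_. 0" and g="?D k" and h="\<lambda>n. ennreal C * (?D f n + ?D g n)"]) auto
qed

section \<open>From boxes to measurable sets to integrable functions\<close>

definition box_d :: "nat \<Rightarrow> (nat \<Rightarrow> real) \<Rightarrow> (nat \<Rightarrow> real) \<Rightarrow> (nat \<Rightarrow> real) set" where
  "box_d d l u = (\<Pi>\<^sub>E i\<in>{..<d}. {l i..u i})"

lemma sets_box_d [measurable]: "box_d d l u \<in> sets (lebd d)"
  unfolding box_d_def lebd_def by measurable

lemma emeasure_box_d: "emeasure (lebd d) (box_d d l u) < \<infinity>"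
proof -
  have "emeasure (lebd d) (box_d d l u) = (\<Prod>i<d. emeasure lborel {l i..u i})"
    unfolding lebd_def box_d_def by (rule leb_prod.emeasure_PiM) auto
  also have "\<dots> = (\<Prod>i<d. ennreal (if l i \<le> u i then u i - l i else 0))"
    by (intro prod.cong) (auto simp: emeasure_lborel_Icc_eq)
  also have "\<dots> = ennreal (\<Prod>i<d. if l i \<le> u i then u i - l i else 0)"
    by (rule prod_ennreal) auto
  also have "\<dots> < \<infinity>" by simp
  finally show ?thesis .
qed

lemma AE_lebd_component_neq:
  assumes "i < d"
  shows "AE z in lebd d. z i \<noteq> (c::real)"
proof (rule AE_I)
  let ?N = "\<Pi>\<^sub>E j\<in>{..<d}. if j = i then {c} else UNIV"
  show "{z \<in> space (lebd d). \<not> z i \<noteq> c} \<subseteq> ?N" by (auto simp: space_lebd PiE_iff extensional_def)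
  show "?N \<in> sets (lebd d)" unfolding lebd_def by measurable
  have "emeasure (lebd d) ?N = (\<Prod>j<d. emeasure lborel (if j = i then {c} else UNIV))"
    unfolding lebd_def by (rule leb_prod.emeasure_PiM) auto
  also have "\<dots> = 0" using assms by (intro prod_zero) auto
  finally show "emeasure (lebd d) ?N = 0" .
qed

text \<open>Off the faces, which are null, membership in the box is unaffected by small shifts, so
  the integrand is eventually 0. A convergent \<open>h\<close> is bounded, and the box enlarged
  accordingly dominates all shifts.\<close>

lemma l1_continuous_box: "l1_continuous d (indicator (box_d d l u))"
  unfolding l1_continuous_def
proof (intro conjI allI impI)
  fix a :: "nat \<Rightarrow> real" and h :: "nat \<Rightarrow> real"
  assume h: "h \<longlonglongrightarrow> 0"
  then obtain K where K: "\<And>n. \<bar>h n\<bar> \<le> K"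
    using convergent_imp_Bseq[of h] by (auto simp: convergent_def Bseq_def)
  let ?B = "box_d d l u" and ?B' = "box_d d (\<lambda>i. l i - K * \<bar>a i\<bar>) (\<lambda>i. u i + K * \<bar>a i\<bar>)"
  let ?D = "\<lambda>n z. ennreal \<bar>indicator ?B (vshift d z (h n) a) - indicator ?B z\<bar>"
  have K0: "0 \<le> K" using K[of 0] by linarith
  have "(\<lambda>n. \<integral>\<^sup>+ z. ?D n z \<partial>lebd d) \<longlonglongrightarrow> (\<integral>\<^sup>+ z. 0 \<partial>lebd d)"
  proof (rule nn_integral_dominated_convergence)
    show "(\<integral>\<^sup>+ z. indicator ?B' z \<partial>lebd d) < \<infinity>" using emeasure_box_d by simp
    show "AE z in lebd d. ?D n z \<le> indicator ?B' z" for n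
    proof (rule AE_I2)
      fix z assume z: "z \<in> space (lebd d)"
      have ha: "\<bar>h n * a i\<bar> \<le> K * \<bar>a i\<bar>" "0 \<le> K * \<bar>a i\<bar>" for i
        using K[of n] K0 by (auto simp: abs_mult intro: mult_right_mono)
      have "z \<in> ?B'" if "vshift d z (h n) a \<in> ?B \<or> z \<in> ?B"
      proof -
        have "l i - K * \<bar>a i\<bar> \<le> z i \<and> z i \<le> u i + K * \<bar>a i\<bar>" if i: "i < d" for i
          using \<open>vshift d z (h n) a \<in> ?B \<or> z \<in> ?B\<close>
        proof
          assume "vshift d z (h n) a \<in> ?B"
          then have "l i \<le> z i + h n * a i" "z i + h n * a i \<le> u i"
            using i by (auto simp: box_d_def vshift_def PiE_iff)
          then show ?thesis using ha[of i] by linarith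
        next
          assume "z \<in> ?B"
          then have "l i \<le> z i" "z i \<le> u i" using i by (auto simp: box_d_def PiE_iff)
          then show ?thesis using ha[of i] by linarith
        qed
        then show ?thesis using z by (auto simp: box_d_def space_lebd PiE_iff)
      qed
      then show "?D n z \<le> indicator ?B' z" by (auto split: split_indicator)
    qed
    have "AE z in lebd d. \<forall>i\<in>{..<d}. z i \<noteq> l i \<and> z i \<noteq> u i"
      by (intro AE_finite_allI AE_conjI) (auto intro: AE_lebd_component_neq)
    then show "AE z in lebd d. (\<lambda>n. ?D n z) \<longlonglongrightarrow> 0"
      using AE_space
    proof eventually_elim
      case (elim z)
      note z = elim(1)
      have "eventually (\<lambda>n. \<forall>i\<in>{..<d}. (z i + h n * a i \<in> {l i..u i} \<longleftrightarrow> z i \<in> {l i..u i})) sequentially"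
      proof (rule eventually_ball_finite, simp, rule ballI)
        fix i assume i: "i \<in> {..<d}"
        have lim: "(\<lambda>n. z i + h n * a i) \<longlonglongrightarrow> z i" using h by (auto intro!: tendsto_eq_intros)
        have "z i < l i \<or> l i < z i \<and> z i < u i \<or> u i < z i" using z i by force
        then show "eventually (\<lambda>n. z i + h n * a i \<in> {l i..u i} \<longleftrightarrow> z i \<in> {l i..u i}) sequentially"
        proof (elim disjE conjE)
          assume "z i < l i"
          from order_tendstoD(2)[OF lim this] show ?thesis by eventually_elim (use \<open>z i < l i\<close> in auto)
        next
          assume "u i < z i"
          from order_tendstoD(1)[OF lim this] show ?thesis by eventually_elim (use \<open>u i < z i\<close> in auto)
        next
          assume "l i < z i" "z i < u i"
          from order_tendstoD(1)[OF lim this(1)] order_tendstoD(2)[OF lim this(2)]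
          show ?thesis by eventually_elim (use \<open>l i < z i\<close> \<open>z i < u i\<close> in auto)
        qed
      qed
      then have "eventually (\<lambda>n. ?D n z = 0) sequentially"
      proof eventually_elim
        case n: (elim n)
        have "vshift d z (h n) a \<in> ?B \<longleftrightarrow> (\<forall>i\<in>{..<d}. z i + h n * a i \<in> {l i..u i})"
          by (simp add: box_d_def vshift_def PiE_iff)
        moreover have "z \<in> ?B \<longleftrightarrow> (\<forall>i\<in>{..<d}. z i \<in> {l i..u i})"
          using elim(2) by (simp add: box_d_def space_lebd PiE_iff)
        ultimately have "vshift d z (h n) a \<in> ?B \<longleftrightarrow> z \<in> ?B"
          using n by blast
        then show ?case by (simp add: indicator_def)
      qed
      then show "(\<lambda>n. ?D n z) \<longlonglongrightarrow> 0" by (rule tendsto_eventually)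
    qed
  qed measurable
  then show "(\<lambda>n. \<integral>\<^sup>+ z. ?D n z \<partial>lebd d) \<longlonglongrightarrow> 0" by simp
qed measurable

text \<open>The sets whose trace on a fixed cube has an \<open>L\<^sup>1\<close>-continuous indicator form a \<open>\<sigma>\<close>-algebra.\<close>

lemma l1_continuous_inter_box:
  fixes k :: real
  assumes A: "A \<in> sets (lebd d)"
  defines "Q \<equiv> box_d d (\<lambda>_. - k) (\<lambda>_. k)"
  shows "l1_continuous d (indicator (A \<inter> Q))"
proof -
  define \<P> where "\<P> = {A \<in> sets (lebd d). l1_continuous d (indicator (A \<inter> Q))}"
  have Q[measurable]: "Q \<in> sets (lebd d)" unfolding Q_def by measurable
  have Qc: "l1_continuous d (indicator Q)" unfolding Q_def by (rule l1_continuous_box)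
  have un: "A \<union> B \<in> \<P>" if "A \<in> \<P>" "B \<in> \<P>" for A B
  proof -
    have "l1_continuous d (indicator ((A \<union> B) \<inter> Q))"
      by (rule l1_continuous_le_sum[of d "indicator (A \<inter> Q)" "indicator (B \<inter> Q)" _ 1])
        (use that in \<open>auto simp: \<P>_def indicator_def\<close>)
    then show ?thesis using that by (auto simp: \<P>_def)
  qed
  have e: "{} \<in> \<P>" by (auto simp: \<P>_def l1_continuous_def)
  have sa: "sigma_algebra (space (lebd d)) \<P>"
    unfolding sigma_algebra_iff2
  proof (intro conjI ballI allI impI e)
    show "\<P> \<subseteq> Pow (space (lebd d))" using sets.sets_into_space by (auto simp: \<P>_def)
  next
    fix A assume A: "A \<in> \<P>"
    have "l1_continuous d (indicator ((space (lebd d) - A) \<inter> Q))"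
      by (rule l1_continuous_le_sum[of d "indicator (A \<inter> Q)" "indicator Q" _ 1])
        (use A Qc in \<open>auto simp: \<P>_def indicator_def\<close>)
    then show "space (lebd d) - A \<in> \<P>" using A by (auto simp: \<P>_def)
  next
    fix A :: "nat \<Rightarrow> _" assume A: "range A \<subseteq> \<P>"
    then have [measurable]: "A i \<in> sets (lebd d)" for i by (auto simp: \<P>_def)
    have fin: "(\<Union>i<n. A i) \<in> \<P>" for n
    proof (induction n)
      case (Suc n)
      have "A n \<union> (\<Union>i<n. A i) \<in> \<P>" using A Suc by (intro un) auto
      then show ?case by (simp add: lessThan_Suc)
    qed (use e in simp)
    let ?U = "\<Union>i. A i" and ?V = "\<lambda>n. \<Union>i<n. A i"
    have "l1_continuous d (indicator (?U \<inter> Q))"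
    proof (rule l1_continuous_approx[where s="\<lambda>n. indicator (?V n \<inter> Q)"])
      show "l1_continuous d (indicator (?V n \<inter> Q))" for n using fin[of n] by (simp add: \<P>_def)
      \<comment> \<open>Finite unions approximate the countable one in L^1 by continuity from above;
        the intersection with the cube \<open>Q\<close> provides the finite measure this
        requires.\<close>
      have "(\<lambda>n. emeasure (lebd d) ((?U - ?V n) \<inter> Q)) \<longlonglongrightarrow> emeasure (lebd d) (\<Inter>n. (?U - ?V n) \<inter> Q)"
      proof (rule Lim_emeasure_decseq)
        show "decseq (\<lambda>n. (?U - ?V n) \<inter> Q)" by (fastforce simp: decseq_def)
        fix n
        have "emeasure (lebd d) ((?U - ?V n) \<inter> Q) \<le> emeasure (lebd d) Q" by (rule emeasure_mono) auto
        also have "\<dots> < \<infinity>" unfolding Q_def by (rule emeasure_box_d)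
        finally show "emeasure (lebd d) ((?U - ?V n) \<inter> Q) \<noteq> \<infinity>" by simp
      qed auto
      also have "(\<Inter>n. (?U - ?V n) \<inter> Q) = {}" by auto
      also have "(\<lambda>n. emeasure (lebd d) ((?U - ?V n) \<inter> Q)) =
          (\<lambda>n. \<integral>\<^sup>+ z. ennreal \<bar>indicator (?V n \<inter> Q) z - indicator (?U \<inter> Q) z\<bar> \<partial>lebd d)"
      proof
        fix n
        have "emeasure (lebd d) ((?U - ?V n) \<inter> Q) = (\<integral>\<^sup>+ z. indicator ((?U - ?V n) \<inter> Q) z \<partial>lebd d)"
          by (rule nn_integral_indicator[symmetric]) measurable
        also have "\<dots> = (\<integral>\<^sup>+ z. ennreal \<bar>indicator (?V n \<inter> Q) z - indicator (?U \<inter> Q) z\<bar> \<partial>lebd d)"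
          by (intro nn_integral_cong) (auto simp: indicator_def)
        finally show "emeasure (lebd d) ((?U - ?V n) \<inter> Q) = \<dots>" .
      qed
      finally show "(\<lambda>n. \<integral>\<^sup>+ z. ennreal \<bar>indicator (?V n \<inter> Q) z - indicator (?U \<inter> Q) z\<bar> \<partial>lebd d) \<longlonglongrightarrow> 0"
        by simp
    qed measurable
    then show "?U \<in> \<P>" by (auto simp: \<P>_def)
  qed
  interpret \<P>: sigma_algebra "space (lebd d)" \<P> by (rule sa)
  \<comment> \<open>A measure space, with the zero measure, whose \<sigma>-algebra is
    \<open>\<P>\<close>. The identity from it to \<open>lebd d\<close> is measurable iff
    \<open>\<P>\<close> contains all measurable sets, and this can be tested on the coordinates:
    half spaces cut boxes out of \<open>Q\<close>.\<close>
  let ?N = "measure_of (space (lebd d)) \<P> (\<lambda>_. 0)"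
  have N: "space ?N = space (lebd d)" "sets ?N = \<P>"
    by (simp_all add: space_measure_of_conv \<P>.sets_measure_of_eq)
  have "(\<lambda>x. x) \<in> measurable ?N (lebd d)"
  proof (rule measurable_lebdI)
    fix i assume i: "i < d"
    have "{z \<in> space (lebd d). z i \<le> c} \<in> \<P>" for c
    proof -
      have [measurable]: "(\<lambda>z. z i) \<in> borel_measurable (lebd d)" by (rule measurable_lebd_component[OF i])
      have "{z \<in> space (lebd d). z i \<le> c} \<inter> Q = box_d d (\<lambda>_. - k) (\<lambda>j. if j = i then min k c else k)"
        (is "?L = ?R")
      proof (intro set_eqI iffI)
        fix z assume z: "z \<in> ?L"
        then have "\<And>j. j < d \<Longrightarrow> - k \<le> z j \<and> z j \<le> k" "z i \<le> c" "z \<in> space (lebd d)"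
          by (auto simp: Q_def box_d_def PiE_iff)
        then show "z \<in> ?R" by (simp add: box_d_def space_lebd PiE_iff)
      next
        fix z assume z: "z \<in> ?R"
        then have b: "- k \<le> z j \<and> z j \<le> (if j = i then min k c else k)" if "j < d" for j
          using that by (simp add: box_d_def PiE_iff)
        have "z \<in> space (lebd d)" using z by (simp add: box_d_def space_lebd PiE_iff)
        moreover have "- k \<le> z j \<and> z j \<le> k" if "j < d" for j using b[OF that] by (auto split: if_splits)
        moreover have "z i \<le> c" using b[OF i] by simp
        ultimately show "z \<in> ?L" by (simp add: Q_def box_d_def space_lebd PiE_iff)
      qed
      then show ?thesis by (auto simp: \<P>_def intro: l1_continuous_box)
    qed
    then show "(\<lambda>x. x i) \<in> borel_measurable ?N"
      by (subst borel_measurable_iff_le) (simp add: N)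
  next
    fix x i assume "x \<in> space ?N" "d \<le> i"
    then have "x \<in> space (lebd d)" by (simp only: N)
    then show "x i = undefined" using \<open>d \<le> i\<close> by (simp add: space_lebd PiE_iff extensional_def)
  qed
  from measurable_sets[OF this A] have "A \<in> \<P>"
    using sets.sets_into_space[OF A] by (simp add: N Int_absorb2)
  then show ?thesis by (simp add: \<P>_def)
qed

text \<open>Exhaustion by cubes: since \<open>A\<close> has finite measure, the part outside a large
  cube is small in L^1.\<close>

lemma l1_continuous_indicator:
  assumes A[measurable]: "A \<in> sets (lebd d)" and fin: "emeasure (lebd d) A < \<infinity>"
  shows "l1_continuous d (indicator A)"
proof -
  define Q where "Q n = box_d d (\<lambda>_. - real n) (\<lambda>_. real n)" for n
  have [measurable]: "Q n \<in> sets (lebd d)" for n unfolding Q_def by measurable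
  show ?thesis
  proof (rule l1_continuous_approx[where s="\<lambda>n. indicator (A \<inter> Q n)"])
    show "l1_continuous d (indicator (A \<inter> Q n))" for n
      unfolding Q_def by (rule l1_continuous_inter_box[OF A])
    have "(\<lambda>n. emeasure (lebd d) (A - Q n)) \<longlonglongrightarrow> emeasure (lebd d) (\<Inter>n. A - Q n)"
    proof (rule Lim_emeasure_decseq)
      show "decseq (\<lambda>n. A - Q n)" by (force simp: decseq_def Q_def box_d_def PiE_iff)
      fix n
      have "emeasure (lebd d) (A - Q n) \<le> emeasure (lebd d) A" by (rule emeasure_mono) auto
      then show "emeasure (lebd d) (A - Q n) \<noteq> \<infinity>" using fin by auto
    qed auto
    also have "(\<Inter>n. A - Q n) = {}"
    proof -
      have "\<exists>n. z \<in> Q n" if "z \<in> A" for z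
      proof -
        obtain n where n: "(\<Sum>i<d. \<bar>z i\<bar>) \<le> real n" using real_arch_simple by blast
        have "\<bar>z i\<bar> \<le> real n" if "i < d" for i
          using member_le_sum[of i "{..<d}" "\<lambda>i. \<bar>z i\<bar>"] that n by auto
        then have "z \<in> Q n" using sets.sets_into_space[OF A] \<open>z \<in> A\<close>
          by (fastforce simp: Q_def box_d_def PiE_iff space_lebd abs_le_iff)
        then show ?thesis ..
      qed
      then show ?thesis by auto
    qed
    also have "(\<lambda>n. emeasure (lebd d) (A - Q n)) = (\<lambda>n. \<integral>\<^sup>+ z. ennreal \<bar>indicator (A \<inter> Q n) z - indicator A z\<bar> \<partial>lebd d)"
    proof
      fix n
      have "emeasure (lebd d) (A - Q n) = (\<integral>\<^sup>+ z. indicator (A - Q n) z \<partial>lebd d)"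
        by (rule nn_integral_indicator[symmetric]) measurable
      also have "\<dots> = (\<integral>\<^sup>+ z. ennreal \<bar>indicator (A \<inter> Q n) z - indicator A z\<bar> \<partial>lebd d)"
        by (intro nn_integral_cong) (auto simp: indicator_def)
      finally show "emeasure (lebd d) (A - Q n) = \<dots>" .
    qed
    finally show "(\<lambda>n. \<integral>\<^sup>+ z. ennreal \<bar>indicator (A \<inter> Q n) z - indicator A z\<bar> \<partial>lebd d) \<longlonglongrightarrow> 0" by simp
  qed measurable
qed

lemma l1_continuous_integrable:
  assumes "integrable (lebd d) g"
  shows "l1_continuous d g"
  using assms
proof (induction rule: integrable_induct)
  case (base A c)
  have "l1_continuous d (indicator A)" by (rule l1_continuous_indicator) (use base in auto)
  from l1_continuous_le_sum[OF this this, of _ "\<bar>c\<bar>"] show ?case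
    using base(1) by (auto simp: indicator_def abs_mult)
next
  case (add f g)
  show ?case
    by (rule l1_continuous_le_sum[OF add(3,4), of _ 1]) (use add(1,2) in auto)
next
  case (lim f s)
  have [measurable]: "f \<in> borel_measurable (lebd d)" "\<And>i. s i \<in> borel_measurable (lebd d)" using lim by auto
  show ?case
  proof (rule l1_continuous_approx[where s=s])
    have "(\<lambda>i. \<integral>\<^sup>+ z. ennreal \<bar>s i z - f z\<bar> \<partial>lebd d) \<longlonglongrightarrow> (\<integral>\<^sup>+ z. 0 \<partial>lebd d)"
    \<comment> \<open>The approximating simple functions are bounded by
      \<open>2 * \<bar>f z\<bar>\<close>, whence the factor 3.\<close>
    proof (rule nn_integral_dominated_convergence[where w="\<lambda>z. ennreal (3 * \<bar>f z\<bar>)"])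
      show "AE z in lebd d. ennreal \<bar>s i z - f z\<bar> \<le> ennreal (3 * \<bar>f z\<bar>)" for i
      proof (rule AE_I2)
        fix z assume "z \<in> space (lebd d)"
        from lim(3)[OF this, of i] show "ennreal \<bar>s i z - f z\<bar> \<le> ennreal (3 * \<bar>f z\<bar>)" by simp
      qed
      have "integrable (lebd d) (\<lambda>z. 3 * \<bar>f z\<bar>)" using lim by auto
      then have "(\<integral>\<^sup>+ z. ennreal (norm (3 * \<bar>f z\<bar>)) \<partial>lebd d) < \<infinity>"
        by (simp only: integrable_iff_bounded)
      moreover have "norm (3 * \<bar>f z\<bar>) = 3 * \<bar>f z\<bar>" for z by (simp add: abs_mult)
      ultimately show "(\<integral>\<^sup>+ z. ennreal (3 * \<bar>f z\<bar>) \<partial>lebd d) < \<infinity>" by (simp only:)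
      show "AE z in lebd d. (\<lambda>i. ennreal \<bar>s i z - f z\<bar>) \<longlonglongrightarrow> 0"
      proof (rule AE_I2)
        fix z assume "z \<in> space (lebd d)"
        then have "(\<lambda>i. s i z) \<longlonglongrightarrow> f z" using lim by blast
        then have "(\<lambda>i. \<bar>s i z - f z\<bar>) \<longlonglongrightarrow> 0" by (simp add: LIM_zero tendsto_rabs_zero)
        from tendsto_ennrealI[OF this] show "(\<lambda>i. ennreal \<bar>s i z - f z\<bar>) \<longlonglongrightarrow> 0" by simp
      qed
    qed measurable
    then show "(\<lambda>i. \<integral>\<^sup>+ z. ennreal \<bar>s i z - f z\<bar> \<partial>lebd d) \<longlonglongrightarrow> 0" by simp
  qed (use lim in auto)
qed

section \<open>Correlations of a density at small distances\<close>

definition shift3 :: "nat \<Rightarrow> ((nat \<Rightarrow> real) \<Rightarrow> real) \<Rightarrow> real \<Rightarrow> (nat \<Rightarrow> real) \<Rightarrow> (nat \<Rightarrow> real) \<Rightarrow> ennreal" where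
  "shift3 d f h a b = (\<integral>\<^sup>+ z. ennreal (f z * f (vshift d z h a) * f (vshift d z h b)) \<partial>lebd d)"

lemma mult3_le_cubes:
  fixes x y z :: real
  assumes "x \<ge> 0" "y \<ge> 0" "z \<ge> 0"
  shows "3 * (x * y * z) \<le> x ^ 3 + y ^ 3 + z ^ 3"
proof -
  have "x ^ 3 + y ^ 3 + z ^ 3 - 3 * (x * y * z) = (x + y + z) * ((x - y)\<^sup>2 + (y - z)\<^sup>2 + (z - x)\<^sup>2) / 2"
    by (simp add: power2_eq_square power3_eq_cube algebra_simps)
  also have "\<dots> \<ge> 0" using assms by simp
  finally show ?thesis by simp
qed

text \<open>After AM-GM, translation invariance gives all three cubes the same integral. The bound
  is uniform in \<open>h\<close>, \<open>a\<close> and \<open>b\<close>, so it also serves as the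
  dominating constant when offsets are integrated over a set \<open>K\<close>.\<close>

lemma shift3_le:
  assumes [measurable]: "f \<in> borel_measurable (lebd d)" and nn: "\<And>z. f z \<ge> 0"
  shows "shift3 d f h a b \<le> (\<integral>\<^sup>+ z. ennreal (f z ^ 3) \<partial>lebd d)"
proof -
  let ?F = "\<integral>\<^sup>+ z. ennreal (f z ^ 3) \<partial>lebd d"
  have "3 * shift3 d f h a b = (\<integral>\<^sup>+ z. 3 * ennreal (f z * f (vshift d z h a) * f (vshift d z h b)) \<partial>lebd d)"
    unfolding shift3_def by (rule nn_integral_cmult[symmetric]) measurable
  also have "\<dots> \<le> (\<integral>\<^sup>+ z. ennreal (f z ^ 3) + (ennreal (f (vshift d z h a) ^ 3) + ennreal (f (vshift d z h b) ^ 3)) \<partial>lebd d)"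
  proof (rule nn_integral_mono)
    fix z
    have "3 * ennreal (f z * f (vshift d z h a) * f (vshift d z h b)) = ennreal (3 * (f z * f (vshift d z h a) * f (vshift d z h b)))"
      by (simp add: ennreal_mult')
    also have "\<dots> \<le> ennreal (f z ^ 3 + f (vshift d z h a) ^ 3 + f (vshift d z h b) ^ 3)"
      by (intro ennreal_leI mult3_le_cubes nn)
    finally show "3 * ennreal (f z * f (vshift d z h a) * f (vshift d z h b)) \<le> ennreal (f z ^ 3) + (ennreal (f (vshift d z h a) ^ 3) + ennreal (f (vshift d z h b) ^ 3))"
      by (simp add: nn add.assoc flip: ennreal_plus)
  qed
  also have "\<dots> = ?F + ((\<integral>\<^sup>+ z. ennreal (f (vshift d z h a) ^ 3) \<partial>lebd d) + (\<integral>\<^sup>+ z. ennreal (f (vshift d z h b) ^ 3) \<partial>lebd d))"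
    by (subst nn_integral_add, measurable)+
  also have "\<dots> = ?F + (?F + ?F)"
    by (simp add: nn_integral_vshift[of "\<lambda>z. ennreal (f z ^ 3)"])
  also have "\<dots> = 3 * ?F"
  proof -
    have "(3::ennreal) = 1 + (1 + 1)" by simp
    then show ?thesis by (simp only: distrib_right mult_1)
  qed
  finally show ?thesis
    by (simp add: ennreal_mult_le_mult_iff)
qed

text \<open>The error is written on the right as a summand, which avoids subtraction in
  \<open>ennreal\<close>. Passing from \<open>g\<close> back to \<open>f\<close> in the product only
  increases it, as \<open>0 \<le> g \<le> f\<close>.\<close>

lemma shift3_truncated_lower:
  assumes f[measurable]: "f \<in> borel_measurable (lebd d)" and nn: "\<And>z. f z \<ge> 0" and B: "B \<ge> 0"
  defines "g \<equiv> \<lambda>z. min (f z) B"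
  shows "(\<integral>\<^sup>+ z. ennreal (g z ^ 3) \<partial>lebd d) \<le> shift3 d f h a b +
     ennreal (B\<^sup>2) * ((\<integral>\<^sup>+ z. ennreal \<bar>g (vshift d z h a) - g z\<bar> \<partial>lebd d) + (\<integral>\<^sup>+ z. ennreal \<bar>g (vshift d z h b) - g z\<bar> \<partial>lebd d))"
proof -
  have [measurable]: "g \<in> borel_measurable (lebd d)" unfolding g_def by measurable
  have g: "0 \<le> g z" "g z \<le> B" "g z \<le> f z" for z using nn B by (auto simp: g_def)
  have pt: "g z ^ 3 \<le> f z * f u * f v + B\<^sup>2 * (\<bar>g u - g z\<bar> + \<bar>g v - g z\<bar>)" for z u v
  proof -
    \<comment> \<open>Telescoping: the arguments \<open>u\<close> and \<open>v\<close> are exchanged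
      for \<open>z\<close> one at a time, and the untouched factors are at most
      \<open>B\<close>.\<close>
    have "g z ^ 3 - g z * g u * g v = g z * (g z * (g z - g u) + g u * (g z - g v))"
      by (simp add: power3_eq_cube algebra_simps)
    also have "\<dots> \<le> B * (B * \<bar>g u - g z\<bar> + B * \<bar>g v - g z\<bar>)"
    proof (rule order_trans[OF mult_left_mono mult_right_mono])
      show "g z * (g z - g u) + g u * (g z - g v) \<le> B * \<bar>g u - g z\<bar> + B * \<bar>g v - g z\<bar>"
        using g[of z] g[of u] by (intro add_mono order_trans[OF mult_left_mono mult_right_mono]) auto
    qed (use g[of z] B in auto)
    also have "\<dots> = B\<^sup>2 * (\<bar>g u - g z\<bar> + \<bar>g v - g z\<bar>)" by (simp add: power2_eq_square algebra_simps)
    finally have "g z ^ 3 \<le> g z * g u * g v + B\<^sup>2 * (\<bar>g u - g z\<bar> + \<bar>g v - g z\<bar>)" by simp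
    moreover have "g z * g u * g v \<le> f z * f u * f v"
      using g nn by (intro mult_mono) auto
    ultimately show ?thesis by simp
  qed
  have "(\<integral>\<^sup>+ z. ennreal (g z ^ 3) \<partial>lebd d) \<le> (\<integral>\<^sup>+ z. ennreal (f z * f (vshift d z h a) * f (vshift d z h b)) +
      ennreal (B\<^sup>2) * (ennreal \<bar>g (vshift d z h a) - g z\<bar> + ennreal \<bar>g (vshift d z h b) - g z\<bar>) \<partial>lebd d)"
    using pt nn by (intro nn_integral_mono) (simp flip: ennreal_plus ennreal_mult)
  also have "\<dots> = shift3 d f h a b + (\<integral>\<^sup>+ z. ennreal (B\<^sup>2) * (ennreal \<bar>g (vshift d z h a) - g z\<bar> + ennreal \<bar>g (vshift d z h b) - g z\<bar>) \<partial>lebd d)"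
    unfolding shift3_def by (subst nn_integral_add) auto
  also have "(\<integral>\<^sup>+ z. ennreal (B\<^sup>2) * (ennreal \<bar>g (vshift d z h a) - g z\<bar> + ennreal \<bar>g (vshift d z h b) - g z\<bar>) \<partial>lebd d) =
     ennreal (B\<^sup>2) * ((\<integral>\<^sup>+ z. ennreal \<bar>g (vshift d z h a) - g z\<bar> \<partial>lebd d) + (\<integral>\<^sup>+ z. ennreal \<bar>g (vshift d z h b) - g z\<bar> \<partial>lebd d))"
    by (subst nn_integral_cmult, measurable, subst nn_integral_add, measurable)
  finally show ?thesis .
qed

lemma shift3_tendsto:
  assumes f[measurable]: "f \<in> borel_measurable (lebd d)" and nn: "\<And>z. f z \<ge> 0"
    and int: "(\<integral>\<^sup>+ z. ennreal (f z) \<partial>lebd d) < \<infinity>" and h: "h \<longlonglongrightarrow> 0"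
  shows "(\<lambda>n. shift3 d f (h n) a b) \<longlonglongrightarrow> (\<integral>\<^sup>+ z. ennreal (f z ^ 3) \<partial>lebd d)"
proof (rule order_tendstoI)
  let ?F = "\<integral>\<^sup>+ z. ennreal (f z ^ 3) \<partial>lebd d"
  fix y assume y: "y < ?F"
  let ?g = "\<lambda>B z. min (f z) B"
  let ?S = "\<lambda>B. \<integral>\<^sup>+ z. ennreal (?g B z ^ 3) \<partial>lebd d"
  have "(\<lambda>k. ?S (real k)) \<longlonglongrightarrow> ?F"
  proof (rule nn_integral_LIMSEQ)
    show "incseq (\<lambda>k z. ennreal (?g (real k) z ^ 3))"
      using nn by (auto simp: incseq_def le_fun_def intro!: ennreal_leI power_mono)
    fix z
    have "eventually (\<lambda>k. f z \<le> real k) sequentially" by (rule eventually_nat_real) auto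
    then have "eventually (\<lambda>k. ennreal (?g (real k) z ^ 3) = ennreal (f z ^ 3)) sequentially"
      by eventually_elim (simp add: min_def)
    then show "(\<lambda>k. ennreal (?g (real k) z ^ 3)) \<longlonglongrightarrow> ennreal (f z ^ 3)" by (rule tendsto_eventually)
  qed measurable
  from order_tendstoD(1)[OF this y] obtain k where k: "y < ?S (real k)" by (auto simp: eventually_sequentially)
  let ?k = "?g (real k)"
  let ?E = "\<lambda>a n. \<integral>\<^sup>+ z. ennreal \<bar>?k (vshift d z (h n) a) - ?k z\<bar> \<partial>lebd d"
  have "integrable (lebd d) f" using int nn by (intro integrableI_nonneg) auto
  then have "integrable (lebd d) ?k"
    by (rule Bochner_Integration.integrable_bound) (use nn in auto)
  then have "l1_continuous d ?k" by (rule l1_continuous_integrable)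
  then have lim: "?E a \<longlonglongrightarrow> 0" for a using h by (simp add: l1_continuous_def)
  \<comment> \<open>The truncated integral exceeds \<open>y\<close> by a fixed margin. Once the
    translation error is below that margin, a correlation of at most \<open>y\<close> would
    contradict the lower bound.\<close>
  have "(\<lambda>n. y + ennreal ((real k)\<^sup>2) * (?E a n + ?E b n)) \<longlonglongrightarrow> y + ennreal ((real k)\<^sup>2) * (0 + 0)"
    by (intro tendsto_add tendsto_mult_ennreal tendsto_const lim) auto
  then have "(\<lambda>n. y + ennreal ((real k)\<^sup>2) * (?E a n + ?E b n)) \<longlonglongrightarrow> y" by simp
  from order_tendstoD(2)[OF this k]
  show "eventually (\<lambda>n. y < shift3 d f (h n) a b) sequentially"
  proof eventually_elim
    case (elim n)
    show ?case
    proof (rule ccontr)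
      assume "\<not> ?case"
      have "?S (real k) \<le> shift3 d f (h n) a b + ennreal ((real k)\<^sup>2) * (?E a n + ?E b n)"
        by (rule shift3_truncated_lower[OF f nn]) simp
      also have "shift3 d f (h n) a b + ennreal ((real k)\<^sup>2) * (?E a n + ?E b n) \<le> y + ennreal ((real k)\<^sup>2) * (?E a n + ?E b n)"
        using \<open>\<not> ?case\<close> by (intro add_right_mono) simp
      also note elim
      finally show False by simp
    qed
  qed
next
  fix y assume "(\<integral>\<^sup>+ z. ennreal (f z ^ 3) \<partial>lebd d) < y"
  then show "eventually (\<lambda>n. shift3 d f (h n) a b < y) sequentially"
    by (intro always_eventually allI le_less_trans[OF shift3_le[OF f nn]])
qed

lemma measurable_shift3 [measurable]:
  assumes [measurable]: "f \<in> borel_measurable (lebd d)"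
  shows "(\<lambda>p. shift3 d f h (fst p) (snd p)) \<in> borel_measurable (lebd d \<Otimes>\<^sub>M lebd d)"
  unfolding shift3_def by measurable

lemma kernel_shift3_tendsto:
  assumes f[measurable]: "f \<in> borel_measurable (lebd d)" and nn: "\<And>z. f z \<ge> 0"
    and int: "(\<integral>\<^sup>+ z. ennreal (f z) \<partial>lebd d) < \<infinity>" "(\<integral>\<^sup>+ z. ennreal (f z ^ 3) \<partial>lebd d) < \<infinity>" and h: "h \<longlonglongrightarrow> 0"
    and K[measurable]: "K \<in> sets (lebd d \<Otimes>\<^sub>M lebd d)" and fin: "emeasure (lebd d \<Otimes>\<^sub>M lebd d) K < \<infinity>"
  shows "(\<lambda>n. \<integral>\<^sup>+ p. indicator K p * shift3 d f (h n) (fst p) (snd p) \<partial>(lebd d \<Otimes>\<^sub>M lebd d))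
    \<longlonglongrightarrow> emeasure (lebd d \<Otimes>\<^sub>M lebd d) K * (\<integral>\<^sup>+ z. ennreal (f z ^ 3) \<partial>lebd d)"
proof -
  let ?F = "\<integral>\<^sup>+ z. ennreal (f z ^ 3) \<partial>lebd d"
  have F: "(\<integral>\<^sup>+ p. indicator K p * ?F \<partial>(lebd d \<Otimes>\<^sub>M lebd d)) = emeasure (lebd d \<Otimes>\<^sub>M lebd d) K * ?F"
    by (subst nn_integral_multc) auto
  have "(\<lambda>n. \<integral>\<^sup>+ p. indicator K p * shift3 d f (h n) (fst p) (snd p) \<partial>(lebd d \<Otimes>\<^sub>M lebd d))
    \<longlonglongrightarrow> (\<integral>\<^sup>+ p. indicator K p * ?F \<partial>(lebd d \<Otimes>\<^sub>M lebd d))"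
  proof (rule nn_integral_dominated_convergence)
    show "AE p in lebd d \<Otimes>\<^sub>M lebd d. indicator K p * shift3 d f (h n) (fst p) (snd p) \<le> indicator K p * ?F" for n
      by (intro AE_I2 mult_left_mono shift3_le f nn) simp
    show "(\<integral>\<^sup>+ p. indicator K p * ?F \<partial>(lebd d \<Otimes>\<^sub>M lebd d)) < \<infinity>"
      unfolding F using fin int(2) by (simp add: ennreal_mult_less_top)
    show "AE p in lebd d \<Otimes>\<^sub>M lebd d. (\<lambda>n. indicator K p * shift3 d f (h n) (fst p) (snd p)) \<longlonglongrightarrow> indicator K p * ?F"
      by (intro AE_I2 tendsto_mult_ennreal tendsto_const shift3_tendsto f nn int h) (use int(2) in \<open>auto simp: indicator_def\<close>)
  qed measurable
  then show ?thesis unfolding F .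
qed

section \<open>Independent samples from a density\<close>

locale density_sample = prob_space M
  for M :: "'a measure" +
  fixes X :: "nat \<Rightarrow> 'a \<Rightarrow> (nat \<Rightarrow> real)" and f :: "(nat \<Rightarrow> real) \<Rightarrow> real" and d :: nat
  assumes f_nonneg: "f x \<ge> 0"
    and X_distributed: "distributed M (lebd d) (X i) (\<lambda>x. ennreal (f x))"
    and X_indep: "indep_vars (\<lambda>_. lebd d) X UNIV"
begin

definition law :: "(nat \<Rightarrow> real) measure" where
  "law = density (lebd d) (\<lambda>x. ennreal (f x))"

text \<open>The hypotheses speak of \<open>ennreal (f x)\<close>; by nonnegativity
  \<open>enn2real\<close> recovers \<open>f\<close> from it.\<close>

lemma measurable_f [measurable]: "f \<in> borel_measurable (lebd d)"
proof -
  have "(\<lambda>x. ennreal (f x)) \<in> borel_measurable (lebd d)"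
    by (rule distributed_borel_measurable[OF X_distributed])
  then have "(\<lambda>x. enn2real (ennreal (f x))) \<in> borel_measurable (lebd d)" by measurable
  then show ?thesis by (simp add: f_nonneg)
qed

lemma measurable_X [measurable]: "X i \<in> measurable M (lebd d)"
  by (rule distributed_measurable[OF X_distributed])

lemma distr_X: "distr M (lebd d) (X i) = law"
  unfolding law_def by (rule distributed_distr_eq_density[OF X_distributed])

lemma sets_law [measurable_cong]: "sets law = sets (lebd d)"
  by (simp add: law_def)

lemma space_law: "space law = space (lebd d)"
  by (simp add: law_def)

lemma prob_space_law: "prob_space law"
  using prob_space_distr[OF measurable_X] by (simp add: distr_X)

sublocale law: prob_space law by (rule prob_space_law)

sublocale laws: product_sigma_finite "\<lambda>_::nat. law" by standard

lemma nn_integral_law: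
  assumes "g \<in> borel_measurable (lebd d)"
  shows "(\<integral>\<^sup>+ x. g x \<partial>law) = (\<integral>\<^sup>+ x. ennreal (f x) * g x \<partial>lebd d)"
  unfolding law_def by (rule nn_integral_density) (use assms in auto)

lemma nn_integral_f: "(\<integral>\<^sup>+ x. ennreal (f x) \<partial>lebd d) = 1"
  using nn_integral_law[of "\<lambda>_. 1"] law.emeasure_space_1 by (simp add: space_law)

lemma sets_PiM_law [measurable_cong]: "sets (PiM I (\<lambda>_. law)) = sets (PiM I (\<lambda>_. lebd d))"
  by (rule sets_PiM_cong) (simp_all add: sets_law)

lemma measurable_PiM_law: "measurable (PiM I (\<lambda>_. law)) N = measurable (PiM I (\<lambda>_. lebd d)) N"
  by (rule measurable_cong_sets[OF sets_PiM_law refl])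

lemma measurable_law: "measurable law N = measurable (lebd d) N"
  by (rule measurable_cong_sets[OF sets_law refl])

lemma measurable_law': "measurable N law = measurable N (lebd d)"
  by (rule measurable_cong_sets[OF refl sets_law])

lemma nn_integral_joint:
  assumes "I \<noteq> {}" and g: "g \<in> borel_measurable (PiM I (\<lambda>_. lebd d))"
  shows "(\<integral>\<^sup>+ \<omega>. g (\<lambda>i\<in>I. X i \<omega>) \<partial>M) = (\<integral>\<^sup>+ x. g x \<partial>PiM I (\<lambda>_. law))"
proof -
  have "indep_vars (\<lambda>_. lebd d) X I" by (rule indep_vars_subset[OF X_indep]) simp
  then have "distr M (PiM I (\<lambda>_. lebd d)) (\<lambda>\<omega>. \<lambda>i\<in>I. X i \<omega>) = PiM I (\<lambda>i. distr M (lebd d) (X i))"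
    using assms(1) by (subst (asm) indep_vars_iff_distr_eq_PiM') auto
  then have "PiM I (\<lambda>_. law) = distr M (PiM I (\<lambda>_. lebd d)) (\<lambda>\<omega>. \<lambda>i\<in>I. X i \<omega>)"
    by (simp add: distr_X)
  then show ?thesis
    using g by (simp add: nn_integral_distr)
qed

text \<open>Given the centre \<open>X i\<close>, the other points are independent with a common law,
  so the integral of the product is a power.\<close>

lemma nn_integral_star:
  assumes I: "finite I" "i \<in> I"
    and H: "(\<lambda>p. H (fst p) (snd p)) \<in> borel_measurable (lebd d \<Otimes>\<^sub>M lebd d)"
  shows "(\<integral>\<^sup>+ \<omega>. (\<Prod>j\<in>I-{i}. H (X i \<omega>) (X j \<omega>)) \<partial>M) =
    (\<integral>\<^sup>+ x. (\<integral>\<^sup>+ y. H x y \<partial>law) ^ (card I - 1) \<partial>law)" (is "?L = ?R")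
proof -
  define J where "J = I - {i}"
  have J: "I = insert i J" "finite J" "i \<notin> J" using I by (auto simp: J_def)
  have H2: "(\<lambda>p. H (u p) (v p)) \<in> borel_measurable N"
    if "u \<in> measurable N (lebd d)" "v \<in> measurable N (lebd d)" for u v and N :: "'z measure"
    using measurable_compose[OF measurable_Pair[OF that] H] by simp
  have c: "(\<lambda>x. x k) \<in> measurable (PiM I (\<lambda>_. lebd d)) (lebd d)" if "k \<in> I" for k
    using that by (rule measurable_component_singleton)
  have gm: "(\<lambda>x. \<Prod>j\<in>J. H (x i) (x j)) \<in> borel_measurable (PiM I (\<lambda>_. lebd d))"
    by (rule borel_measurable_prod_ennreal, rule H2; rule c) (use J in auto)
  then have gm': "(\<lambda>x. \<Prod>j\<in>J. H (x i) (x j)) \<in> borel_measurable (PiM (insert i J) (\<lambda>_. law))"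
    unfolding J(1)[symmetric] by (simp only: measurable_PiM_law)
  have "?L = (\<integral>\<^sup>+ \<omega>. (\<lambda>x. \<Prod>j\<in>J. H (x i) (x j)) (\<lambda>i\<in>I. X i \<omega>) \<partial>M)"
    unfolding J_def[symmetric] using J by (intro nn_integral_cong) (auto intro!: prod.cong)
  also have "\<dots> = (\<integral>\<^sup>+ x. (\<Prod>j\<in>J. H (x i) (x j)) \<partial>PiM (insert i J) (\<lambda>_. law))"
    unfolding J(1)[symmetric] by (rule nn_integral_joint[OF _ gm]) (use I in auto)
  also have "\<dots> = (\<integral>\<^sup>+ x. \<integral>\<^sup>+ y. (\<Prod>j\<in>J. H ((y(i := x)) i) ((y(i := x)) j)) \<partial>PiM J (\<lambda>_. law) \<partial>law)"
    by (rule laws.product_nn_integral_insert_rev[OF J(2,3) gm'])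
  also have "\<dots> = (\<integral>\<^sup>+ x. \<integral>\<^sup>+ y. (\<Prod>j\<in>J. H x (y j)) \<partial>PiM J (\<lambda>_. law) \<partial>law)"
    using J(3) by (intro nn_integral_cong prod.cong) auto
  also have "\<dots> = (\<integral>\<^sup>+ x. (\<Prod>j\<in>J. \<integral>\<^sup>+ y. H x y \<partial>law) \<partial>law)"
  proof (rule nn_integral_cong)
    fix x assume x: "x \<in> space law"
    have "H x \<in> borel_measurable law"
      using measurable_compose[OF measurable_Pair1' H, of x] x
      by (simp only: space_law measurable_law fst_conv snd_conv)
    then show "(\<integral>\<^sup>+ y. (\<Prod>j\<in>J. H x (y j)) \<partial>PiM J (\<lambda>_. law)) = (\<Prod>j\<in>J. \<integral>\<^sup>+ y. H x y \<partial>law)"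
      by (intro laws.product_nn_integral_prod[OF J(2)])
  qed
  also have "\<dots> = ?R" using J by simp
  finally show ?thesis .
qed

text \<open>The third point is integrated last because it is the centre around which the other two
  will be rescaled.\<close>

lemma nn_integral_triple:
  assumes ijk: "i \<noteq> j" "j \<noteq> k" "i \<noteq> k"
    and g: "(\<lambda>(x, y, z). g x y z) \<in> borel_measurable (lebd d \<Otimes>\<^sub>M lebd d \<Otimes>\<^sub>M lebd d)"
  shows "(\<integral>\<^sup>+ \<omega>. g (X i \<omega>) (X j \<omega>) (X k \<omega>) \<partial>M) = (\<integral>\<^sup>+ z. \<integral>\<^sup>+ x. \<integral>\<^sup>+ y. g x y z \<partial>law \<partial>law \<partial>law)"
proof -
  have g2: "(\<lambda>p. g (u p) (v p) (t p)) \<in> borel_measurable N"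
    if "u \<in> measurable N (lebd d)" "v \<in> measurable N (lebd d)" "t \<in> measurable N (lebd d)" for u v t and N :: "'z measure"
    using measurable_compose[OF measurable_Pair[OF that(1) measurable_Pair[OF that(2,3)]] g] by simp
  have g3: "(\<lambda>p. g (u p) (v p) (t p)) \<in> borel_measurable N"
    if "u \<in> measurable N law" "v \<in> measurable N law" "t \<in> measurable N law" for u v t and N :: "'z measure"
    by (rule g2) (use that in \<open>simp_all only: measurable_law'\<close>)
  have c: "(\<lambda>x. x l) \<in> measurable (PiM I (\<lambda>_. law)) law" if "l \<in> I" for l I
    using that by (rule measurable_component_singleton)
  have cl: "(\<lambda>x. x l) \<in> measurable (PiM I (\<lambda>_. lebd d)) (lebd d)" if "l \<in> I" for l I
    using that by (rule measurable_component_singleton)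
  have "(\<integral>\<^sup>+ \<omega>. g (X i \<omega>) (X j \<omega>) (X k \<omega>) \<partial>M) =
      (\<integral>\<^sup>+ \<omega>. (\<lambda>x. g (x i) (x j) (x k)) (\<lambda>i\<in>{k,i,j}. X i \<omega>) \<partial>M)" by simp
  also have "\<dots> = (\<integral>\<^sup>+ x. g (x i) (x j) (x k) \<partial>PiM {k,i,j} (\<lambda>_. law))"
    by (rule nn_integral_joint, simp, rule g2; rule cl) auto
  also have "\<dots> = (\<integral>\<^sup>+ z. \<integral>\<^sup>+ w. g ((w(k := z)) i) ((w(k := z)) j) ((w(k := z)) k) \<partial>PiM {i,j} (\<lambda>_. law) \<partial>law)"
    by (rule laws.product_nn_integral_insert_rev, simp, use ijk in simp, rule g3; rule c; simp)
  also have "\<dots> = (\<integral>\<^sup>+ z. \<integral>\<^sup>+ w. g (w i) (w j) z \<partial>PiM {i,j} (\<lambda>_. law) \<partial>law)"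
    using ijk by simp
  also have "\<dots> = (\<integral>\<^sup>+ z. \<integral>\<^sup>+ x. \<integral>\<^sup>+ y. g x y z \<partial>law \<partial>law \<partial>law)"
  proof (rule nn_integral_cong)
    fix z assume z: "z \<in> space law"
    have "(\<integral>\<^sup>+ w. g (w i) (w j) z \<partial>PiM {i,j} (\<lambda>_. law)) =
       (\<integral>\<^sup>+ x. \<integral>\<^sup>+ w. g ((w(i := x)) i) ((w(i := x)) j) z \<partial>PiM {j} (\<lambda>_. law) \<partial>law)"
      by (rule laws.product_nn_integral_insert_rev, simp, use ijk in simp, rule g3[OF c c measurable_const[OF z]]; simp)
    also have "\<dots> = (\<integral>\<^sup>+ x. \<integral>\<^sup>+ w. g x (w j) z \<partial>PiM {j} (\<lambda>_. law) \<partial>law)"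
      using ijk by simp
    also have "\<dots> = (\<integral>\<^sup>+ x. \<integral>\<^sup>+ y. g x y z \<partial>law \<partial>law)"
    proof (rule nn_integral_cong)
      fix x assume x: "x \<in> space law"
      show "(\<integral>\<^sup>+ w. g x (w j) z \<partial>PiM {j} (\<lambda>_. law)) = (\<integral>\<^sup>+ y. g x y z \<partial>law)"
        by (rule laws.product_nn_integral_singleton)
          (rule g3[OF measurable_const[OF x] measurable_ident measurable_const[OF z], unfolded id_def])
    qed
    finally show "(\<integral>\<^sup>+ w. g (w i) (w j) z \<partial>PiM {i,j} (\<lambda>_. law)) = (\<integral>\<^sup>+ x. \<integral>\<^sup>+ y. g x y z \<partial>law \<partial>law)" .
  qed
  finally show ?thesis .
qed

text \<open>If finitely many sample points are pairwise close, then all of them lie near the one at which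
  \<open>f\<close> is largest. Given that point, each of the others does so with probability at most its density
  times the volume of a ball, which brings in the moments of \<open>f\<close>.\<close>

lemma emeasure_clique_le:
  assumes I: "finite I" "I \<noteq> {}" and \<rho>: "\<rho> \<ge> 0"
  shows "emeasure M {\<omega> \<in> space M. \<forall>i\<in>I. \<forall>j\<in>I. enorm d (\<lambda>l. X i \<omega> l - X j \<omega> l) \<le> \<rho>} \<le>
    of_nat (card I) * (ennreal (unit_ball_vol (real d) * \<rho> ^ d) ^ (card I - 1) * (\<integral>\<^sup>+ x. ennreal (f x ^ card I) \<partial>lebd d))"
proof -
  let ?V = "ennreal (unit_ball_vol (real d) * \<rho> ^ d)"
  define H :: "(nat \<Rightarrow> real) \<Rightarrow> (nat \<Rightarrow> real) \<Rightarrow> ennreal"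
    where "H x y = indicator {p. enorm d (\<lambda>l. fst p l - snd p l) \<le> \<rho> \<and> f (snd p) \<le> f (fst p)} (x, y)" for x y
  define E where "E i = {\<omega> \<in> space M. \<forall>j\<in>I-{i}. enorm d (\<lambda>l. X i \<omega> l - X j \<omega> l) \<le> \<rho> \<and> f (X j \<omega>) \<le> f (X i \<omega>)}" for i
  have Hm: "(\<lambda>p. H (fst p) (snd p)) \<in> borel_measurable (lebd d \<Otimes>\<^sub>M lebd d)"
    unfolding H_def by simp
  have E[measurable]: "E i \<in> sets M" for i
    unfolding E_def using I(1) by measurable
  have HX: "(\<integral>\<^sup>+ y. H x y \<partial>law) \<le> ennreal (f x) * ?V" if x: "x \<in> space (lebd d)" for x
  proof -
    let ?B = "{y \<in> space (lebd d). enorm d (\<lambda>l. x l - y l) \<le> \<rho>}"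
    have [measurable]: "?B \<in> sets (lebd d)" using x by measurable
    have "H x \<in> borel_measurable (lebd d)"
      using measurable_compose[OF measurable_Pair1'[OF x] Hm] by simp
    then have "(\<integral>\<^sup>+ y. H x y \<partial>law) = (\<integral>\<^sup>+ y. ennreal (f y) * H x y \<partial>lebd d)"
      by (rule nn_integral_law)
    \<comment> \<open>Where \<open>H x y\<close> is nonzero, \<open>f y\<close> is at most
      \<open>f x\<close>, a constant for this integral.\<close>
    also have "\<dots> \<le> (\<integral>\<^sup>+ y. ennreal (f x) * indicator ?B y \<partial>lebd d)"
      by (intro nn_integral_mono) (auto simp: H_def split: split_indicator intro!: ennreal_leI)
    also have "\<dots> = ennreal (f x) * emeasure (lebd d) ?B"
      by (rule nn_integral_cmult_indicator) measurable
    also have "emeasure (lebd d) ?B = (\<integral>\<^sup>+ y. indicator ?B y \<partial>lebd d)"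
      by (rule nn_integral_indicator[symmetric]) measurable
    also have "\<dots> = (\<integral>\<^sup>+ y. indicator ?B (vshift d y 1 x) \<partial>lebd d)"
      by (rule nn_integral_vshift[symmetric]) measurable
    also have "\<dots> = (\<integral>\<^sup>+ y. indicator {y \<in> space (lebd d). enorm d y \<le> \<rho>} y \<partial>lebd d)"
    proof (rule nn_integral_cong)
      fix y assume y: "y \<in> space (lebd d)"
      have "enorm d (\<lambda>l. x l - vshift d y 1 x l) = enorm d (\<lambda>l. 0 - y l)"
        by (rule enorm_cong) (simp add: vshift_def)
      also have "\<dots> = enorm d y" by (simp add: enorm_def)
      finally show "indicator ?B (vshift d y 1 x) = (indicator {y \<in> space (lebd d). enorm d y \<le> \<rho>} y :: ennreal)"
        using y by (simp add: indicator_def vshift_space)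
    qed
    also have "\<dots> = emeasure (lebd d) {y \<in> space (lebd d). enorm d y \<le> \<rho>}"
      by (rule nn_integral_indicator) measurable
    also have "\<dots> = ?V" by (rule emeasure_lebd_ball[OF \<rho>])
    finally show ?thesis .
  qed
  have E_le: "emeasure M (E i) \<le> ?V ^ (card I - 1) * (\<integral>\<^sup>+ x. ennreal (f x ^ card I) \<partial>lebd d)" if i: "i \<in> I" for i
  proof -
    have "emeasure M (E i) = (\<integral>\<^sup>+ \<omega>. indicator (E i) \<omega> \<partial>M)" by (rule nn_integral_indicator[symmetric]) measurable
    also have "\<dots> = (\<integral>\<^sup>+ \<omega>. (\<Prod>j\<in>I-{i}. H (X i \<omega>) (X j \<omega>)) \<partial>M)"
    proof (rule nn_integral_cong)
      fix \<omega> assume "\<omega> \<in> space M"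
      then show "indicator (E i) \<omega> = (\<Prod>j\<in>I-{i}. H (X i \<omega>) (X j \<omega>))"
        using I(1) by (auto simp: E_def H_def indicator_def prod_eq_1_iff intro!: prod.neutral[symmetric] prod_zero[symmetric])
    qed
    also have "\<dots> = (\<integral>\<^sup>+ x. (\<integral>\<^sup>+ y. H x y \<partial>law) ^ (card I - 1) \<partial>law)"
      by (rule nn_integral_star[OF I(1) i Hm])
    also have "\<dots> \<le> (\<integral>\<^sup>+ x. (ennreal (f x) * ?V) ^ (card I - 1) \<partial>law)"
      by (intro nn_integral_mono power_mono HX) (auto simp: space_law)
    also have "\<dots> = (\<integral>\<^sup>+ x. ennreal (f x) * (ennreal (f x) * ?V) ^ (card I - 1) \<partial>lebd d)"
      by (rule nn_integral_law) measurable
    \<comment> \<open>One factor \<open>f x\<close> is the density of the centre, the remaining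
      \<open>card I - 1\<close> come from its neighbours.\<close>
    also have "\<dots> = (\<integral>\<^sup>+ x. ?V ^ (card I - 1) * ennreal (f x ^ card I) \<partial>lebd d)"
    proof (rule nn_integral_cong)
      fix x
      obtain m where m: "card I = Suc m" using I by (cases "card I") auto
      show "ennreal (f x) * (ennreal (f x) * ?V) ^ (card I - 1) = ?V ^ (card I - 1) * ennreal (f x ^ card I)"
        by (simp add: m power_mult_distrib ennreal_mult f_nonneg ennreal_power[symmetric] mult_ac)
    qed
    also have "\<dots> = ?V ^ (card I - 1) * (\<integral>\<^sup>+ x. ennreal (f x ^ card I) \<partial>lebd d)"
      by (rule nn_integral_cmult) measurable
    finally show ?thesis .
  qed
  have "{\<omega> \<in> space M. \<forall>i\<in>I. \<forall>j\<in>I. enorm d (\<lambda>l. X i \<omega> l - X j \<omega> l) \<le> \<rho>} \<subseteq> (\<Union>i\<in>I. E i)"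
  proof
    fix \<omega> assume \<omega>: "\<omega> \<in> {\<omega> \<in> space M. \<forall>i\<in>I. \<forall>j\<in>I. enorm d (\<lambda>l. X i \<omega> l - X j \<omega> l) \<le> \<rho>}"
    \<comment> \<open>A union bound over the possible maximisers tolerates ties and accounts for the
      factor \<open>card I\<close>.\<close>
    have "Max ((\<lambda>i. f (X i \<omega>)) ` I) \<in> (\<lambda>i. f (X i \<omega>)) ` I" using I by (intro Max_in) auto
    then obtain i where i: "i \<in> I" "f (X i \<omega>) = Max ((\<lambda>i. f (X i \<omega>)) ` I)" by auto
    then have "f (X j \<omega>) \<le> f (X i \<omega>)" if "j \<in> I" for j using I that by simp
    then have "\<omega> \<in> E i" using \<omega> i(1) by (auto simp: E_def)
    then show "\<omega> \<in> (\<Union>i\<in>I. E i)" using i(1) by blast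
  qed
  then have "emeasure M {\<omega> \<in> space M. \<forall>i\<in>I. \<forall>j\<in>I. enorm d (\<lambda>l. X i \<omega> l - X j \<omega> l) \<le> \<rho>} \<le> emeasure M (\<Union>i\<in>I. E i)"
    by (rule emeasure_mono) (use I in measurable)
  also have "\<dots> \<le> (\<Sum>i\<in>I. emeasure M (E i))"
    by (rule emeasure_subadditive_finite) (use I in auto)
  also have "\<dots> \<le> (\<Sum>i\<in>I. ?V ^ (card I - 1) * (\<integral>\<^sup>+ x. ennreal (f x ^ card I) \<partial>lebd d))"
    by (intro sum_mono E_le)
  finally show ?thesis by simp
qed

lemma nn_integral_lebd_rescale:
  assumes "r > 0" "g \<in> borel_measurable (lebd d)"
  shows "(\<integral>\<^sup>+ x. g x \<partial>lebd d) = ennreal (r ^ d) * (\<integral>\<^sup>+ a. g (vshift d z r a) \<partial>lebd d)"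
  using nn_integral_lebd_affine[of r g d z] assms by (simp add: vshift_def)

text \<open>Substituting \<open>z + r a\<close> and \<open>z + r b\<close> for the two outer points
  extracts \<open>r^(2 d)\<close>. By \<open>PK\<close> the event then depends on the offsets alone,
  so the integral over \<open>z\<close> can be taken first and is \<open>shift3\<close>.\<close>

lemma emeasure_triple:
  assumes ijk: "i \<noteq> j" "j \<noteq> k" "i \<noteq> k" and r: "r > 0"
    and P[measurable]: "Measurable.pred (lebd d \<Otimes>\<^sub>M lebd d \<Otimes>\<^sub>M lebd d) (\<lambda>(x, y, z). P x y z)"
    and K[measurable]: "K \<in> sets (lebd d \<Otimes>\<^sub>M lebd d)"
    and PK: "\<And>z a b. z \<in> space (lebd d) \<Longrightarrow> a \<in> space (lebd d) \<Longrightarrow> b \<in> space (lebd d) \<Longrightarrow>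
       P (vshift d z r a) (vshift d z r b) z \<longleftrightarrow> (a, b) \<in> K"
  shows "emeasure M {\<omega> \<in> space M. P (X i \<omega>) (X j \<omega>) (X k \<omega>)} =
    ennreal (r ^ d) ^ 2 * (\<integral>\<^sup>+ p. indicator K p * shift3 d f r (fst p) (snd p) \<partial>(lebd d \<Otimes>\<^sub>M lebd d))"
proof -
  define g :: "(nat \<Rightarrow> real) \<Rightarrow> (nat \<Rightarrow> real) \<Rightarrow> (nat \<Rightarrow> real) \<Rightarrow> ennreal"
    where "g x y z = (if P x y z then 1 else 0)" for x y z
  have gm: "(\<lambda>(x, y, z). g x y z) \<in> borel_measurable (lebd d \<Otimes>\<^sub>M lebd d \<Otimes>\<^sub>M lebd d)"
  proof -
    have "(\<lambda>p. if (case p of (x, y, z) \<Rightarrow> P x y z) then 1 else 0 :: ennreal) \<in> borel_measurable (lebd d \<Otimes>\<^sub>M lebd d \<Otimes>\<^sub>M lebd d)"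
      by (rule measurable_If[OF measurable_const measurable_const predE[OF P]]) auto
    then show ?thesis by (simp add: g_def split_beta')
  qed
  have g2[measurable]: "(\<lambda>p. g (u p) (v p) (t p)) \<in> borel_measurable N"
    if "u \<in> measurable N (lebd d)" "v \<in> measurable N (lebd d)" "t \<in> measurable N (lebd d)" for u v t and N :: "'z measure"
    using measurable_compose[OF measurable_Pair[OF that(1) measurable_Pair[OF that(2,3)]] gm] by simp
  let ?K = "\<lambda>a b. indicator K (a, b) :: ennreal"
  let ?L = "lebd d"
  have "{\<omega> \<in> space M. P (X i \<omega>) (X j \<omega>) (X k \<omega>)} \<in> sets M"
    using measurable_compose[OF measurable_Pair[OF measurable_X measurable_Pair[OF measurable_X measurable_X]] P, of i j k]
    by (simp add: pred_def)
  then have "emeasure M {\<omega> \<in> space M. P (X i \<omega>) (X j \<omega>) (X k \<omega>)} =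
      (\<integral>\<^sup>+ \<omega>. indicator {\<omega> \<in> space M. P (X i \<omega>) (X j \<omega>) (X k \<omega>)} \<omega> \<partial>M)"
    by (rule nn_integral_indicator[symmetric])
  also have "\<dots> = (\<integral>\<^sup>+ \<omega>. g (X i \<omega>) (X j \<omega>) (X k \<omega>) \<partial>M)"
    by (intro nn_integral_cong) (simp add: g_def indicator_def)
  also have "\<dots> = (\<integral>\<^sup>+ z. \<integral>\<^sup>+ x. \<integral>\<^sup>+ y. g x y z \<partial>law \<partial>law \<partial>law)"
    by (rule nn_integral_triple[OF ijk gm])
  also have "\<dots> = (\<integral>\<^sup>+ z. \<integral>\<^sup>+ x. \<integral>\<^sup>+ y. ennreal (f z) * (ennreal (f x) * (ennreal (f y) * g x y z)) \<partial>?L \<partial>?L \<partial>?L)"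
  proof -
    have "(\<integral>\<^sup>+ z. \<integral>\<^sup>+ x. \<integral>\<^sup>+ y. g x y z \<partial>law \<partial>law \<partial>law) =
      (\<integral>\<^sup>+ z. ennreal (f z) * (\<integral>\<^sup>+ x. \<integral>\<^sup>+ y. g x y z \<partial>law \<partial>law) \<partial>?L)"
      by (rule nn_integral_law) measurable
    also have "\<dots> = (\<integral>\<^sup>+ z. ennreal (f z) * (\<integral>\<^sup>+ x. ennreal (f x) * (\<integral>\<^sup>+ y. g x y z \<partial>law) \<partial>?L) \<partial>?L)"
      by (intro nn_integral_cong arg_cong2[where f="(*)"] nn_integral_law refl) measurable
    also have "\<dots> = (\<integral>\<^sup>+ z. ennreal (f z) * (\<integral>\<^sup>+ x. ennreal (f x) * (\<integral>\<^sup>+ y. ennreal (f y) * g x y z \<partial>?L) \<partial>?L) \<partial>?L)"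
      by (intro nn_integral_cong arg_cong2[where f="(*)"] nn_integral_law refl) measurable
    finally show ?thesis by (simp add: nn_integral_cmult cong: nn_integral_cong)
  qed
  also have "\<dots> = (\<integral>\<^sup>+ z. ennreal (r ^ d) * (ennreal (r ^ d) * (\<integral>\<^sup>+ a. \<integral>\<^sup>+ b.
       ennreal (f z) * (ennreal (f (vshift d z r a)) * (ennreal (f (vshift d z r b)) * g (vshift d z r a) (vshift d z r b) z)) \<partial>?L \<partial>?L)) \<partial>?L)"
  proof (rule nn_integral_cong)
    fix z assume [measurable]: "z \<in> space ?L"
    have "(\<integral>\<^sup>+ x. \<integral>\<^sup>+ y. ennreal (f z) * (ennreal (f x) * (ennreal (f y) * g x y z)) \<partial>?L \<partial>?L) =
      ennreal (r ^ d) * (\<integral>\<^sup>+ a. \<integral>\<^sup>+ y. ennreal (f z) * (ennreal (f (vshift d z r a)) * (ennreal (f y) * g (vshift d z r a) y z)) \<partial>?L \<partial>?L)"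
      by (rule nn_integral_lebd_rescale[OF r]) measurable
    also have "\<dots> = ennreal (r ^ d) * (\<integral>\<^sup>+ a. ennreal (r ^ d) * (\<integral>\<^sup>+ b. ennreal (f z) * (ennreal (f (vshift d z r a)) * (ennreal (f (vshift d z r b)) * g (vshift d z r a) (vshift d z r b) z)) \<partial>?L) \<partial>?L)"
    proof (rule arg_cong[where f="\<lambda>u. ennreal (r ^ d) * u"], rule nn_integral_cong)
      fix a
      have [measurable]: "vshift d z r a \<in> space ?L" by (rule vshift_space)
      show "(\<integral>\<^sup>+ y. ennreal (f z) * (ennreal (f (vshift d z r a)) * (ennreal (f y) * g (vshift d z r a) y z)) \<partial>?L) =
        ennreal (r ^ d) * (\<integral>\<^sup>+ b. ennreal (f z) * (ennreal (f (vshift d z r a)) * (ennreal (f (vshift d z r b)) * g (vshift d z r a) (vshift d z r b) z)) \<partial>?L)"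
        by (rule nn_integral_lebd_rescale[OF r]) measurable
    qed
    also have "\<dots> = ennreal (r ^ d) * (ennreal (r ^ d) * (\<integral>\<^sup>+ a. \<integral>\<^sup>+ b. ennreal (f z) * (ennreal (f (vshift d z r a)) * (ennreal (f (vshift d z r b)) * g (vshift d z r a) (vshift d z r b) z)) \<partial>?L \<partial>?L))"
      by (intro arg_cong2[where f="(*)"] refl nn_integral_cmult) measurable
    finally show "(\<integral>\<^sup>+ x. \<integral>\<^sup>+ y. ennreal (f z) * (ennreal (f x) * (ennreal (f y) * g x y z)) \<partial>?L \<partial>?L) = \<dots>" .
  qed
  also have "\<dots> = (\<integral>\<^sup>+ z. ennreal (r ^ d) ^ 2 * (\<integral>\<^sup>+ p. ennreal (f z * f (vshift d z r (fst p)) * f (vshift d z r (snd p))) * indicator K p \<partial>(?L \<Otimes>\<^sub>M ?L)) \<partial>?L)"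
  proof (rule nn_integral_cong)
    fix z assume z[measurable]: "z \<in> space ?L"
    have "(\<integral>\<^sup>+ a. \<integral>\<^sup>+ b. ennreal (f z) * (ennreal (f (vshift d z r a)) * (ennreal (f (vshift d z r b)) * g (vshift d z r a) (vshift d z r b) z)) \<partial>?L \<partial>?L) =
      (\<integral>\<^sup>+ a. \<integral>\<^sup>+ b. (\<lambda>p. ennreal (f z * f (vshift d z r (fst p)) * f (vshift d z r (snd p))) * indicator K p) (a, b) \<partial>?L \<partial>?L)"
      by (intro nn_integral_cong) (simp add: g_def indicator_def PK z f_nonneg ennreal_mult mult_ac)
    also have "\<dots> = (\<integral>\<^sup>+ p. ennreal (f z * f (vshift d z r (fst p)) * f (vshift d z r (snd p))) * indicator K p \<partial>(?L \<Otimes>\<^sub>M ?L))"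
      by (rule lebd.nn_integral_fst) measurable
    finally show "ennreal (r ^ d) * (ennreal (r ^ d) * (\<integral>\<^sup>+ a. \<integral>\<^sup>+ b. ennreal (f z) * (ennreal (f (vshift d z r a)) * (ennreal (f (vshift d z r b)) * g (vshift d z r a) (vshift d z r b) z)) \<partial>?L \<partial>?L)) =
      ennreal (r ^ d) ^ 2 * \<dots>" by (simp add: power2_eq_square mult.assoc)
  qed
  also have "\<dots> = ennreal (r ^ d) ^ 2 * (\<integral>\<^sup>+ z. \<integral>\<^sup>+ p. ennreal (f z * f (vshift d z r (fst p)) * f (vshift d z r (snd p))) * indicator K p \<partial>(?L \<Otimes>\<^sub>M ?L) \<partial>?L)"
    by (rule nn_integral_cmult) measurable
  also have "(\<integral>\<^sup>+ z. \<integral>\<^sup>+ p. ennreal (f z * f (vshift d z r (fst p)) * f (vshift d z r (snd p))) * indicator K p \<partial>(?L \<Otimes>\<^sub>M ?L) \<partial>?L) =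
    (\<integral>\<^sup>+ p. \<integral>\<^sup>+ z. ennreal (f z * f (vshift d z r (fst p)) * f (vshift d z r (snd p))) * indicator K p \<partial>?L \<partial>(?L \<Otimes>\<^sub>M ?L))"
  proof -
    interpret P: pair_sigma_finite ?L "?L \<Otimes>\<^sub>M ?L"
      by (intro pair_sigma_finite.intro sigma_finite_lebd lebd_pair.sigma_finite_measure_axioms)
    show ?thesis
      by (rule P.Fubini'[symmetric]) (simp add: split_beta', measurable)
  qed
  also have "\<dots> = (\<integral>\<^sup>+ p. indicator K p * shift3 d f r (fst p) (snd p) \<partial>(?L \<Otimes>\<^sub>M ?L))"
    unfolding shift3_def by (intro nn_integral_cong, subst nn_integral_multc) (measurable, auto simp: mult.commute)
  finally show ?thesis .
qed

end

section \<open>Variance of triple counts\<close>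

definition triples :: "nat \<Rightarrow> (nat \<times> nat \<times> nat) set" where
  "triples n = {(i, j, k). i < j \<and> j < k \<and> k < n}"

definition verts :: "nat \<times> nat \<times> nat \<Rightarrow> nat set" where
  "verts t = (case t of (i, j, k) \<Rightarrow> {i, j, k})"

lemma triples_subset: "triples n \<subseteq> {..<n} \<times> {..<n} \<times> {..<n}"
  by (auto simp: triples_def)

lemma finite_triples [simp]: "finite (triples n)"
  by (rule finite_subset[OF triples_subset]) simp

lemma finite_verts [simp]: "finite (verts t)"
  by (simp add: verts_def split: prod.split)

lemma verts_subset: "t \<in> triples n \<Longrightarrow> verts t \<subseteq> {..<n}"
  by (auto simp: triples_def verts_def)

lemma mem_verts: "verts t \<subseteq> U \<Longrightarrow> t \<in> U \<times> U \<times> U"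
  by (cases t) (simp add: verts_def)

lemma card_verts: "t \<in> triples n \<Longrightarrow> card (verts t) = 3"
  by (auto simp: triples_def verts_def card_insert_if)

text \<open>One index from each of three consecutive blocks of length \<open>n div 3\<close> gives
  an increasing triple; only the order \<open>n^3\<close> matters.\<close>

lemma card_triples_ge: "(n div 3) ^ 3 \<le> card (triples n)"
proof -
  let ?q = "n div 3"
  have "{..<?q} \<times> {?q..<2*?q} \<times> {2*?q..<3*?q} \<subseteq> triples n"
    by (auto simp: triples_def)
  then have "card ({..<?q} \<times> {?q..<2*?q} \<times> {2*?q..<3*?q}) \<le> card (triples n)"
    by (intro card_mono) auto
  then show ?thesis by (simp add: card_cartesian_product power3_eq_cube)
qed

text \<open>A pair is determined by the union \<open>U\<close> of its vertices, with at most
  \<open>n ^ u\<close> choices, and by six entries from \<open>U\<close>.\<close>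

lemma card_pairs_of_triples:
  "card {q \<in> triples n \<times> triples n. card (verts (fst q) \<union> verts (snd q)) = u} \<le> n ^ u * u ^ 6"
proof -
  let ?U = "{U. U \<subseteq> {..<n} \<and> card U = u}"
  let ?C = "\<lambda>U. (U \<times> U \<times> U) \<times> (U \<times> U \<times> U) :: ((nat \<times> nat \<times> nat) \<times> (nat \<times> nat \<times> nat)) set"
  have fin: "finite ?U" by (rule finite_subset[of _ "Pow {..<n}"]) auto
  have finU: "finite U" if "U \<in> ?U" for U using that by (intro finite_subset[of U "{..<n}"]) auto
  have "{q \<in> triples n \<times> triples n. card (verts (fst q) \<union> verts (snd q)) = u} \<subseteq> (\<Union>U\<in>?U. ?C U)"
  proof
    fix q assume q: "q \<in> {q \<in> triples n \<times> triples n. card (verts (fst q) \<union> verts (snd q)) = u}"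
    then have "fst q \<in> triples n" "snd q \<in> triples n" "card (verts (fst q) \<union> verts (snd q)) = u"
      by (simp_all only: mem_Collect_eq mem_Times_iff)
    then have "verts (fst q) \<union> verts (snd q) \<in> ?U" using verts_subset by blast
    moreover have "q \<in> ?C (verts (fst q) \<union> verts (snd q))"
      by (subst mem_Times_iff) (intro conjI mem_verts; blast)
    ultimately show "q \<in> (\<Union>U\<in>?U. ?C U)" by blast
  qed
  then have "card {q \<in> triples n \<times> triples n. card (verts (fst q) \<union> verts (snd q)) = u} \<le> card (\<Union>U\<in>?U. ?C U)"
    by (rule card_mono[rotated]) (intro finite_UN_I[OF fin] finite_cartesian_product finU; assumption)
  also have "\<dots> \<le> (\<Sum>U\<in>?U. card (?C U))" by (rule card_UN_le[OF fin])
  also have "\<dots> = (\<Sum>U\<in>?U. u ^ 6)"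
    by (intro sum.cong refl) (auto simp: card_cartesian_product eval_nat_numeral)
  also have "\<dots> = (n choose u) * u ^ 6" using n_subsets[of "{..<n}" u] by simp
  also have "\<dots> \<le> n ^ u * u ^ 6"
  proof -
    have "n choose u \<le> n ^ u"
      by (cases "u \<le> n") (simp_all add: binomial_le_pow binomial_eq_0)
    then show ?thesis by (rule mult_right_mono) simp
  qed
  finally show ?thesis .
qed

lemma enorm_triangle: "enorm d (\<lambda>l. x l - y l) \<le> enorm d (\<lambda>l. x l - z l) + enorm d (\<lambda>l. z l - y l)"
  using L2_set_triangle_ineq[of "\<lambda>l. x l - z l" "\<lambda>l. z l - y l" "{..<d}"] by (simp add: enorm_def L2_set_def)

context density_sample
begin

text \<open>Since \<open>enn2real\<close> sends infinity to 0, \<open>prob_clique_le\<close> assumes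
  the integral to be finite.\<close>

definition moment :: "nat \<Rightarrow> real" where
  "moment u = enn2real (\<integral>\<^sup>+ x. ennreal (f x ^ u) \<partial>lebd d)"

definition clique_bound :: "real \<Rightarrow> nat \<Rightarrow> real" where
  "clique_bound \<rho> u = real u * ((unit_ball_vol (real d) * \<rho> ^ d) ^ (u - 1) * moment u)"

lemma prob_clique_le:
  assumes I: "finite I" "I \<noteq> {}" and \<rho>: "\<rho> \<ge> 0"
    and fin: "(\<integral>\<^sup>+ x. ennreal (f x ^ card I) \<partial>lebd d) < \<infinity>"
  shows "prob {\<omega> \<in> space M. \<forall>i\<in>I. \<forall>j\<in>I. enorm d (\<lambda>l. X i \<omega> l - X j \<omega> l) \<le> \<rho>} \<le> clique_bound \<rho> (card I)"
proof -
  have m: "(\<integral>\<^sup>+ x. ennreal (f x ^ card I) \<partial>lebd d) = ennreal (moment (card I))" "moment (card I) \<ge> 0"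
    using fin by (auto simp: moment_def)
  have v: "unit_ball_vol (real d) * \<rho> ^ d \<ge> 0" using \<rho> by simp
  have "ennreal (prob {\<omega> \<in> space M. \<forall>i\<in>I. \<forall>j\<in>I. enorm d (\<lambda>l. X i \<omega> l - X j \<omega> l) \<le> \<rho>}) \<le> ennreal (clique_bound \<rho> (card I))"
    using emeasure_clique_le[OF I \<rho>] v m
    by (simp add: emeasure_eq_measure clique_bound_def ennreal_mult ennreal_power ennreal_of_nat_eq_real_of_nat)
  then show ?thesis
    using v m by (subst (asm) ennreal_le_iff) (auto simp: clique_bound_def)
qed

text \<open>Interpolation between the first and fifth powers: \<open>f x ^ u\<close> is at most
  \<open>f x\<close> where \<open>f x \<le> 1\<close> and at most \<open>f x ^ 5\<close>
  elsewhere.\<close>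

lemma moment_finite:
  assumes "(\<integral>\<^sup>+ x. ennreal (f x ^ 5) \<partial>lebd d) < \<infinity>" "1 \<le> u" "u \<le> 5"
  shows "(\<integral>\<^sup>+ x. ennreal (f x ^ u) \<partial>lebd d) < \<infinity>"
proof -
  have pt: "f x ^ u \<le> f x + f x ^ 5" for x
  proof (cases "f x \<le> 1")
    case True
    then have "f x ^ u \<le> f x ^ 1" by (intro power_decreasing) (use assms f_nonneg in auto)
    then show ?thesis using f_nonneg[of x] by (simp add: add_increasing2)
  next
    case False
    then have "f x ^ u \<le> f x ^ 5" by (intro power_increasing) (use assms in auto)
    then show ?thesis using f_nonneg[of x] by simp
  qed
  have "(\<integral>\<^sup>+ x. ennreal (f x ^ u) \<partial>lebd d) \<le> (\<integral>\<^sup>+ x. ennreal (f x) + ennreal (f x ^ 5) \<partial>lebd d)"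
    using pt f_nonneg by (intro nn_integral_mono) (simp flip: ennreal_plus)
  also have "\<dots> = 1 + (\<integral>\<^sup>+ x. ennreal (f x ^ 5) \<partial>lebd d)"
    by (subst nn_integral_add) (auto simp: nn_integral_f)
  also have "\<dots> < \<infinity>" using assms(1) by simp
  finally show ?thesis .
qed

section \<open>Events attached to triples, their dependence and the variance of their count\<close>

definition triple_event :: "((nat \<Rightarrow> real) \<Rightarrow> (nat \<Rightarrow> real) \<Rightarrow> (nat \<Rightarrow> real) \<Rightarrow> bool) \<Rightarrow> nat \<times> nat \<times> nat \<Rightarrow> 'a set" where
  "triple_event P t = (case t of (i, j, k) \<Rightarrow> {\<omega> \<in> space M. P (X i \<omega>) (X j \<omega>) (X k \<omega>)})"

lemma measurable_pred3:
  assumes "Measurable.pred (lebd d \<Otimes>\<^sub>M lebd d \<Otimes>\<^sub>M lebd d) (\<lambda>(x, y, z). P x y z)"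
    and "a \<in> measurable N (lebd d)" "b \<in> measurable N (lebd d)" "c \<in> measurable N (lebd d)"
  shows "{\<omega> \<in> space N. P (a \<omega>) (b \<omega>) (c \<omega>)} \<in> sets N"
  using measurable_compose[OF measurable_Pair[OF assms(2) measurable_Pair[OF assms(3,4)]] assms(1)]
  by (simp add: pred_def)

lemma sets_triple_event:
  assumes "Measurable.pred (lebd d \<Otimes>\<^sub>M lebd d \<Otimes>\<^sub>M lebd d) (\<lambda>(x, y, z). P x y z)"
  shows "triple_event P t \<in> sets M"
  unfolding triple_event_def by (auto split: prod.split intro!: measurable_pred3[OF assms] measurable_X)

lemma triple_event_indep:
  assumes P: "Measurable.pred (lebd d \<Otimes>\<^sub>M lebd d \<Otimes>\<^sub>M lebd d) (\<lambda>(x, y, z). P x y z)"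
    and disj: "verts s \<inter> verts t = {}"
  shows "prob (triple_event P s \<inter> triple_event P t) = prob (triple_event P s) * prob (triple_event P t)"
proof -
  let ?N = "\<lambda>t. PiM (verts t) (\<lambda>_. lebd d)"
  let ?Y = "\<lambda>t \<omega>. \<lambda>i\<in>verts t. X i \<omega>"
  define Z where "Z t = {x \<in> space (?N t). case t of (i, j, k) \<Rightarrow> P (x i) (x j) (x k)}" for t
  have Z: "Z t \<in> sets (?N t)" for t
  proof (cases t)
    case (fields i j k)
    have "(\<lambda>x. x l) \<in> measurable (?N t) (lebd d)" if "l \<in> verts t" for l
      using that by (rule measurable_component_singleton)
    then have "{x \<in> space (?N t). P (x i) (x j) (x k)} \<in> sets (?N t)"
      by (intro measurable_pred3[OF P]) (auto simp: verts_def fields)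
    then show ?thesis by (simp add: Z_def fields)
  qed
  have X_space: "X i \<omega> \<in> space (lebd d)" if "\<omega> \<in> space M" for i \<omega>
    using measurable_space[OF measurable_X that] .
  have ZY: "?Y t -` Z t \<inter> space M = triple_event P t" for t
    by (cases t) (auto simp: Z_def triple_event_def verts_def space_PiM X_space)
  have "indep_var (?N s) (?Y s) (?N t) (?Y t)"
    by (rule indep_var_restrict[OF X_indep disj]) auto
  from indep_varD[OF this Z Z]
  have "prob ((\<lambda>x. (?Y s x, ?Y t x)) -` (Z s \<times> Z t) \<inter> space M) = prob (triple_event P s) * prob (triple_event P t)"
    unfolding ZY .
  also have "(\<lambda>x. (?Y s x, ?Y t x)) -` (Z s \<times> Z t) \<inter> space M = triple_event P s \<inter> triple_event P t"
    unfolding ZY[symmetric] by auto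
  finally show ?thesis .
qed

text \<open>Vertices of one triple are within \<open>\<rho>\<close> of its centre, hence within
  \<open>2 * \<rho>\<close> of each other; a path through a common vertex of both triples doubles
  this to \<open>4 * \<rho>\<close>.\<close>

lemma triple_event_overlap:
  assumes P: "\<And>x y z. P x y z \<Longrightarrow> enorm d (\<lambda>l. x l - z l) \<le> \<rho> \<and> enorm d (\<lambda>l. y l - z l) \<le> \<rho>"
    and ne: "verts s \<inter> verts t \<noteq> {}" and \<rho>: "\<rho> \<ge> 0"
  defines "U \<equiv> verts s \<union> verts t"
  shows "triple_event P s \<inter> triple_event P t \<subseteq>
    {\<omega> \<in> space M. \<forall>i\<in>U. \<forall>j\<in>U. enorm d (\<lambda>l. X i \<omega> l - X j \<omega> l) \<le> 4 * \<rho>}"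
proof
  fix \<omega> assume \<omega>: "\<omega> \<in> triple_event P s \<inter> triple_event P t"
  have near: "\<exists>c. \<forall>a\<in>verts t. enorm d (\<lambda>l. X a \<omega> l - X c \<omega> l) \<le> \<rho>" if "\<omega> \<in> triple_event P t" for t
  proof (cases t)
    case (fields i j k)
    have "P (X i \<omega>) (X j \<omega>) (X k \<omega>)" using that by (simp add: triple_event_def fields)
    from P[OF this] \<rho> show ?thesis
      by (intro exI[of _ k]) (auto simp: verts_def fields enorm_def)
  qed
  have pair: "enorm d (\<lambda>l. X a \<omega> l - X b \<omega> l) \<le> 2 * \<rho>" if t: "\<omega> \<in> triple_event P t" "a \<in> verts t" "b \<in> verts t" for t a b
  proof -
    obtain c where c: "\<And>a. a\<in>verts t \<Longrightarrow> enorm d (\<lambda>l. X a \<omega> l - X c \<omega> l) \<le> \<rho>" using near[OF t(1)] by auto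
    show ?thesis
      using enorm_triangle[of d "X a \<omega>" "X b \<omega>" "X c \<omega>"] c[OF t(2)] c[OF t(3)] enorm_minus_commute[of d "X b \<omega>" "X c \<omega>"] by simp
  qed
  obtain m where m: "m \<in> verts s" "m \<in> verts t" using ne by auto
  have m2: "enorm d (\<lambda>l. X a \<omega> l - X m \<omega> l) \<le> 2 * \<rho>" if "a \<in> U" for a
    using that pair[of s a m] pair[of t a m] \<omega> m by (auto simp: U_def)
  have "enorm d (\<lambda>l. X a \<omega> l - X b \<omega> l) \<le> 4 * \<rho>" if "a \<in> U" "b \<in> U" for a b
    using enorm_triangle[of d "X a \<omega>" "X b \<omega>" "X m \<omega>"] m2[OF that(1)] m2[OF that(2)] enorm_minus_commute[of d "X b \<omega>" "X m \<omega>"] by simp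
  moreover have "\<omega> \<in> space M" using \<omega> by (cases s) (auto simp: triple_event_def)
  ultimately show "\<omega> \<in> {\<omega> \<in> space M. \<forall>i\<in>U. \<forall>j\<in>U. enorm d (\<lambda>l. X i \<omega> l - X j \<omega> l) \<le> 4 * \<rho>}" by simp
qed

definition triple_count :: "((nat \<Rightarrow> real) \<Rightarrow> (nat \<Rightarrow> real) \<Rightarrow> (nat \<Rightarrow> real) \<Rightarrow> bool) \<Rightarrow> nat \<Rightarrow> 'a \<Rightarrow> real" where
  "triple_count P n \<omega> = (\<Sum>t\<in>triples n. indicator (triple_event P t) \<omega>)"

lemma expectation_triple_count:
  assumes P: "Measurable.pred (lebd d \<Otimes>\<^sub>M lebd d \<Otimes>\<^sub>M lebd d) (\<lambda>(x, y, z). P x y z)"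
  shows "expectation (triple_count P n) = (\<Sum>t\<in>triples n. prob (triple_event P t))"
  unfolding triple_count_def using sets_triple_event[OF P]
  by (subst Bochner_Integration.integral_sum) (auto simp: integrable_indicator_iff emeasure_eq_measure)

lemma measurable_triple_count:
  assumes P: "Measurable.pred (lebd d \<Otimes>\<^sub>M lebd d \<Otimes>\<^sub>M lebd d) (\<lambda>(x, y, z). P x y z)"
  shows "triple_count P n \<in> borel_measurable M"
  unfolding triple_count_def[abs_def] using sets_triple_event[OF P] by simp

lemma integrable_triple_count_sq:
  assumes P: "Measurable.pred (lebd d \<Otimes>\<^sub>M lebd d \<Otimes>\<^sub>M lebd d) (\<lambda>(x, y, z). P x y z)"
  shows "integrable M (\<lambda>\<omega>. (triple_count P n \<omega>)\<^sup>2)"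
proof (rule integrable_const_bound[where B="(real (card (triples n)))\<^sup>2"])
  have "0 \<le> triple_count P n \<omega>" "triple_count P n \<omega> \<le> real (card (triples n))" for \<omega>
    unfolding triple_count_def
    using sum_mono[of "triples n" "\<lambda>t. indicator (triple_event P t) \<omega>" "\<lambda>_. 1 :: real"]
    by (auto intro!: sum_nonneg simp: indicator_def)
  then show "AE \<omega> in M. norm ((triple_count P n \<omega>)\<^sup>2) \<le> (real (card (triples n)))\<^sup>2"
    by (auto intro!: power_mono)
qed (use measurable_triple_count[OF P] in simp)

text \<open>Covariances of disjoint triples vanish. For overlapping ones the product of the means is
  dropped and the joint probability is bounded by that of a clique on the union, which has at most 5
  points as the triples share one.\<close>

lemma variance_triple_count_le:
  assumes P: "Measurable.pred (lebd d \<Otimes>\<^sub>M lebd d \<Otimes>\<^sub>M lebd d) (\<lambda>(x, y, z). P x y z)"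
    and close: "\<And>x y z. P x y z \<Longrightarrow> enorm d (\<lambda>l. x l - z l) \<le> \<rho> \<and> enorm d (\<lambda>l. y l - z l) \<le> \<rho>"
    and \<rho>: "\<rho> \<ge> 0" and f5: "(\<integral>\<^sup>+ x. ennreal (f x ^ 5) \<partial>lebd d) < \<infinity>"
  shows "variance (triple_count P n) \<le> (\<Sum>u\<in>{3,4,5}. real n ^ u * real u ^ 6 * clique_bound (4 * \<rho>) u)"
proof -
  let ?T = "triples n" and ?A = "triple_event P"
  note sets_triple_event[OF P, measurable]
  let ?O = "{q \<in> ?T \<times> ?T. verts (fst q) \<inter> verts (snd q) \<noteq> {}}"
  let ?c = "\<lambda>q. card (verts (fst q) \<union> verts (snd q))"
  have cb0: "clique_bound (4 * \<rho>) u \<ge> 0" for u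
    using \<rho> by (simp add: clique_bound_def moment_def)
  have "integrable M (triple_count P n)"
    unfolding triple_count_def[abs_def] by (intro Bochner_Integration.integrable_sum) (auto simp: integrable_indicator_iff emeasure_eq_measure)
  then have "variance (triple_count P n) = expectation (\<lambda>\<omega>. (triple_count P n \<omega>)\<^sup>2) - (expectation (triple_count P n))\<^sup>2"
    by (rule variance_eq[OF _ integrable_triple_count_sq[OF P]])
  also have "expectation (\<lambda>\<omega>. (triple_count P n \<omega>)\<^sup>2) = (\<Sum>q\<in>?T \<times> ?T. prob (?A (fst q) \<inter> ?A (snd q)))"
  proof -
    have "(triple_count P n \<omega>)\<^sup>2 = (\<Sum>q\<in>?T \<times> ?T. indicator (?A (fst q) \<inter> ?A (snd q)) \<omega>)" for \<omega>
      unfolding triple_count_def power2_eq_square sum_product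
      by (simp only: sum.cartesian_product split_beta' indicator_inter_arith)
    then show ?thesis
      by (simp only:) (subst Bochner_Integration.integral_sum, auto simp: integrable_indicator_iff emeasure_eq_measure)
  qed
  also have "(expectation (triple_count P n))\<^sup>2 = (\<Sum>q\<in>?T \<times> ?T. prob (?A (fst q)) * prob (?A (snd q)))"
    unfolding expectation_triple_count[OF P] power2_eq_square sum_product
    by (simp add: sum.cartesian_product split_beta)
  also have "(\<Sum>q\<in>?T \<times> ?T. prob (?A (fst q) \<inter> ?A (snd q))) - (\<Sum>q\<in>?T \<times> ?T. prob (?A (fst q)) * prob (?A (snd q))) =
      (\<Sum>q\<in>?T \<times> ?T. prob (?A (fst q) \<inter> ?A (snd q)) - prob (?A (fst q)) * prob (?A (snd q)))"
    by (rule sum_subtractf[symmetric])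
  also have "\<dots> \<le> (\<Sum>q\<in>?T \<times> ?T. if verts (fst q) \<inter> verts (snd q) \<noteq> {} then clique_bound (4 * \<rho>) (?c q) else 0)"
  proof (rule sum_mono)
    fix q assume q: "q \<in> ?T \<times> ?T"
    show "prob (?A (fst q) \<inter> ?A (snd q)) - prob (?A (fst q)) * prob (?A (snd q)) \<le>
      (if verts (fst q) \<inter> verts (snd q) \<noteq> {} then clique_bound (4 * \<rho>) (?c q) else 0)"
    proof (cases "verts (fst q) \<inter> verts (snd q) = {}")
      case True
      then show ?thesis using triple_event_indep[OF P True] by simp
    next
      case False
      let ?U = "verts (fst q) \<union> verts (snd q)"
      have c3: "card (verts (fst q)) = 3" "card (verts (snd q)) = 3" using q card_verts by auto
      have "?c q \<ge> 3" using card_mono[of ?U "verts (fst q)"] c3 by simp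
      moreover have "?c q \<le> 5"
        using card_Un_Int[of "verts (fst q)" "verts (snd q)"] c3 False
        by (cases "card (verts (fst q) \<inter> verts (snd q))") auto
      ultimately have fin: "(\<integral>\<^sup>+ x. ennreal (f x ^ ?c q) \<partial>lebd d) < \<infinity>"
        by (intro moment_finite[OF f5]) auto
      have "prob (?A (fst q) \<inter> ?A (snd q)) \<le> prob {\<omega> \<in> space M. \<forall>i\<in>?U. \<forall>j\<in>?U. enorm d (\<lambda>l. X i \<omega> l - X j \<omega> l) \<le> 4 * \<rho>}"
        by (rule finite_measure_mono[OF triple_event_overlap[OF close False \<rho>]]) (auto, measurable)
      also have "\<dots> \<le> clique_bound (4 * \<rho>) (?c q)"
        by (rule prob_clique_le) (use fin \<rho> False in auto)
      finally have "prob (?A (fst q) \<inter> ?A (snd q)) \<le> clique_bound (4 * \<rho>) (?c q)" .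
      moreover have "0 \<le> prob (?A (fst q)) * prob (?A (snd q))" by simp
      ultimately have "prob (?A (fst q) \<inter> ?A (snd q)) - prob (?A (fst q)) * prob (?A (snd q)) \<le> clique_bound (4 * \<rho>) (?c q)"
        by linarith
      then show ?thesis using False by (simp only: not_False_eq_True if_True)
    qed
  qed
  \<comment> \<open>Spreading each term over the possible sizes \<open>u\<close> lets the sums be
    exchanged, which leaves a count of pairs for each size.\<close>
  also have "\<dots> \<le> (\<Sum>q\<in>?T \<times> ?T. \<Sum>u\<in>{3,4,5}. if ?c q = u then clique_bound (4 * \<rho>) u else 0)"
  proof (rule sum_mono)
    fix q assume q: "q \<in> ?T \<times> ?T"
    have c3: "card (verts (fst q)) = 3" "card (verts (snd q)) = 3" using q card_verts by auto
    have "?c q \<ge> 3" using card_mono[of "verts (fst q) \<union> verts (snd q)" "verts (fst q)"] c3 by simp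
    moreover have "?c q \<le> 5" if "verts (fst q) \<inter> verts (snd q) \<noteq> {}"
      using card_Un_Int[of "verts (fst q)" "verts (snd q)"] c3 that
      by (cases "card (verts (fst q) \<inter> verts (snd q))") auto
    ultimately have "?c q \<in> {3,4,5}" if "verts (fst q) \<inter> verts (snd q) \<noteq> {}" using that by force
    then show "(if verts (fst q) \<inter> verts (snd q) \<noteq> {} then clique_bound (4 * \<rho>) (?c q) else 0) \<le>
      (\<Sum>u\<in>{3,4,5}. if ?c q = u then clique_bound (4 * \<rho>) u else 0)"
      using cb0 by (auto simp: sum.delta)
  qed
  also have "\<dots> = (\<Sum>u\<in>{3,4,5}. \<Sum>q\<in>?T \<times> ?T. if ?c q = u then clique_bound (4 * \<rho>) u else 0)"
    by (rule sum.swap)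
  also have "\<dots> = (\<Sum>u\<in>{3,4,5}. real (card {q \<in> ?T \<times> ?T. ?c q = u}) * clique_bound (4 * \<rho>) u)"
    by (intro sum.cong refl) (simp add: sum.If_cases Int_def)
  also have "\<dots> \<le> (\<Sum>u\<in>{3,4,5}. real n ^ u * real u ^ 6 * clique_bound (4 * \<rho>) u)"
  proof (intro sum_mono mult_right_mono cb0)
    fix u :: nat
    have "real (card {q \<in> ?T \<times> ?T. ?c q = u}) \<le> real (n ^ u * u ^ 6)"
      by (rule of_nat_mono[OF card_pairs_of_triples])
    then show "real (card {q \<in> ?T \<times> ?T. ?c q = u}) \<le> real n ^ u * real u ^ 6" by simp
  qed
  finally show ?thesis .
qed

end

section \<open>Concentration and convergence\<close>

text \<open>Continuity of division, with positivity of \<open>b\<close> added so that the ratio of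
  counts is never taken at a zero denominator.\<close>

lemma divide_near:
  fixes a0 b0 e :: real
  assumes "b0 > 0" "e > 0"
  shows "\<exists>\<eta>>0. \<forall>a b. \<bar>a - a0\<bar> < \<eta> \<longrightarrow> \<bar>b - b0\<bar> < \<eta> \<longrightarrow> b > 0 \<and> \<bar>a / b - a0 / b0\<bar> < e"
proof -
  have "isCont (\<lambda>p. fst p / snd p) (a0, b0)"
    using assms by (intro continuous_intros) auto
  then obtain \<theta> where \<theta>: "\<theta> > 0" "\<And>p. dist p (a0, b0) < \<theta> \<Longrightarrow> dist (fst p / snd p) (a0 / b0) < e"
    using assms(2) unfolding continuous_at_eps_delta by (metis fst_conv snd_conv)
  have "b > 0 \<and> \<bar>a / b - a0 / b0\<bar> < e" if "\<bar>a - a0\<bar> < min (\<theta> / 2) b0" "\<bar>b - b0\<bar> < min (\<theta> / 2) b0" for a b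
  proof -
    have "dist (a, b) (a0, b0) \<le> \<bar>a - a0\<bar> + \<bar>b - b0\<bar>"
      by (simp add: dist_Pair_Pair dist_real_def sqrt_sum_squares_le_sum_abs)
    also have "\<dots> < \<theta>" using that by simp
    finally have "dist (fst (a, b) / snd (a, b)) (a0 / b0) < e" by (rule \<theta>(2))
    moreover have "b > 0" using that by (simp add: abs_less_iff)
    ultimately show ?thesis by (simp add: dist_real_def)
  qed
  then show ?thesis using \<theta>(1) assms(1) by (intro exI[of _ "min (\<theta> / 2) b0"]) auto
qed

lemma powr_three_halves_sq: "x > 0 \<Longrightarrow> (x powr (3/2))\<^sup>2 = (x::real) ^ 3"
  by (simp add: power2_eq_square powr_add[symmetric] powr_numeral)

text \<open>Here \<open>x\<close> stands for \<open>n\<close> and \<open>y\<close> for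
  \<open>r^d\<close>; \<open>x ^ 6 * y ^ 4\<close> is the order of the squared mean, and each
  numerator is the order of one overlap size.\<close>

lemma clique_rate_eq:
  fixes x y :: real
  assumes "x > 0" "y > 0"
  shows "x ^ 3 * y ^ 2 / (x ^ 6 * y ^ 4) = inverse (x ^ 3 * y ^ 2)"
    "x ^ 4 * y ^ 3 / (x ^ 6 * y ^ 4) = inverse (x ^ 2 * y)"
    "x ^ 5 * y ^ 4 / (x ^ 6 * y ^ 4) = inverse x"
proof -
  have cancel: "a * b / ((a * u) * (b * v)) = inverse (u * v)" if "a > 0" "b > 0" for a b u v :: real
    using that by (simp add: divide_simps)
  have p: "x ^ (m + k) = x ^ m * x ^ k" "y ^ (m + k) = y ^ m * y ^ k" for m k by (simp_all add: power_add)
  show "x ^ 3 * y ^ 2 / (x ^ 6 * y ^ 4) = inverse (x ^ 3 * y ^ 2)"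
    using cancel[of "x ^ 3" "y ^ 2" "x ^ 3" "y ^ 2"] p(1)[of 3 3] p(2)[of 2 2] assms by simp
  show "x ^ 4 * y ^ 3 / (x ^ 6 * y ^ 4) = inverse (x ^ 2 * y)"
    using cancel[of "x ^ 4" "y ^ 3" "x ^ 2" y] p(1)[of 4 2] p(2)[of 3 1] assms by simp
  show "x ^ 5 * y ^ 4 / (x ^ 6 * y ^ 4) = inverse x"
    using cancel[of "x ^ 5" "y ^ 4" x 1] p(1)[of 5 1] assms by simp
qed
lemma clique_rate_tendsto_0:
  fixes R :: "nat \<Rightarrow> real"
  assumes R: "\<And>n. R n > 0" and lim: "filterlim (\<lambda>n. real n powr (3/2) * R n) at_top sequentially"
    and u: "u \<in> {3, 4, 5}"
  shows "(\<lambda>n. real n ^ u * R n ^ (u - 1) / (real n ^ 6 * R n ^ 4)) \<longlonglongrightarrow> 0"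
proof -
  let ?x = "\<lambda>n. real n powr (3/2) * R n"
  have inv: "(\<lambda>n. inverse (?x n)) \<longlonglongrightarrow> 0"
    by (rule tendsto_inverse_0_at_top[OF lim])
  have sq: "(?x n)\<^sup>2 = real n ^ 3 * (R n)\<^sup>2" if "n \<ge> 1" for n
    using that by (simp add: power_mult_distrib powr_three_halves_sq)
  consider "u = 3" | "u = 4" | "u = 5" using u by auto
  then show ?thesis
  proof cases
    case 1
    have "(\<lambda>n. (inverse (?x n))\<^sup>2) \<longlonglongrightarrow> 0" using tendsto_power[OF inv, of 2] unfolding zero_power2 .
    moreover have "eventually (\<lambda>n. (inverse (?x n))\<^sup>2 = real n ^ u * R n ^ (u - 1) / (real n ^ 6 * R n ^ 4)) sequentially"
      using eventually_ge_at_top[of 1]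
    proof eventually_elim
      case (elim n)
      have "real n > 0" using elim by simp
      then show ?case
        using clique_rate_eq(1)[of "real n" "R n"] R[of n] 1 sq[OF elim] by (simp only: power_inverse) simp
    qed
    ultimately show ?thesis by (rule Lim_transform_eventually)
  next
    case 2
    have "eventually (\<lambda>n. real n ^ u * R n ^ (u - 1) / (real n ^ 6 * R n ^ 4) \<le> inverse (?x n)) sequentially"
      using eventually_ge_at_top[of 1]
    proof eventually_elim
      case (elim n)
      have n: "real n \<ge> 1" using elim by simp
      have "real n powr (3/2) \<le> real n powr 2" using n by (intro powr_mono) auto
      then have le: "?x n \<le> real n ^ 2 * R n" using R[of n] n
        by (intro mult_right_mono) (auto simp: powr_numeral)
      have "real n ^ u * R n ^ (u - 1) / (real n ^ 6 * R n ^ 4) = inverse (real n ^ 2 * R n)"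
        using clique_rate_eq(2)[of "real n" "R n"] R[of n] n 2 by simp
      also have "\<dots> \<le> inverse (?x n)"
        by (rule le_imp_inverse_le[OF le]) (use R[of n] n in auto)
      finally show ?case .
    qed
    moreover have "eventually (\<lambda>n. 0 \<le> real n ^ u * R n ^ (u - 1) / (real n ^ 6 * R n ^ 4)) sequentially"
      using R by (auto intro!: always_eventually divide_nonneg_nonneg mult_nonneg_nonneg simp: less_imp_le)
    ultimately show ?thesis
      by (intro tendsto_sandwich[OF _ _ tendsto_const inv])
  next
    case 3
    have "(\<lambda>n. inverse (real n)) \<longlonglongrightarrow> 0" by (rule lim_inverse_n)
    moreover have "eventually (\<lambda>n. inverse (real n) = real n ^ u * R n ^ (u - 1) / (real n ^ 6 * R n ^ 4)) sequentially"
      using eventually_ge_at_top[of 1]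
    proof eventually_elim
      case (elim n)
      then show ?case using clique_rate_eq(3)[of "real n" "R n"] R[of n] 3 by simp
    qed
    ultimately show ?thesis by (rule Lim_transform_eventually)
  qed
qed

text \<open>From \<open>n = 3\<close> on, rounding \<open>n / 3\<close> down costs at most a factor
  2, which explains the 6.\<close>

lemma card_triples_cube: "n \<ge> 3 \<Longrightarrow> (real n / 6) ^ 3 \<le> real (card (triples n))"
proof -
  assume "n \<ge> 3"
  then have "n \<le> 6 * (n div 3)" by presburger
  then have "real n / 6 \<le> real (n div 3)" by linarith
  then have "(real n / 6) ^ 3 \<le> real (n div 3) ^ 3" by (intro power_mono) auto
  also have "\<dots> \<le> real (card (triples n))" using card_triples_ge[of n] by (metis of_nat_mono of_nat_power)
  finally show ?thesis .
qed

context density_sample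
begin

lemma triple_count_concentrated:
  assumes f5: "(\<integral>\<^sup>+ x. ennreal (f x ^ 5) \<partial>lebd d) < \<infinity>"
    and r: "\<And>n. r n > 0" "r \<longlonglongrightarrow> 0" and rate: "filterlim (\<lambda>n. real n powr (3/2) * r n ^ d) at_top sequentially"
    and P: "\<And>n. Measurable.pred (lebd d \<Otimes>\<^sub>M lebd d \<Otimes>\<^sub>M lebd d) (\<lambda>(x, y, z). P n x y z)"
    and close: "\<And>n x y z. P n x y z \<Longrightarrow> enorm d (\<lambda>l. x l - z l) \<le> r n \<and> enorm d (\<lambda>l. y l - z l) \<le> r n"
    and K: "K \<in> sets (lebd d \<Otimes>\<^sub>M lebd d)" "emeasure (lebd d \<Otimes>\<^sub>M lebd d) K < \<infinity>"
    and PK: "\<And>n z a b. z \<in> space (lebd d) \<Longrightarrow> a \<in> space (lebd d) \<Longrightarrow> b \<in> space (lebd d) \<Longrightarrow>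
       P n (vshift d z (r n) a) (vshift d z (r n) b) z \<longleftrightarrow> (a, b) \<in> K"
    and \<delta>: "\<delta> > 0"
  shows "(\<lambda>n. prob {\<omega> \<in> space M. \<delta> \<le> \<bar>triple_count (P n) n \<omega> / (real (card (triples n)) * (r n ^ d)\<^sup>2) -
     measure (lebd d \<Otimes>\<^sub>M lebd d) K * moment 3\<bar>}) \<longlonglongrightarrow> 0"
proof -
  let ?LL = "lebd d \<Otimes>\<^sub>M lebd d"
  define \<kappa> where "\<kappa> = measure ?LL K * moment 3"
  define R where "R n = r n ^ d" for n
  define s where "s n = real (card (triples n)) * (R n)\<^sup>2" for n
  have R: "R n > 0" for n using r(1) by (simp add: R_def)
  define I where "I n = (\<integral>\<^sup>+ p. indicator K p * shift3 d f (r n) (fst p) (snd p) \<partial>?LL)" for n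
  have f3: "(\<integral>\<^sup>+ x. ennreal (f x ^ 3) \<partial>lebd d) < \<infinity>" by (rule moment_finite[OF f5]) auto
  then have m3: "(\<integral>\<^sup>+ x. ennreal (f x ^ 3) \<partial>lebd d) = ennreal (moment 3)" by (simp add: moment_def)
  have m0: "moment u \<ge> 0" for u by (simp add: moment_def)
  have lim0: "I \<longlonglongrightarrow> emeasure ?LL K * (\<integral>\<^sup>+ x. ennreal (f x ^ 3) \<partial>lebd d)"
    unfolding I_def
    by (rule kernel_shift3_tendsto[OF measurable_f f_nonneg _ f3 r(2) K]) (simp add: nn_integral_f)
  have "emeasure ?LL K * (\<integral>\<^sup>+ x. ennreal (f x ^ 3) \<partial>lebd d) = ennreal \<kappa>"
    using K(2) m0 by (simp add: \<kappa>_def m3 emeasure_eq_ennreal_measure less_top ennreal_mult)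
  with lim0 have I: "I \<longlonglongrightarrow> ennreal \<kappa>" by simp
  have "\<kappa> \<ge> 0" using m0 by (simp add: \<kappa>_def)
  have lim: "(\<lambda>n. enn2real (I n)) \<longlonglongrightarrow> \<kappa>"
    using tendsto_enn2real[OF I] \<open>\<kappa> \<ge> 0\<close> by simp
  have pr: "prob (triple_event (P n) t) = (R n)\<^sup>2 * enn2real (I n)" if "t \<in> triples n" for n t
  proof (cases t)
    case (fields i j k)
    then have ijk: "i \<noteq> j" "j \<noteq> k" "i \<noteq> k" using that by (auto simp: triples_def)
    have "emeasure M (triple_event (P n) t) = ennreal (R n) ^ 2 * I n"
      unfolding triple_event_def fields prod.case R_def I_def
      by (rule emeasure_triple[OF ijk r(1) P K(1) PK])
    then show ?thesis using R[of n] by (simp add: measure_def enn2real_mult ennreal_power)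
  qed
  have E: "expectation (triple_count (P n) n) = s n * enn2real (I n)" for n
    unfolding expectation_triple_count[OF P] s_def using pr by (simp add: mult.assoc)
  \<comment> \<open>The factors come from the lower bound \<open>(n / 6)^3\<close> on the number of
    triples, squared (\<open>6 ^ 6\<close>), the number of pairs on a vertex set
    (\<open>u ^ 6\<close>), the clique bound at radius \<open>4 * r n\<close>
    (\<open>4 ^ d\<close>), and Chebyshev's inequality at half of \<open>\<delta>\<close>
    (\<open>4 / \<delta>^2\<close>).\<close>
  define C where "C u = 6 ^ 6 * (real u ^ 6 * (real u * (unit_ball_vol (real d) * 4 ^ d) ^ (u - 1) * moment u)) * (4 / \<delta>\<^sup>2)" for u :: nat
  define B where "B n = (\<Sum>u\<in>{3,4,5}. C u * (real n ^ u * R n ^ (u - 1) / (real n ^ 6 * R n ^ 4)))" for n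
  have B: "B \<longlonglongrightarrow> 0"
  proof -
    have "B \<longlonglongrightarrow> (\<Sum>u\<in>{3,4,5}. C u * 0)"
      unfolding B_def
      by (intro tendsto_sum tendsto_mult tendsto_const clique_rate_tendsto_0[OF R]) (use rate in \<open>auto simp: R_def\<close>)
    then show ?thesis by simp
  qed
  \<comment> \<open>Half of \<open>\<delta>\<close> absorbs the distance of the normalised mean from
    its limit; the other half is left for the random deviation.\<close>
  have "eventually (\<lambda>n. dist (enn2real (I n)) \<kappa> < \<delta> / 2) sequentially"
    using lim \<delta> by (intro tendstoD) auto
  then have le: "eventually (\<lambda>n. prob {\<omega> \<in> space M. \<delta> \<le> \<bar>triple_count (P n) n \<omega> / s n - \<kappa>\<bar>} \<le> B n) sequentially"
    using eventually_ge_at_top[of 3]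
  proof eventually_elim
    case (elim n)
    have n: "real n > 0" using elim(2) by simp
    have c: "(real n / 6) ^ 3 \<le> real (card (triples n))" by (rule card_triples_cube[OF elim(2)])
    have s_ge: "(real n / 6) ^ 3 * (R n)\<^sup>2 \<le> s n"
      unfolding s_def by (rule mult_right_mono[OF c]) simp
    have "0 < (real n / 6) ^ 3 * (R n)\<^sup>2" using n R[of n] by simp
    with s_ge have s0: "s n > 0" by linarith
    let ?S = "triple_count (P n) n"
    have [measurable]: "?S \<in> borel_measurable M" by (rule measurable_triple_count[OF P])
    have "{\<omega> \<in> space M. \<delta> \<le> \<bar>?S \<omega> / s n - \<kappa>\<bar>} \<subseteq> {\<omega> \<in> space M. \<delta> / 2 * s n \<le> \<bar>?S \<omega> - expectation ?S\<bar>}"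
    proof (intro Collect_mono impI conjI; elim conjE)
      fix \<omega> assume a: "\<delta> \<le> \<bar>?S \<omega> / s n - \<kappa>\<bar>"
      have "\<bar>?S \<omega> / s n - enn2real (I n)\<bar> \<ge> \<delta> / 2"
        using a elim(1) unfolding dist_real_def by linarith
      then have "\<delta> / 2 * s n \<le> \<bar>?S \<omega> / s n - enn2real (I n)\<bar> * s n" using s0 by (intro mult_right_mono) auto
      also have "\<dots> = \<bar>(?S \<omega> / s n - enn2real (I n)) * s n\<bar>" using s0 by (simp add: abs_mult)
      also have "(?S \<omega> / s n - enn2real (I n)) * s n = ?S \<omega> - expectation ?S"
        using s0 by (simp add: E field_simps)
      finally show "\<delta> / 2 * s n \<le> \<bar>?S \<omega> - expectation ?S\<bar>" .
    qed
    then have "prob {\<omega> \<in> space M. \<delta> \<le> \<bar>?S \<omega> / s n - \<kappa>\<bar>} \<le> prob {\<omega> \<in> space M. \<delta> / 2 * s n \<le> \<bar>?S \<omega> - expectation ?S\<bar>}"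
      by (rule finite_measure_mono) measurable
    also have "\<dots> \<le> variance ?S / (\<delta> / 2 * s n)\<^sup>2"
      by (rule Chebyshev_inequality) (use s0 \<delta> integrable_triple_count_sq[OF P] in auto)
    also have "\<dots> \<le> (\<Sum>u\<in>{3,4,5}. real n ^ u * real u ^ 6 * clique_bound (4 * r n) u) / (\<delta> / 2 * s n)\<^sup>2"
      using r(1)[of n] by (intro divide_right_mono variance_triple_count_le[OF P close _ f5]) (auto simp: less_imp_le)
    also have "\<dots> \<le> (\<Sum>u\<in>{3,4,5}. real n ^ u * real u ^ 6 * clique_bound (4 * r n) u) / (\<delta> / 2 * ((real n / 6) ^ 3 * (R n)\<^sup>2))\<^sup>2"
    proof (rule divide_left_mono)
      show "(\<delta> / 2 * ((real n / 6) ^ 3 * (R n)\<^sup>2))\<^sup>2 \<le> (\<delta> / 2 * s n)\<^sup>2"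
        using \<delta> s_ge n R[of n] by (intro power_mono mult_left_mono) auto
      show "0 \<le> (\<Sum>u\<in>{3,4,5}. real n ^ u * real u ^ 6 * clique_bound (4 * r n) u)"
        using r(1)[of n] m0 by (intro sum_nonneg mult_nonneg_nonneg) (auto simp: clique_bound_def)
      show "0 < (\<delta> / 2 * s n)\<^sup>2 * (\<delta> / 2 * ((real n / 6) ^ 3 * (R n)\<^sup>2))\<^sup>2"
        using \<delta> s0 n R[of n] by simp
    qed
    also have "\<dots> = B n"
    proof -
      have "real n ^ u * real u ^ 6 * clique_bound (4 * r n) u / (\<delta> / 2 * ((real n / 6) ^ 3 * (R n)\<^sup>2))\<^sup>2 =
        C u * (real n ^ u * R n ^ (u - 1) / (real n ^ 6 * R n ^ 4))" for u
      proof -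
        have cb: "clique_bound (4 * r n) u = (real u * (unit_ball_vol (real d) * 4 ^ d) ^ (u - 1) * moment u) * R n ^ (u - 1)"
          by (simp add: clique_bound_def R_def power_mult_distrib mult_ac)
        have sq: "(\<delta> / 2 * ((real n / 6) ^ 3 * (R n)\<^sup>2))\<^sup>2 = (\<delta>\<^sup>2 / 4) * (real n ^ 6 * R n ^ 4) / 6 ^ 6"
          by (simp add: power_mult_distrib power_divide flip: power_mult)
        have cancel: "a * b * (c * e) / (t / 4 * N / k) = k * (b * c) * (4 / t) * (a * e / N)"
          if "t > 0" "N > 0" "k > 0" for a b c e t N k :: real
          using that by (simp add: divide_simps)
        show ?thesis
          unfolding cb C_def sq by (rule cancel) (use \<delta> n R[of n] in auto)
      qed
      then show ?thesis by (simp only: B_def sum_divide_distrib)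
    qed
    finally show ?case .
  qed
  have "(\<lambda>n. prob {\<omega> \<in> space M. \<delta> \<le> \<bar>triple_count (P n) n \<omega> / s n - \<kappa>\<bar>}) \<longlonglongrightarrow> 0"
    by (rule tendsto_sandwich[OF _ le tendsto_const B]) simp
  then show ?thesis by (simp only: s_def R_def \<kappa>_def)
qed

end

section \<open>The limiting shapes of paths and triangles\<close>

definition wedge_set :: "nat \<Rightarrow> ((nat \<Rightarrow> real) \<times> (nat \<Rightarrow> real)) set" where
  "wedge_set d = {p \<in> space (lebd d \<Otimes>\<^sub>M lebd d). enorm d (fst p) \<le> 1 \<and> enorm d (snd p) \<le> 1}"

text \<open>As in \<open>wedge_set\<close>, the points are pairs of offsets of the two outer
  vertices from the centre, in units of \<open>r\<close>.\<close>

definition triangle_set :: "nat \<Rightarrow> ((nat \<Rightarrow> real) \<times> (nat \<Rightarrow> real)) set" where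
  "triangle_set d = {p \<in> space (lebd d \<Otimes>\<^sub>M lebd d). enorm d (fst p) \<le> 1 \<and> enorm d (snd p) \<le> 1 \<and>
     enorm d (\<lambda>l. fst p l - snd p l) \<le> 1}"

lemma sets_wedge_set: "wedge_set d \<in> sets (lebd d \<Otimes>\<^sub>M lebd d)"
  unfolding wedge_set_def by measurable

lemma sets_triangle_set: "triangle_set d \<in> sets (lebd d \<Otimes>\<^sub>M lebd d)"
  unfolding triangle_set_def by measurable

lemma emeasure_wedge_set: "emeasure (lebd d \<Otimes>\<^sub>M lebd d) (wedge_set d) = ennreal (unit_ball_vol (real d) ^ 2)"
proof -
  have "wedge_set d = unit_ball_d d \<times> unit_ball_d d"
    by (auto simp: wedge_set_def unit_ball_d_def space_pair_measure)
  then show ?thesis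
    by (simp add: lebd.emeasure_pair_measure_Times emeasure_unit_ball_d power2_eq_square ennreal_mult)
qed

text \<open>The slice over an \<open>x\<close> in the unit ball is the lens of \<open>x\<close>, so
  \<open>w_mult_sq\<close> applies. Compared with \<open>emeasure_wedge_set\<close>, this is where
  \<open>w d\<close> enters as a ratio of volumes.\<close>

lemma emeasure_triangle_set:
  "emeasure (lebd d \<Otimes>\<^sub>M lebd d) (triangle_set d) = ennreal (w d * unit_ball_vol (real d) ^ 2)"
proof -
  have "emeasure (lebd d \<Otimes>\<^sub>M lebd d) (triangle_set d) = (\<integral>\<^sup>+ x. emeasure (lebd d) (Pair x -` triangle_set d) \<partial>lebd d)"
    by (rule lebd.emeasure_pair_measure_alt[OF sets_triangle_set])
  also have "\<dots> = (\<integral>\<^sup>+ x. indicator {x. enorm d x \<le> 1} x * lens_vol d x \<partial>lebd d)"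
  proof (rule nn_integral_cong)
    fix x assume x: "x \<in> space (lebd d)"
    have "emeasure (lebd d) (Pair x -` triangle_set d) = (\<integral>\<^sup>+ y. indicator (Pair x -` triangle_set d) y \<partial>lebd d)"
      by (rule nn_integral_indicator[symmetric]) (rule sets_Pair1[OF sets_triangle_set])
    also have "\<dots> = (\<integral>\<^sup>+ y. indicator {x. enorm d x \<le> 1} x *
        indicator {y. enorm d y \<le> 1 \<and> enorm d (\<lambda>i. y i - x i) \<le> 1} y \<partial>lebd d)"
      using x by (intro nn_integral_cong)
        (simp add: indicator_def triangle_set_def space_pair_measure enorm_minus_commute[of d x])
    also have "\<dots> = indicator {x. enorm d x \<le> 1} x * lens_vol d x"
      unfolding lens_vol_def by (rule nn_integral_cmult[OF measurable_lens])
    finally show "emeasure (lebd d) (Pair x -` triangle_set d) = indicator {x. enorm d x \<le> 1} x * lens_vol d x" .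
  qed
  also have "\<dots> = ennreal (w d) * ennreal (unit_ball_vol (real d)) ^ 2" by (rule w_mult_sq[symmetric])
  finally show ?thesis by (simp add: ennreal_mult' ennreal_power w_def)
qed

definition wedge :: "nat \<Rightarrow> real \<Rightarrow> (nat \<Rightarrow> real) \<Rightarrow> (nat \<Rightarrow> real) \<Rightarrow> (nat \<Rightarrow> real) \<Rightarrow> bool" where
  "wedge d r x y z \<longleftrightarrow> enorm d (\<lambda>l. z l - x l) \<le> r \<and> enorm d (\<lambda>l. z l - y l) \<le> r"

definition triangle :: "nat \<Rightarrow> real \<Rightarrow> (nat \<Rightarrow> real) \<Rightarrow> (nat \<Rightarrow> real) \<Rightarrow> (nat \<Rightarrow> real) \<Rightarrow> bool" where
  "triangle d r x y z \<longleftrightarrow> wedge d r x y z \<and> enorm d (\<lambda>l. x l - y l) \<le> r"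

lemma measurable_wedge: "Measurable.pred (lebd d \<Otimes>\<^sub>M lebd d \<Otimes>\<^sub>M lebd d) (\<lambda>(x, y, z). wedge d r x y z)"
  unfolding wedge_def split_beta' by measurable

lemma measurable_triangle: "Measurable.pred (lebd d \<Otimes>\<^sub>M lebd d \<Otimes>\<^sub>M lebd d) (\<lambda>(x, y, z). triangle d r x y z)"
  unfolding triangle_def wedge_def split_beta' by measurable

lemma enorm_vshift_diff:
  assumes "r > 0"
  shows "enorm d (\<lambda>l. z l - vshift d z r a l) \<le> r \<longleftrightarrow> enorm d a \<le> 1"
    and "enorm d (\<lambda>l. vshift d z r a l - vshift d z r b l) \<le> r \<longleftrightarrow> enorm d (\<lambda>l. a l - b l) \<le> 1"
proof -
  have "enorm d (\<lambda>l. z l - vshift d z r a l) = enorm d (\<lambda>l. - r * a l)"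
    by (rule enorm_cong) (simp add: vshift_def)
  then show "enorm d (\<lambda>l. z l - vshift d z r a l) \<le> r \<longleftrightarrow> enorm d a \<le> 1"
    using assms by (simp only: enorm_scale) simp
  have "enorm d (\<lambda>l. vshift d z r a l - vshift d z r b l) = enorm d (\<lambda>l. r * (a l - b l))"
    by (rule enorm_cong) (simp add: vshift_def algebra_simps)
  then show "enorm d (\<lambda>l. vshift d z r a l - vshift d z r b l) \<le> r \<longleftrightarrow> enorm d (\<lambda>l. a l - b l) \<le> 1"
    using assms by (simp only: enorm_scale) simp
qed

lemma wedge_vshift:
  assumes "r > 0" "z \<in> space (lebd d)" "a \<in> space (lebd d)" "b \<in> space (lebd d)"
  shows "wedge d r (vshift d z r a) (vshift d z r b) z \<longleftrightarrow> (a, b) \<in> wedge_set d"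
  using assms by (simp add: wedge_def wedge_set_def enorm_vshift_diff space_pair_measure)

lemma triangle_vshift:
  assumes "r > 0" "z \<in> space (lebd d)" "a \<in> space (lebd d)" "b \<in> space (lebd d)"
  shows "triangle d r (vshift d z r a) (vshift d z r b) z \<longleftrightarrow> (a, b) \<in> triangle_set d"
  using assms by (simp add: triangle_def wedge_def triangle_set_def enorm_vshift_diff space_pair_measure)

context density_sample
begin

text \<open>The normalised denominator converges to a multiple of \<open>moment 3\<close>, so the
  quotient has a limit only if this is nonzero. Otherwise \<open>f\<close> would vanish almost
  everywhere, against its total mass 1.\<close>

lemma moment_3_pos:
  assumes "(\<integral>\<^sup>+ x. ennreal (f x ^ 5) \<partial>lebd d) < \<infinity>"
  shows "moment 3 > 0"
proof -
  have fin: "(\<integral>\<^sup>+ x. ennreal (f x ^ 3) \<partial>lebd d) < \<infinity>" by (rule moment_finite[OF assms]) auto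
  have "(\<integral>\<^sup>+ x. ennreal (f x ^ 3) \<partial>lebd d) \<noteq> 0"
  proof
    assume "(\<integral>\<^sup>+ x. ennreal (f x ^ 3) \<partial>lebd d) = 0"
    then have "AE x in lebd d. ennreal (f x ^ 3) = 0"
      by (subst (asm) nn_integral_0_iff_AE) auto
    then have "AE x in lebd d. ennreal (f x) = 0"
      by eventually_elim (use f_nonneg in \<open>simp add: ennreal_eq_0_iff power_le_zero_eq\<close>)
    then have "(\<integral>\<^sup>+ x. ennreal (f x) \<partial>lebd d) = 0"
      by (subst nn_integral_0_iff_AE) auto
    then show False by (simp add: nn_integral_f)
  qed
  with fin show ?thesis by (simp add: moment_def enn2real_positive_iff zero_less_iff_neq_zero)
qed

section \<open>Convergence of the ratio and of its argmin\<close>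

lemma triple_count_eq_card:
  assumes "\<omega> \<in> space M"
  shows "triple_count P n \<omega> = real (card {(i, j, k). i < j \<and> j < k \<and> k < n \<and> P (X i \<omega>) (X j \<omega>) (X k \<omega>)})"
proof -
  have "triple_count P n \<omega> = real (card {t \<in> triples n. \<omega> \<in> triple_event P t})"
    unfolding triple_count_def by (simp add: indicator_def sum.If_cases Int_def)
  also have "{t \<in> triples n. \<omega> \<in> triple_event P t} = {(i, j, k). i < j \<and> j < k \<and> k < n \<and> P (X i \<omega>) (X j \<omega>) (X k \<omega>)}"
    using assms by (auto simp: triples_def triple_event_def)
  finally show ?thesis .
qed

lemma W2_eq_triple_count:
  assumes "\<omega> \<in> space M"
  shows "W2 c d r n (\<lambda>i. X i \<omega>) =
    (if triple_count (wedge d r) n \<omega> = 0 then c else triple_count (triangle d r) n \<omega> / triple_count (wedge d r) n \<omega>)"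
proof -
  have "{(i, j, k). i < j \<and> j < k \<and> k < n \<and> adj d r (\<lambda>i. X i \<omega>) k i \<and> adj d r (\<lambda>i. X i \<omega>) k j \<and> adj d r (\<lambda>i. X i \<omega>) i j} =
     {(i, j, k). i < j \<and> j < k \<and> k < n \<and> triangle d r (X i \<omega>) (X j \<omega>) (X k \<omega>)}"
    by (auto simp: adj_def triangle_def wedge_def)
  moreover have "{(i, j, k). i < j \<and> j < k \<and> k < n \<and> adj d r (\<lambda>i. X i \<omega>) k i \<and> adj d r (\<lambda>i. X i \<omega>) k j} =
     {(i, j, k). i < j \<and> j < k \<and> k < n \<and> wedge d r (X i \<omega>) (X j \<omega>) (X k \<omega>)}"
    by (auto simp: adj_def wedge_def)
  ultimately show ?thesis
    unfolding W2_def Let_def triple_count_eq_card[OF assms] by simp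
qed

lemma measurable_W2: "(\<lambda>\<omega>. W2 c d r n (\<lambda>i. X i \<omega>)) \<in> borel_measurable M"
proof -
  have [measurable]: "triple_count (wedge d r) n \<in> borel_measurable M" "triple_count (triangle d r) n \<in> borel_measurable M"
    by (intro measurable_triple_count measurable_wedge measurable_triangle)+
  have "(\<lambda>\<omega>. if triple_count (wedge d r) n \<omega> = 0 then c
      else triple_count (triangle d r) n \<omega> / triple_count (wedge d r) n \<omega>) \<in> borel_measurable M"
    by measurable
  then show ?thesis by (subst measurable_cong[OF W2_eq_triple_count])
qed

lemma W2_tendsto_in_prob:
  assumes f5: "(\<integral>\<^sup>+ x. ennreal (f x ^ 5) \<partial>lebd d) < \<infinity>"
    and r: "\<And>n. r n > 0" "r \<longlonglongrightarrow> 0" and rate: "filterlim (\<lambda>n. real n powr (3/2) * r n ^ d) at_top sequentially"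
    and \<epsilon>: "\<epsilon> > 0"
  shows "(\<lambda>n. prob {\<omega> \<in> space M. \<bar>W2 c d (r n) n (\<lambda>i. X i \<omega>) - w d\<bar> > \<epsilon>}) \<longlonglongrightarrow> 0"
proof -
  let ?v = "unit_ball_vol (real d)"
  define s where "s n = real (card (triples n)) * (r n ^ d)\<^sup>2" for n
  let ?N = "\<lambda>n. triple_count (wedge d (r n)) n" and ?T = "\<lambda>n. triple_count (triangle d (r n)) n"
  have w0: "w d \<ge> 0" by (simp add: w_def)
  have m3: "moment 3 > 0" by (rule moment_3_pos[OF f5])
  have mN: "measure (lebd d \<Otimes>\<^sub>M lebd d) (wedge_set d) = ?v\<^sup>2"
    by (simp add: measure_def emeasure_wedge_set)
  have mT: "measure (lebd d \<Otimes>\<^sub>M lebd d) (triangle_set d) = w d * ?v\<^sup>2"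
    using w0 by (simp add: measure_def emeasure_triangle_set)
  have close: "wedge d r x y z \<Longrightarrow> enorm d (\<lambda>l. x l - z l) \<le> r \<and> enorm d (\<lambda>l. y l - z l) \<le> r" for r x y z
    by (simp add: wedge_def enorm_minus_commute[of d z])
  have close': "triangle d r x y z \<Longrightarrow> enorm d (\<lambda>l. x l - z l) \<le> r \<and> enorm d (\<lambda>l. y l - z l) \<le> r" for r x y z
    using close[of r x y z] unfolding triangle_def by blast
  have v0: "?v > 0" by (rule unit_ball_vol_pos) simp
  then have "?v\<^sup>2 * moment 3 > 0" using m3 by (intro mult_pos_pos zero_less_power)
  then obtain \<eta> where \<eta>: "\<eta> > 0" "\<And>a b. \<bar>a - w d * ?v\<^sup>2 * moment 3\<bar> < \<eta> \<Longrightarrow> \<bar>b - ?v\<^sup>2 * moment 3\<bar> < \<eta> \<Longrightarrow>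
      b > 0 \<and> \<bar>a / b - (w d * ?v\<^sup>2 * moment 3) / (?v\<^sup>2 * moment 3)\<bar> < \<epsilon>"
    using divide_near[of "?v\<^sup>2 * moment 3" \<epsilon> "w d * ?v\<^sup>2 * moment 3"] \<epsilon> by metis
  let ?EN = "\<lambda>n. {\<omega> \<in> space M. \<eta> \<le> \<bar>?N n \<omega> / s n - ?v\<^sup>2 * moment 3\<bar>}"
  let ?ET = "\<lambda>n. {\<omega> \<in> space M. \<eta> \<le> \<bar>?T n \<omega> / s n - w d * ?v\<^sup>2 * moment 3\<bar>}"
  have "(\<lambda>n. prob (?EN n)) \<longlonglongrightarrow> 0"
    unfolding s_def mN[symmetric]
    by (rule triple_count_concentrated[OF f5 r rate measurable_wedge close sets_wedge_set _ wedge_vshift[OF r(1)] \<eta>(1)])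
      (simp_all add: emeasure_wedge_set)
  moreover have "(\<lambda>n. prob (?ET n)) \<longlonglongrightarrow> 0"
    unfolding s_def mT[symmetric]
    by (rule triple_count_concentrated[OF f5 r rate measurable_triangle close' sets_triangle_set _ triangle_vshift[OF r(1)] \<eta>(1)])
      (simp_all add: emeasure_triangle_set)
  ultimately have lim: "(\<lambda>n. prob (?EN n) + prob (?ET n)) \<longlonglongrightarrow> 0"
    by (rule tendsto_add_zero)
  have "prob {\<omega> \<in> space M. \<bar>W2 c d (r n) n (\<lambda>i. X i \<omega>) - w d\<bar> > \<epsilon>} \<le> prob (?EN n) + prob (?ET n)" for n
  proof -
    have [measurable]: "?N n \<in> borel_measurable M" "?T n \<in> borel_measurable M"
      by (intro measurable_triple_count measurable_wedge measurable_triangle)+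
    have ms: "?EN n \<in> events" "?ET n \<in> events" by measurable
    have "{\<omega> \<in> space M. \<bar>W2 c d (r n) n (\<lambda>i. X i \<omega>) - w d\<bar> > \<epsilon>} \<subseteq> ?EN n \<union> ?ET n"
    proof (rule subsetI, rule ccontr)
      fix \<omega> assume \<omega>: "\<omega> \<in> {\<omega> \<in> space M. \<bar>W2 c d (r n) n (\<lambda>i. X i \<omega>) - w d\<bar> > \<epsilon>}" and "\<omega> \<notin> ?EN n \<union> ?ET n"
      then have near: "?N n \<omega> / s n > 0 \<and> \<bar>(?T n \<omega> / s n) / (?N n \<omega> / s n) - (w d * ?v\<^sup>2 * moment 3) / (?v\<^sup>2 * moment 3)\<bar> < \<epsilon>"
        by (intro \<eta>(2)) auto
      \<comment> \<open>A positive normalised denominator excludes the branch of \<open>W2\<close>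
        that returns \<open>c\<close>, and the normalisation \<open>s n\<close> cancels in the
        quotient.\<close>
      then have "?N n \<omega> \<noteq> 0" "s n \<noteq> 0" by auto
      then have "W2 c d (r n) n (\<lambda>i. X i \<omega>) = (?T n \<omega> / s n) / (?N n \<omega> / s n)"
        using \<omega> by (simp add: W2_eq_triple_count)
      moreover have "(w d * ?v\<^sup>2 * moment 3) / (?v\<^sup>2 * moment 3) = w d"
        using m3 less_imp_neq[OF v0, symmetric] by simp
      ultimately show False using near \<omega> by simp
    qed
    then have "prob {\<omega> \<in> space M. \<bar>W2 c d (r n) n (\<lambda>i. X i \<omega>) - w d\<bar> > \<epsilon>} \<le> prob (?EN n \<union> ?ET n)"
      by (rule finite_measure_mono) (use ms in auto)
    also have "\<dots> \<le> prob (?EN n) + prob (?ET n)"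
      by (rule measure_Un_le[OF ms])
    finally show ?thesis .
  qed
  then show ?thesis
    by (intro tendsto_sandwich[OF _ _ tendsto_const lim]) auto
qed

text \<open>The event says that \<open>d\<close> is a strict minimiser over all
  \<open>s \<ge> 1\<close>, which yields existence and uniqueness of the argmin together.\<close>

lemma W2_argmin_in_prob:
  assumes d: "1 \<le> d" and f5: "(\<integral>\<^sup>+ x. ennreal (f x ^ 5) \<partial>lebd d) < \<infinity>"
    and r: "\<And>n. r n > 0" "r \<longlonglongrightarrow> 0" and rate: "filterlim (\<lambda>n. real n powr (3/2) * r n ^ d) at_top sequentially"
  shows "(\<lambda>n. prob {\<omega> \<in> space M. \<forall>s. 1 \<le> s \<and> s \<noteq> d \<longrightarrow>
      \<bar>W2 c d (r n) n (\<lambda>i. X i \<omega>) - w d\<bar> < \<bar>W2 c d (r n) n (\<lambda>i. X i \<omega>) - w s\<bar>}) \<longlonglongrightarrow> 1"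
proof -
  let ?W = "\<lambda>n \<omega>. W2 c d (r n) n (\<lambda>i. X i \<omega>)"
  let ?G = "\<lambda>n. {\<omega> \<in> space M. \<forall>s. 1 \<le> s \<and> s \<noteq> d \<longrightarrow> \<bar>?W n \<omega> - w d\<bar> < \<bar>?W n \<omega> - w s\<bar>}"
  obtain \<delta> where \<delta>: "\<delta> > 0" "\<And>s. 1 \<le> s \<Longrightarrow> s \<noteq> d \<Longrightarrow> \<delta> \<le> \<bar>w s - w d\<bar>"
    using w_gap[OF d] by blast
  \<comment> \<open>If \<open>W2\<close> is within \<open>\<delta> / 3\<close> of
    \<open>w d\<close>, it is at least \<open>2 * \<delta> / 3\<close> away from every other
    \<open>w s\<close>.\<close>
  let ?B = "\<lambda>n. {\<omega> \<in> space M. \<bar>?W n \<omega> - w d\<bar> > \<delta> / 3}"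
  have lim: "(\<lambda>n. 1 - prob (?B n)) \<longlonglongrightarrow> 1 - 0"
    by (intro tendsto_diff tendsto_const W2_tendsto_in_prob[OF f5 r rate]) (use \<delta>(1) in simp)
  have "1 - prob (?B n) \<le> prob (?G n)" for n
  proof -
    have [measurable]: "?W n \<in> borel_measurable M" by (rule measurable_W2)
    have [measurable]: "?B n \<in> events" "?G n \<in> events" by measurable
    have "space M - ?B n \<subseteq> ?G n"
    proof
      fix \<omega> assume \<omega>: "\<omega> \<in> space M - ?B n"
      then have near: "\<bar>?W n \<omega> - w d\<bar> \<le> \<delta> / 3" by auto
      have "\<bar>?W n \<omega> - w d\<bar> < \<bar>?W n \<omega> - w s\<bar>" if "1 \<le> s" "s \<noteq> d" for s
        using near \<delta>(2)[OF that] \<delta>(1) by linarith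
      then show "\<omega> \<in> ?G n" using \<omega> by simp
    qed
    then have "prob (space M - ?B n) \<le> prob (?G n)" by (rule finite_measure_mono) measurable
    then show ?thesis by (simp add: prob_compl)
  qed
  then have "eventually (\<lambda>n. 1 - prob (?B n) \<le> prob (?G n)) sequentially"
    by (intro always_eventually allI)
  moreover have "eventually (\<lambda>n. prob (?G n) \<le> 1) sequentially"
    by (intro always_eventually allI prob_le_1)
  moreover have "(\<lambda>n. 1 - prob (?B n)) \<longlonglongrightarrow> 1"
    using lim by (simp only: diff_zero)
  ultimately show ?thesis
    by (rule tendsto_sandwich[OF _ _ _ tendsto_const])
qed

end

theorem theorem5:
  fixes M :: "'a measure" and X :: "nat \<Rightarrow> 'a \<Rightarrow> (nat \<Rightarrow> real)"
    and f :: "(nat \<Rightarrow> real) \<Rightarrow> real" and r :: "nat \<Rightarrow> real"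
    and d :: nat and c :: real
  assumes "d \<ge> 1"
    and "prob_space M"
    and "\<And>x. f x \<ge> 0"
    and "\<And>i. distributed M (lebd d) (X i) (\<lambda>x. ennreal (f x))"
    and "prob_space.indep_vars M (\<lambda>_. lebd d) X UNIV"
    and "(\<integral>\<^sup>+ x. ennreal (f x ^ 5) \<partial>lebd d) < \<infinity>"
    and "\<And>n. r n > 0"
    and "r \<longlonglongrightarrow> 0"
    and "filterlim (\<lambda>n. real n powr (3/2) * r n ^ d) at_top sequentially"
  shows "(\<forall>\<epsilon>>0. (\<lambda>n. measure M {\<omega> \<in> space M.
             \<bar>W2 c d (r n) n (\<lambda>i. X i \<omega>) - w d\<bar> > \<epsilon>}) \<longlonglongrightarrow> 0)
       \<and> (\<lambda>n. measure M {\<omega> \<in> space M. \<forall>s. 1 \<le> s \<and> s \<noteq> d \<longrightarrow>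
             \<bar>W2 c d (r n) n (\<lambda>i. X i \<omega>) - w d\<bar> < \<bar>W2 c d (r n) n (\<lambda>i. X i \<omega>) - w s\<bar>})
           \<longlonglongrightarrow> 1"
proof -
  interpret density_sample M X f d
    using assms(2-5) by (intro density_sample.intro density_sample_axioms.intro)
  show ?thesis
    using W2_tendsto_in_prob[OF assms(6-9)] W2_argmin_in_prob[OF assms(1,6-9)] by blast
qed

end
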